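(* Let $\Omega$ be a domain in $\mathbb{R}^3$, let $f$ be a nonvanishing scalar $C^1$-function in $\Omega$, and let $\mathbf{w}\in C^1(\Omega;\mathbb{H}(\mathbb{C}))$ be a purely vectorial solution of the equation $$D\mathbf{w}+\mathbf{w}\,\frac{Df}{f}=0 .$$ Then a solution $W$ of the equation $$DW-\frac{Df}{f}\,\overline{W}=0\quad\text{in }\Omega$$ such that $\mathbf{w}=\overset{\cdot}{W}$, where $\overset{\cdot}{W}:=D_rW-\overline{W}\,\frac{Df}{f}$, is defined by $$W=\frac12\left(f\,\mathcal{A}\!\left[\frac{\mathbf{w}}{f}\right]-\frac1f\operatorname{rot}\big(\mathbf{B}[f\mathbf{w}]\big)+\frac{\nabla h}{f}\right),$$ where $h$ is an arbitrary harmonic function in $\Omega$.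
   Context: $\mathbb{H}(\mathbb{C})$ is the algebra of complex quaternions $Q=\sum_{\alpha=0}^3Q_\alpha\mathbf{e}_\alpha$, $Q_\alpha\in\mathbb{C}$, where $\mathbf{e}_0=1$ and $\mathbf{e}_1,\mathbf{e}_2,\mathbf{e}_3$ are the standard quaternionic imaginary units ($\mathbf{e}_k^2=-1$, $\mathbf{e}_1\mathbf{e}_2=\mathbf{e}_3=-\mathbf{e}_2\mathbf{e}_1$ and cyclically); the complex imaginary unit $i$ commutes with all $\mathbf{e}_\alpha$. Write $Q=Q_0+\mathbf{Q}$ with scalar part $Q_0$ and vector part $\mathbf{Q}=\sum_{k=1}^3Q_k\mathbf{e}_k$; $Q$ is purely vectorial if $Q_0=0$, and such quaternions are identified with vectors in $\mathbb{C}^3$. Scalar functions are complex-valued. The quaternionic conjugate is $\overline{Q}=Q_0-\mathbf{Q}$ (complex conjugation is not applied). $DQ=\sum_{k=1}^3\mathbf{e}_k\,\partial_kQ$ and $D_rQ=\sum_{k=1}^3\partial_kQ\,\mathbf{e}_k$; for scalar $f$, $Df=\nabla f$ viewed as a purely vectorial quaternion. $\operatorname{rot}$ is the curl. For a complex vector field $\mathbf{\Psi}=\sum_{k=1}^3\Psi_k\mathbf{e}_k$ with $\operatorname{rot}\mathbf{\Psi}\equiv0$, $\mathcal{A}[\mathbf{\Psi}]$ denotes its scalar potential, i.e. a complex-valued function $\varphi$ with $\nabla\varphi=\mathbf{\Psi}$, reconstructed up to an arbitrary complex constant $c$ by $$\mathcal{A}[\mathbf{\Psi}](x,y,z)=\int_{x_0}^{x}\Psi_1(\xi,y_0,z_0)\,d\xi+\int_{y_0}^{y}\Psi_2(x,\eta,z_0)\,d\eta+\int_{z_0}^{z}\Psi_3(x,y,\zeta)\,d\zeta+c,$$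 where $(x_0,y_0,z_0)$ is an arbitrary point in the domain of interest. For a vector function $\mathbf{Q}$ on $\Omega$, $\mathbf{B}[\mathbf{Q}](\mathbf{x})=\frac1{4\pi}\int_\Omega\frac{\mathbf{Q}(\mathbf{y})}{|\mathbf{x}-\mathbf{y}|}\,d\mathbf{y}$.
   Formalization: As stated the claim fails (unit ball, f=1, w=e_1: DW=e_1/6); it is proved assuming that B[fw] converges absolutely in Ω and that fw has zero normal component on the boundary, i.e. its extension by zero is weakly divergence-free on R^3. *)

theory Defs
  imports "HOL-Analysis.Analysis"
begin

section \<open>Complex quaternions\<close>

datatype cquat = CQ (scal: complex) (vect: "complex^3")

definition cdot :: "complex^3 \<Rightarrow> complex^3 \<Rightarrow> complex"
  where "cdot u v = (\<Sum>k\<in>UNIV. u $ k * v $ k)"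

definition ccross :: "complex^3 \<Rightarrow> complex^3 \<Rightarrow> complex^3"
  where "ccross u v =
    vector [u $ 2 * v $ 3 - u $ 3 * v $ 2,
            u $ 3 * v $ 1 - u $ 1 * v $ 3,
            u $ 1 * v $ 2 - u $ 2 * v $ 1]"

lemma vector_zero_3 [simp]: "(vector [0, 0, 0] :: complex^3) = 0"
  by (simp add: vec_eq_iff forall_3)

text \<open>The pairing \<open>cdot\<close> is bilinear, not Hermitian.  The multiplication below is the
  complex-bilinear extension of the multiplication table of the units; the table itself is
  the lemma \<open>imu_table\<close>.\<close>

instantiation cquat :: ring_1
begin

definition "0 = CQ 0 0"
definition "1 = CQ 1 0"
definition "P + Q = CQ (scal P + scal Q) (vect P + vect Q)"
definition "- Q = CQ (- scal Q) (- vect Q)"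
definition "P - Q = CQ (scal P - scal Q) (vect P - vect Q)"
definition "P * Q = CQ (scal P * scal Q - cdot (vect P) (vect Q))
    (scal P *s vect Q + scal Q *s vect P + ccross (vect P) (vect Q))"

instance
  by standard
    (auto simp: zero_cquat_def one_cquat_def plus_cquat_def uminus_cquat_def minus_cquat_def
      times_cquat_def cdot_def ccross_def sum_3 vec_eq_iff forall_3 algebra_simps)

end

definition of_scalar :: "complex \<Rightarrow> cquat"
  where "of_scalar a = CQ a 0"

definition of_vec :: "complex^3 \<Rightarrow> cquat"
  where "of_vec v = CQ 0 v"

definition imu :: "3 \<Rightarrow> cquat"
  where "imu k = of_vec (axis k 1)"

text \<open>Quaternionic conjugation; complex conjugation is not applied.\<close>

definition qconj :: "cquat \<Rightarrow> cquat"
  where "qconj Q = CQ (scal Q) (- vect Q)"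

lemma imu_table:
  "imu k * imu k = - 1"
  "imu 1 * imu 2 = imu 3" "imu 2 * imu 3 = imu 1" "imu 3 * imu 1 = imu 2"
  "imu 2 * imu 1 = - imu 3" "imu 3 * imu 2 = - imu 1" "imu 1 * imu 3 = - imu 2"
  "of_scalar a * imu k = imu k * of_scalar a"
proof -
  have "k = 1 \<or> k = 2 \<or> k = 3" by (rule exhaust_3)
  then show "imu k * imu k = - 1"
    by (auto simp: imu_def of_vec_def times_cquat_def uminus_cquat_def one_cquat_def
      cdot_def ccross_def axis_def sum_3 vec_eq_iff forall_3)
qed (auto simp: imu_def of_vec_def of_scalar_def times_cquat_def uminus_cquat_def
      cdot_def ccross_def axis_def sum_3 vec_eq_iff forall_3)

lemma cquat_expansion:
  "Q = of_scalar (scal Q) + (\<Sum>k\<in>UNIV. of_scalar (vect Q $ k) * imu k)"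
  by (cases Q)
    (auto simp: imu_def of_vec_def of_scalar_def times_cquat_def plus_cquat_def
      cdot_def ccross_def axis_def sum_3 vec_eq_iff forall_3)


section \<open>Differential operators\<close>

definition partial :: "3 \<Rightarrow> (real^3 \<Rightarrow> 'b::real_normed_vector) \<Rightarrow> real^3 \<Rightarrow> 'b"
  where "partial k u x = vector_derivative (\<lambda>t. u (x + t *\<^sub>R axis k 1)) (at 0)"

definition C1_on :: "(real^3) set \<Rightarrow> (real^3 \<Rightarrow> 'b::real_normed_vector) \<Rightarrow> bool"
  where "C1_on \<Omega> u \<longleftrightarrow>
    (\<forall>x\<in>\<Omega>. u differentiable at x) \<and> (\<forall>k. continuous_on \<Omega> (partial k u))"

definition grad :: "(real^3 \<Rightarrow> complex) \<Rightarrow> real^3 \<Rightarrow> complex^3"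
  where "grad u x = (\<chi> k. partial k u x)"

definition rot :: "(real^3 \<Rightarrow> complex^3) \<Rightarrow> real^3 \<Rightarrow> complex^3"
  where "rot \<Psi> x =
    vector [partial 2 (\<lambda>y. \<Psi> y $ 3) x - partial 3 (\<lambda>y. \<Psi> y $ 2) x,
            partial 3 (\<lambda>y. \<Psi> y $ 1) x - partial 1 (\<lambda>y. \<Psi> y $ 3) x,
            partial 1 (\<lambda>y. \<Psi> y $ 2) x - partial 2 (\<lambda>y. \<Psi> y $ 1) x]"

definition harmonic_on :: "(real^3) set \<Rightarrow> (real^3 \<Rightarrow> complex) \<Rightarrow> bool"
  where "harmonic_on \<Omega> h \<longleftrightarrow>
    C1_on \<Omega> h \<and> (\<forall>k. C1_on \<Omega> (partial k h)) \<and>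
    (\<forall>x\<in>\<Omega>. (\<Sum>k\<in>UNIV. partial k (partial k h) x) = 0)"

definition qC1_on :: "(real^3) set \<Rightarrow> (real^3 \<Rightarrow> cquat) \<Rightarrow> bool"
  where "qC1_on \<Omega> Q \<longleftrightarrow> C1_on \<Omega> (\<lambda>x. scal (Q x)) \<and> C1_on \<Omega> (\<lambda>x. vect (Q x))"

definition qpartial :: "3 \<Rightarrow> (real^3 \<Rightarrow> cquat) \<Rightarrow> real^3 \<Rightarrow> cquat"
  where "qpartial k Q x = CQ (partial k (\<lambda>y. scal (Q y)) x) (partial k (\<lambda>y. vect (Q y)) x)"

definition Dl :: "(real^3 \<Rightarrow> cquat) \<Rightarrow> real^3 \<Rightarrow> cquat"
  where "Dl Q x = (\<Sum>k\<in>UNIV. imu k * qpartial k Q x)"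

definition Dr :: "(real^3 \<Rightarrow> cquat) \<Rightarrow> real^3 \<Rightarrow> cquat"
  where "Dr Q x = (\<Sum>k\<in>UNIV. qpartial k Q x * imu k)"

definition Dlog :: "(real^3 \<Rightarrow> complex) \<Rightarrow> real^3 \<Rightarrow> cquat"
  where "Dlog f x = of_scalar (1 / f x) * Dl (\<lambda>y. of_scalar (f y)) x"


section \<open>Scalar potentials\<close>

text \<open>The operator \<open>\<A>\<close> is determined only up to a constant, so it is rendered as the relation
  ``\<open>\<phi>\<close> is a value of \<open>\<A>[\<Psi>]\<close> on \<open>\<Omega>\<close>''.  The explicit formula for it is \<open>path_potential\<close>;
  it refers to values of \<open>\<Psi>\<close> inside \<open>\<Omega>\<close> only if the three-legged path lies in \<open>\<Omega>\<close>.\<close>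

definition scalar_potential ::
    "(real^3) set \<Rightarrow> (real^3 \<Rightarrow> complex^3) \<Rightarrow> (real^3 \<Rightarrow> complex) \<Rightarrow> bool"
  where "scalar_potential \<Omega> \<Psi> \<phi> \<longleftrightarrow>
    (\<forall>x\<in>\<Omega>. \<phi> differentiable at x \<and> grad \<phi> x = \<Psi> x)"

definition path_potential ::
    "real^3 \<Rightarrow> complex \<Rightarrow> (real^3 \<Rightarrow> complex^3) \<Rightarrow> real^3 \<Rightarrow> complex"
  where "path_potential p c \<Psi> x =
    (LBINT \<xi>=p $ 1..x $ 1. \<Psi> (vector [\<xi>, p $ 2, p $ 3]) $ 1) +
    (LBINT \<eta>=p $ 2..x $ 2. \<Psi> (vector [x $ 1, \<eta>, p $ 3]) $ 2) +
    (LBINT \<zeta>=p $ 3..x $ 3. \<Psi> (vector [x $ 1, x $ 2, \<zeta>]) $ 3) + c"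

definition path_admissible :: "(real^3) set \<Rightarrow> real^3 \<Rightarrow> bool"
  where "path_admissible \<Omega> p \<longleftrightarrow> p \<in> \<Omega> \<and> (\<forall>x\<in>\<Omega>.
    closed_segment p (vector [x $ 1, p $ 2, p $ 3]) \<subseteq> \<Omega> \<and>
    closed_segment (vector [x $ 1, p $ 2, p $ 3]) (vector [x $ 1, x $ 2, p $ 3]) \<subseteq> \<Omega> \<and>
    closed_segment (vector [x $ 1, x $ 2, p $ 3]) x \<subseteq> \<Omega>)"


section \<open>The Newtonian vector potential\<close>

definition Bop :: "(real^3) set \<Rightarrow> (real^3 \<Rightarrow> complex^3) \<Rightarrow> real^3 \<Rightarrow> complex^3"
  where "Bop \<Omega> Q x =
    (1 / (4 * pi)) *\<^sub>R (LINT y:\<Omega>|lborel. (1 / norm (x - y)) *\<^sub>R Q y)"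

definition Bop_defined :: "(real^3) set \<Rightarrow> (real^3 \<Rightarrow> complex^3) \<Rightarrow> bool"
  where "Bop_defined \<Omega> Q \<longleftrightarrow>
    (\<forall>x\<in>\<Omega>. set_integrable lborel \<Omega> (\<lambda>y. (1 / norm (x - y)) *\<^sub>R Q y))"

text \<open>The curl of \<open>B[Q]\<close> is a right inverse of the curl at a divergence-free \<open>Q\<close> only up to the
  gradient of \<open>div B[Q]\<close>, which is the potential of the boundary flux of \<open>Q\<close>: for
  \<open>Q = e\<^sub>1\<close> on the unit ball, \<open>rot (rot (B[Q])) = (2/3) e\<^sub>1\<close>.  The following condition says, without
  any regularity of the boundary, that \<open>Q\<close> has zero normal component there: the extension of
  \<open>Q\<close> by zero is weakly divergence-free on the whole space.  For \<open>\<Omega> = UNIV\<close> it holds for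
  every divergence-free \<open>C\<^sup>1\<close> field.  Test functions need not vanish near the
  boundary of \<open>\<Omega>\<close>.\<close>

definition zero_normal_trace :: "(real^3) set \<Rightarrow> (real^3 \<Rightarrow> complex^3) \<Rightarrow> bool"
  where "zero_normal_trace \<Omega> Q \<longleftrightarrow>
    (\<forall>\<eta>::real^3 \<Rightarrow> real. C1_on UNIV \<eta> \<and> (\<exists>K. compact K \<and> (\<forall>x. x \<notin> K \<longrightarrow> \<eta> x = 0)) \<longrightarrow>
      (LINT y:\<Omega>|lborel. (\<Sum>k\<in>UNIV. partial k \<eta> y *\<^sub>R Q y $ k)) = 0)"

end

theory Submission
  imports Defs
begin

text \<open>
  Write \<open>v\<close> for the vector part of \<open>w\<close>. The vector part of the equation for \<open>w\<close> says that
  \<open>v / f\<close> is curl-free, which makes the path potential work. For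
  \<open>W = (f \<phi> + (\<nabla>h - C) / f) / 2\<close> both equations reduce to \<open>\<nabla>\<phi> = v / f\<close>, \<open>div C = 0\<close> and
  \<open>rot C = f v\<close>, so everything hinges on showing that \<open>C = rot B[Q]\<close>, \<open>Q = f v\<close>, is a
  \<open>C\<^sup>1\<close> solution of the last two.

  The kernel \<open>1 / |z|\<close> is replaced by \<open>1 / sqrt (|z|\<^sup>2 + \<epsilon>\<^sup>2)\<close>, whose convolution with \<open>Q\<close> can be
  differentiated freely. As \<open>\<epsilon>\<close> tends to 0 the derivatives of order at most two converge locally
  uniformly: in the second derivatives one subtracts \<open>\<chi> Q(x)\<close> with a cutoff \<open>\<chi>\<close> and moves one
  derivative from the kernel to \<open>\<chi>\<close>, so that only the Lipschitz continuity of \<open>Q\<close> is needed. The trace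
  of the limit is \<open>-4 \<pi> Q\<close>, by one explicit radial integral. Finally \<open>div B[Q] = 0\<close> because
  the truncated regularised kernel is an admissible test function in the zero normal trace condition,
  and \<open>rot rot = grad div - \<Delta>\<close>.
\<close>

section \<open>Partial derivatives\<close>

text \<open>The only integrability at hand is that of Q(y) against 1/|x - y|: \<Omega> may be
  unbounded and Q uncontrolled near the boundary. Hence integrals are split at a fixed distance r
  from x. Outside, the kernel and its derivatives are dominated by a multiple of 1/|z|, which
  suffices; inside, Q is bounded and Lipschitz, and |z|^-2 is still integrable. Second derivatives
  of the kernel have size |z|^-3, which is not integrable; the difference between Q(y) and the
  cut-off value Q(x) supplies the missing factor |x - y|, while the subtracted term integrates to a
  constant matrix times Q(x). The regularisation is there because differentiation under the integral
  is immediate for bounded kernels with bounded derivatives; the exact kernel then enters through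
  uniform limits alone. The equation -\<Delta> B[Q] = Q is local, but div B[Q] = 0 depends on the
  flux of Q through the boundary. This is why the test functions must be allowed not to vanish
  there: the regularised kernel is cut off far away only.\<close>

lemma bounded_linear_sum_nth: "bounded_linear (\<lambda>h::real^'n. \<Sum>k\<in>UNIV. h $ k *\<^sub>R c k)"
  by (intro bounded_linear_sum bounded_linear_compose[OF bounded_linear_scaleR_left bounded_linear_vec_nth])

lemma sum_axis_nth:
  fixes c :: "'n::finite \<Rightarrow> 'b::real_vector"
  shows "(\<Sum>k\<in>UNIV. (axis j 1 :: real^'n) $ k *\<^sub>R c k) = c j"
proof -
  have "(\<Sum>k\<in>UNIV. (axis j 1 :: real^'n) $ k *\<^sub>R c k) = (\<Sum>k\<in>UNIV. if k = j then c k else 0)"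
    by (rule sum.cong) (auto simp: axis_def)
  then show ?thesis
    by simp
qed

lemma partial_eq:
  assumes "(u has_derivative u') (at x)"
  shows "partial k u x = u' (axis k 1)"
proof -
  have "(\<lambda>t. x + t *\<^sub>R axis k 1 :: real^3) = (\<lambda>t. t *\<^sub>R axis k 1 + x)"
    by auto
  have "((\<lambda>t. u (x + t *\<^sub>R axis k 1)) has_derivative (\<lambda>t. u' (t *\<^sub>R axis k 1))) (at 0)"
    by (rule has_derivative_compose[where g=u and f="\<lambda>t. x + t *\<^sub>R axis k 1"])
       (auto intro!: derivative_eq_intros assms)
  moreover have "u' (t *\<^sub>R axis k 1) = t *\<^sub>R u' (axis k 1)" for t
    by (rule linear_cmul[OF has_derivative_linear[OF assms]])
  ultimately show ?thesis
    unfolding partial_def by (intro vector_derivative_at) (simp add: has_vector_derivative_def)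
qed

lemma partial_eq_coeff:
  assumes "(u has_derivative (\<lambda>h. \<Sum>k\<in>UNIV. h $ k *\<^sub>R g k)) (at x)"
  shows "partial k u x = g k"
  using partial_eq[OF assms] by (simp add: sum_axis_nth)

lemma has_derivative_partials:
  assumes "u differentiable at x"
  shows "(u has_derivative (\<lambda>h. \<Sum>k\<in>UNIV. h $ k *\<^sub>R partial k u x)) (at x)"
proof -
  obtain u' where u': "(u has_derivative u') (at x)"
    using assms by (auto simp: differentiable_def)
  have "u' h = (\<Sum>k\<in>UNIV. h $ k *\<^sub>R partial k u x)" for h
  proof -
    have "u' h = u' (\<Sum>k\<in>UNIV. h $ k *\<^sub>R axis k 1)"
      by (simp add: basis_expansion flip: scalar_mult_eq_scaleR)
    also have "\<dots> = (\<Sum>k\<in>UNIV. h $ k *\<^sub>R partial k u x)"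
      using has_derivative_linear[OF u'] by (simp add: linear_sum linear_cmul partial_eq[OF u'])
    finally show ?thesis .
  qed
  then have "u' = (\<lambda>h. \<Sum>k\<in>UNIV. h $ k *\<^sub>R partial k u x)" ..
  then show ?thesis
    using u' by simp
qed

lemma C1_onI:
  assumes "\<And>x. x \<in> \<Omega> \<Longrightarrow> (u has_derivative (\<lambda>h. \<Sum>k\<in>UNIV. h $ k *\<^sub>R g k x)) (at x)"
    and "\<And>k. continuous_on \<Omega> (g k)"
  shows "C1_on \<Omega> u"
  unfolding C1_on_def
proof (intro conjI allI ballI)
  show "u differentiable at x" if "x \<in> \<Omega>" for x
    using assms(1)[OF that] by (auto simp: differentiable_def)
  show "continuous_on \<Omega> (partial k u)" for k
    using assms(2)[of k] by (rule continuous_on_eq) (simp add: partial_eq_coeff[OF assms(1)])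
qed

lemma C1_on_differentiable: "C1_on \<Omega> u \<Longrightarrow> x \<in> \<Omega> \<Longrightarrow> u differentiable at x"
  by (simp add: C1_on_def)

lemma C1_on_partial: "C1_on \<Omega> u \<Longrightarrow> continuous_on \<Omega> (partial k u)"
  by (simp add: C1_on_def)

lemma C1_on_continuous: "C1_on \<Omega> u \<Longrightarrow> continuous_on \<Omega> u"
  unfolding C1_on_def continuous_on_eq_continuous_within
  by (meson continuous_at_imp_continuous_at_within differentiable_imp_continuous_within)

lemma partial_bounded_linear:
  assumes "bounded_linear L" "u differentiable at x"
  shows "partial k (\<lambda>y. L (u y)) x = L (partial k u x)"
proof -
  obtain u' where u': "(u has_derivative u') (at x)"
    using assms by (auto simp: differentiable_def)
  from partial_eq[OF u'] partial_eq[OF bounded_linear.has_derivative[OF assms(1) u']] show ?thesis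
    by simp
qed

lemma differentiable_bounded_linear:
  assumes "bounded_linear L" "u differentiable at x"
  shows "(\<lambda>y. L (u y)) differentiable at x"
  using assms(2) bounded_linear.has_derivative[OF assms(1)] by (fastforce simp: differentiable_def)

lemma C1_on_bounded_linear:
  assumes "bounded_linear L" "C1_on \<Omega> u"
  shows "C1_on \<Omega> (\<lambda>y. L (u y))"
  unfolding C1_on_def
proof (intro conjI allI ballI)
  show "(\<lambda>y. L (u y)) differentiable at x" if "x \<in> \<Omega>" for x
    using assms that by (auto intro: differentiable_bounded_linear C1_on_differentiable)
  show "continuous_on \<Omega> (partial k (\<lambda>y. L (u y)))" for k
    by (rule continuous_on_eq[OF bounded_linear.continuous_on[OF assms(1) C1_on_partial[OF assms(2)]]])
       (simp add: partial_bounded_linear assms C1_on_differentiable[OF assms(2)])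
qed

lemma vec_differentiable:
  fixes u :: "real^3 \<Rightarrow> complex^3"
  assumes "\<And>i. (\<lambda>y. u y $ i) differentiable at x"
  shows "u differentiable at x"
proof (subst differentiable_componentwise_within, intro ballI)
  fix b :: "complex^3"
  assume "b \<in> Basis"
  \<comment> \<open>The basis is the real one, so \<open>c\<close> is 1 or the imaginary
    unit.\<close>
  then obtain i c where "b = axis i c"
    by (auto simp: Basis_vec_def)
  then show "(\<lambda>y. u y \<bullet> b) differentiable at x"
    using differentiable_bounded_linear[OF bounded_linear_inner_left[of c] assms[of i]]
    by (simp add: inner_axis)
qed

lemma partial_nth:
  fixes u :: "real^3 \<Rightarrow> complex^3"
  shows "u differentiable at x \<Longrightarrow> partial k (\<lambda>y. u y $ i) x = partial k u x $ i"
  by (rule partial_bounded_linear) (rule bounded_linear_vec_nth)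

lemma C1_on_vec_iff:
  fixes u :: "real^3 \<Rightarrow> complex^3"
  shows "C1_on \<Omega> u \<longleftrightarrow> (\<forall>i. C1_on \<Omega> (\<lambda>y. u y $ i))"
proof
  show "\<forall>i. C1_on \<Omega> (\<lambda>y. u y $ i)" if "C1_on \<Omega> u"
    using C1_on_bounded_linear[OF bounded_linear_vec_nth that] by blast
next
  assume *: "\<forall>i. C1_on \<Omega> (\<lambda>y. u y $ i)"
  have diff: "u differentiable at x" if "x \<in> \<Omega>" for x
    by (rule vec_differentiable) (rule C1_on_differentiable[OF *[rule_format] that])
  have cont: "continuous_on \<Omega> (\<lambda>x. \<chi> i. partial k (\<lambda>y. u y $ i) x)" for k
    by (intro continuous_on_vec_lambda C1_on_partial *[rule_format])
  have "continuous_on \<Omega> (partial k u)" for k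
    by (rule continuous_on_eq[OF cont[of k]]) (simp add: vec_eq_iff partial_nth diff)
  with diff show "C1_on \<Omega> u"
    by (simp add: C1_on_def)
qed

lemma
  fixes u v :: "real^3 \<Rightarrow> complex"
  assumes "u differentiable at x" "v differentiable at x"
  shows partial_add: "partial k (\<lambda>y. u y + v y) x = partial k u x + partial k v x"
    and partial_diff: "partial k (\<lambda>y. u y - v y) x = partial k u x - partial k v x"
    and partial_mult: "partial k (\<lambda>y. u y * v y) x = partial k u x * v x + u x * partial k v x"
    and partial_divide: "v x \<noteq> 0 \<Longrightarrow>
      partial k (\<lambda>y. u y / v y) x = (partial k u x * v x - u x * partial k v x) / (v x)\<^sup>2"
proof -
  obtain u' v' where d: "(u has_derivative u') (at x)" "(v has_derivative v') (at x)"
    using assms unfolding differentiable_def by blast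
  note p = partial_eq[OF d(1)] partial_eq[OF d(2)]
  show "partial k (\<lambda>y. u y + v y) x = partial k u x + partial k v x"
    by (simp only: p partial_eq[OF has_derivative_add[OF d]] add.commute)
  show "partial k (\<lambda>y. u y - v y) x = partial k u x - partial k v x"
    by (simp only: p partial_eq[OF has_derivative_diff[OF d]] add.commute)
  show "partial k (\<lambda>y. u y * v y) x = partial k u x * v x + u x * partial k v x"
    by (simp only: p partial_eq[OF has_derivative_mult[OF d]] add.commute)
  show "partial k (\<lambda>y. u y / v y) x = (partial k u x * v x - u x * partial k v x) / (v x)\<^sup>2" if "v x \<noteq> 0"
    unfolding p partial_eq[OF has_derivative_divide[OF d that]]
    using that by (simp add: divide_simps power2_eq_square)
qed

lemma
  fixes u v :: "real^3 \<Rightarrow> complex"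
  assumes u: "C1_on \<Omega> u" and v: "C1_on \<Omega> v"
  shows C1_on_diff: "C1_on \<Omega> (\<lambda>y. u y - v y)"
    and C1_on_mult: "C1_on \<Omega> (\<lambda>y. u y * v y)"
    and C1_on_divide: "\<forall>x\<in>\<Omega>. v x \<noteq> 0 \<Longrightarrow> C1_on \<Omega> (\<lambda>y. u y / v y)"
proof -
  note c = C1_on_continuous[OF u] C1_on_continuous[OF v] C1_on_partial[OF u] C1_on_partial[OF v]
  note d = C1_on_differentiable[OF u] C1_on_differentiable[OF v]
  show "C1_on \<Omega> (\<lambda>y. u y - v y)"
    unfolding C1_on_def
  proof (intro conjI allI ballI)
    show "(\<lambda>y. u y - v y) differentiable at x" if "x \<in> \<Omega>" for x
      by (intro derivative_intros d that)
    have "continuous_on \<Omega> (\<lambda>x. partial k u x - partial k v x)" for k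
      by (intro continuous_intros c)
    then show "continuous_on \<Omega> (partial k (\<lambda>y. u y - v y))" for k
      by (rule continuous_on_eq) (simp add: partial_diff d)
  qed
  show "C1_on \<Omega> (\<lambda>y. u y * v y)"
    unfolding C1_on_def
  proof (intro conjI allI ballI)
    show "(\<lambda>y. u y * v y) differentiable at x" if "x \<in> \<Omega>" for x
      by (intro derivative_intros d that)
    have "continuous_on \<Omega> (\<lambda>x. partial k u x * v x + u x * partial k v x)" for k
      by (intro continuous_intros c)
    then show "continuous_on \<Omega> (partial k (\<lambda>y. u y * v y))" for k
      by (rule continuous_on_eq) (simp add: partial_mult d)
  qed
  show "C1_on \<Omega> (\<lambda>y. u y / v y)" if nz: "\<forall>x\<in>\<Omega>. v x \<noteq> 0"
    unfolding C1_on_def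
  proof (intro conjI allI ballI)
    show "(\<lambda>y. u y / v y) differentiable at x" if "x \<in> \<Omega>" for x
      using that nz by (intro derivative_intros d) auto
    have "continuous_on \<Omega> (\<lambda>x. (partial k u x * v x - u x * partial k v x) / (v x)\<^sup>2)" for k
      using nz by (intro continuous_intros c) auto
    then show "continuous_on \<Omega> (partial k (\<lambda>y. u y / v y))" for k
      by (rule continuous_on_eq) (simp add: partial_divide d nz)
  qed
qed

section \<open>Convolutions: reflection, differentiation and continuity under the integral\<close>

lemma lborel_distr_reflect: "distr lborel borel (\<lambda>y. x - y) = (lborel :: 'a::euclidean_space measure)"
  using lborel_affine[of "-1" x] by (simp add: density_1)

lemma
  fixes f :: "'a::euclidean_space \<Rightarrow> 'b::{banach, second_countable_topology}"
  assumes "f \<in> borel_measurable borel"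
  shows integral_reflect: "(LINT y|lborel. f (x - y)) = (LINT y|lborel. f y)"
    and integrable_reflect: "integrable lborel (\<lambda>y. f (x - y)) \<longleftrightarrow> integrable lborel f"
proof -
  show "(LINT y|lborel. f (x - y)) = (LINT y|lborel. f y)"
    using integral_distr[of "\<lambda>y. x - y" lborel borel f] assms by (simp add: lborel_distr_reflect)
  show "integrable lborel (\<lambda>y. f (x - y)) \<longleftrightarrow> integrable lborel f"
    using integrable_distr_eq[of "\<lambda>y. x - y" lborel borel f] assms by (simp add: lborel_distr_reflect)
qed

lemma abs_sum_nth_le:
  fixes h :: "real^3"
  assumes "\<And>j. \<bar>g j\<bar> \<le> M"
  shows "\<bar>\<Sum>j\<in>UNIV. h $ j *\<^sub>R g j\<bar> \<le> 3 * M * norm h"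
proof -
  have "\<bar>\<Sum>j\<in>UNIV. h $ j *\<^sub>R g j\<bar> \<le> (\<Sum>j\<in>(UNIV::3 set). norm h * M)"
    by (rule order_trans[OF sum_abs], intro sum_mono)
       (auto simp: abs_mult intro!: mult_mono component_le_norm_cart assms)
  then show ?thesis
    by (simp add: mult_ac)
qed

lemma diff_bound_unit_ball:
  fixes k :: "real^3 \<Rightarrow> real"
  assumes k: "\<And>z. (k has_derivative (\<lambda>h. \<Sum>j\<in>UNIV. h $ j *\<^sub>R g j z)) (at z)"
    and G: "\<And>z \<xi> j. norm (\<xi> - z) \<le> 1 \<Longrightarrow> \<bar>g j \<xi>\<bar> \<le> G z"
    and "norm (\<xi> - z) \<le> 1"
  shows "\<bar>k \<xi> - k z\<bar> \<le> 3 * G z * norm (\<xi> - z)"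
proof -
  have "norm (k \<xi> - k z) \<le> 3 * G z * norm (\<xi> - z)"
  proof (rule differentiable_bound[where S="cball z 1"])
    show "(k has_derivative (\<lambda>h. \<Sum>j\<in>UNIV. h $ j *\<^sub>R g j \<zeta>)) (at \<zeta> within cball z 1)" for \<zeta>
      by (rule has_derivative_at_withinI[OF k])
    show "onorm (\<lambda>h::real^3. \<Sum>j\<in>UNIV. h $ j *\<^sub>R g j \<zeta>) \<le> 3 * G z" if "\<zeta> \<in> cball z 1" for \<zeta>
      unfolding real_norm_def[symmetric]
    proof (rule onorm_le)
      have "norm (\<zeta> - z) \<le> 1"
        using that by (simp add: dist_norm norm_minus_commute)
      then show "norm (\<Sum>j\<in>UNIV. (h::real^3) $ j *\<^sub>R g j \<zeta>) \<le> 3 * G z * norm h" for h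
        unfolding real_norm_def by (intro abs_sum_nth_le G)
    qed
  qed (use assms in \<open>auto simp: dist_norm norm_minus_commute\<close>)
  then show ?thesis
    by simp
qed

text \<open>Dominated convergence applied to the remainder of the total derivative. The majorant
  \<open>G z\<close> bounds the derivatives of \<open>k\<close> on the whole unit ball around
  \<open>z\<close>, so by the mean value theorem one integrable function dominates all increments of
  length at most 1.\<close>

lemma has_derivative_convolution:
  fixes k :: "real^3 \<Rightarrow> real" and q :: "real^3 \<Rightarrow> 'b::{banach, second_countable_topology}"
  assumes k: "\<And>z. (k has_derivative (\<lambda>h. \<Sum>j\<in>UNIV. h $ j *\<^sub>R g j z)) (at z)"
    and g: "\<And>j. continuous_on UNIV (g j)"
    and G: "\<And>z \<xi> j. norm (\<xi> - z) \<le> 1 \<Longrightarrow> \<bar>g j \<xi>\<bar> \<le> G z"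
    and q [measurable]: "q \<in> borel_measurable borel"
    and kq: "integrable lborel (\<lambda>y. k (x - y) *\<^sub>R q y)"
    and Gq: "integrable lborel (\<lambda>y. G (x - y) * norm (q y))"
  shows "((\<lambda>x. LINT y|lborel. k (x - y) *\<^sub>R q y) has_derivative
    (\<lambda>h. \<Sum>j\<in>UNIV. h $ j *\<^sub>R (LINT y|lborel. g j (x - y) *\<^sub>R q y))) (at x)"
proof -
  have "continuous_on UNIV k"
    by (rule has_derivative_continuous_on) (rule has_derivative_at_withinI[OF k])
  then have [measurable]: "k \<in> borel_measurable borel"
    by (rule borel_measurable_continuous_onI)
  have [measurable]: "g j \<in> borel_measurable borel" for j
    using g by (rule borel_measurable_continuous_onI)
  have gq: "integrable lborel (\<lambda>y. g j (x - y) *\<^sub>R q y)" for j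
  proof (rule Bochner_Integration.integrable_bound[OF Gq])
    have "\<bar>g j z\<bar> \<le> \<bar>G z\<bar>" for z
      using G[of z z j] by simp
    then show "AE y in lborel. norm (g j (x - y) *\<^sub>R q y) \<le> norm (G (x - y) * norm (q y))"
      by (simp add: abs_mult mult_right_mono)
  qed measurable
  have kdiff: "\<bar>k (X - y) - k (x - y)\<bar> \<le> 3 * G (x - y) * norm (X - x)" if "norm (X - x) \<le> 1" for X y :: "real^3"
    using diff_bound_unit_ball[OF k G, where \<xi>="X - y" and z="x - y"] that by simp
  have kXq: "integrable lborel (\<lambda>y. k (X - y) *\<^sub>R q y)" if "norm (X - x) \<le> 1" for X
  proof -
    have "integrable lborel (\<lambda>y. (k (X - y) - k (x - y)) *\<^sub>R q y)"
    proof (rule Bochner_Integration.integrable_bound)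
      show "integrable lborel (\<lambda>y. (3 * norm (X - x)) * (G (x - y) * norm (q y)))"
        using Gq by simp
      show "AE y in lborel. norm ((k (X - y) - k (x - y)) *\<^sub>R q y)
          \<le> norm ((3 * norm (X - x)) * (G (x - y) * norm (q y)))"
      proof (rule AE_I2)
        fix y
        have "\<bar>k (X - y) - k (x - y)\<bar> * norm (q y) \<le> 3 * G (x - y) * norm (X - x) * norm (q y)"
          by (intro mult_right_mono kdiff that norm_ge_zero)
        also have "\<dots> = (3 * norm (X - x)) * (G (x - y) * norm (q y))"
          by simp
        also have "\<dots> \<le> norm ((3 * norm (X - x)) * (G (x - y) * norm (q y)))"
          unfolding real_norm_def by (rule abs_ge_self)
        finally show "norm ((k (X - y) - k (x - y)) *\<^sub>R q y)
            \<le> norm ((3 * norm (X - x)) * (G (x - y) * norm (q y)))"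
          by simp
      qed
    qed measurable
    from Bochner_Integration.integrable_add[OF this kq] show ?thesis
      by (simp add: scaleR_diff_left)
  qed
  let ?T = "\<lambda>x. LINT y|lborel. k (x - y) *\<^sub>R q y"
  let ?T' = "\<lambda>h::real^3. \<Sum>j\<in>UNIV. h $ j *\<^sub>R (LINT y|lborel. g j (x - y) *\<^sub>R q y)"
  \<comment> \<open>Restricting to \<open>ball x 1\<close> keeps the increments in the range where
    the majorant is valid; the ball is open, so the derivative is unchanged.\<close>
  have "((\<lambda>X. (1 / norm (X - x)) *\<^sub>R (?T X - (?T x + ?T' (X - x)))) \<longlongrightarrow> 0) (at x within ball x 1)"
    unfolding tendsto_at_iff_sequentially o_def
  proof (intro allI impI)
    fix X assume X: "\<forall>i. X i \<in> ball x 1 - {x}" "X \<longlonglongrightarrow> x"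
    have X1: "norm (X i - x) \<le> 1" for i
      using X(1) by (simp add: dist_norm norm_minus_commute less_imp_le)
    define R where "R i y = (1 / norm (X i - x)) *
      (k (X i - y) - (k (x - y) + (\<Sum>j\<in>UNIV. (X i - x) $ j *\<^sub>R g j (x - y))))" for i y
    have "(LINT y|lborel. R i y *\<^sub>R q y) = (1 / norm (X i - x)) *\<^sub>R (?T (X i) - (?T x + ?T' (X i - x)))" for i
    proof -
      have eq: "R i y *\<^sub>R q y = (1 / norm (X i - x)) *\<^sub>R (k (X i - y) *\<^sub>R q y -
          (k (x - y) *\<^sub>R q y + (\<Sum>j\<in>UNIV. (X i - x) $ j *\<^sub>R (g j (x - y) *\<^sub>R q y))))" for y
        by (simp only: R_def real_scaleR_def scaleR_diff_left scaleR_add_left scaleR_sum_left flip: scaleR_scaleR)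
      show ?thesis
        unfolding eq by (simp add: kXq X1 kq gq del: scaleR_scaleR)
    qed
    moreover have "(\<lambda>i. LINT y|lborel. R i y *\<^sub>R q y) \<longlonglongrightarrow> (LINT y|(lborel :: (real^3) measure). (0::'b))"
    proof (rule integral_dominated_convergence)
      \<comment> \<open>6 = 3 + 3: the increment of \<open>k\<close> and its linear part are each
        bounded by 3 \<open>G\<close>, where 3 is the dimension.\<close>
      show "integrable lborel (\<lambda>y. 6 * (G (x - y) * norm (q y)))"
        using Gq by simp
      show "AE y in lborel. (\<lambda>i. R i y *\<^sub>R q y) \<longlonglongrightarrow> 0"
      proof (rule AE_I2)
        fix y
        have "((\<lambda>\<xi>. (1 / norm (\<xi> - (x - y))) *\<^sub>R (k \<xi> - (k (x - y) +
            (\<Sum>j\<in>UNIV. (\<xi> - (x - y)) $ j *\<^sub>R g j (x - y))))) \<longlongrightarrow> 0) (at (x - y))"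
          using k[of "x - y"] unfolding has_derivative_within[where s=UNIV] by blast
        moreover have "(\<lambda>i. X i - y) \<longlonglongrightarrow> x - y"
          by (intro tendsto_intros X)
        ultimately have "(\<lambda>i. R i y) \<longlonglongrightarrow> 0"
          unfolding tendsto_at_iff_sequentially R_def using X(1)
          by (auto simp: o_def dest!: spec[of _ "\<lambda>i. X i - y"])
        then have "(\<lambda>i. R i y *\<^sub>R q y) \<longlonglongrightarrow> 0 *\<^sub>R q y"
          by (intro tendsto_intros)
        then show "(\<lambda>i. R i y *\<^sub>R q y) \<longlonglongrightarrow> 0"
          by simp
      qed
      show "AE y in lborel. norm (R i y *\<^sub>R q y) \<le> 6 * (G (x - y) * norm (q y))" for i
      proof (rule AE_I2)
        fix y
        have pos: "norm (X i - x) > 0"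
          using X(1) by auto
        have "\<bar>\<Sum>j\<in>UNIV. (X i - x) $ j *\<^sub>R g j (x - y)\<bar> \<le> 3 * G (x - y) * norm (X i - x)"
          by (intro abs_sum_nth_le G) simp
        with kdiff[OF X1, of i y]
        have "\<bar>k (X i - y) - (k (x - y) + (\<Sum>j\<in>UNIV. (X i - x) $ j *\<^sub>R g j (x - y)))\<bar>
            \<le> 6 * G (x - y) * norm (X i - x)"
          by linarith
        then have "\<bar>R i y\<bar> \<le> 6 * G (x - y)"
          using pos by (simp add: R_def abs_mult divide_simps mult_ac)
        then show "norm (R i y *\<^sub>R q y) \<le> 6 * (G (x - y) * norm (q y))"
          by (simp flip: mult.assoc add: mult_right_mono)
      qed
      show "(\<lambda>y. R i y *\<^sub>R q y) \<in> borel_measurable lborel" for i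
        unfolding R_def by measurable
    qed simp
    ultimately show "(\<lambda>i. (1 / norm (X i - x)) *\<^sub>R (?T (X i) - (?T x + ?T' (X i - x)))) \<longlonglongrightarrow> 0"
      by simp
  qed
  then have "(?T has_derivative ?T') (at x within ball x 1)"
    by (simp add: has_derivative_within bounded_linear_sum_nth)
  then show ?thesis
    by (simp add: at_within_open[of x "ball x 1"])
qed

lemma isCont_convolution:
  fixes g :: "real^3 \<Rightarrow> real" and q :: "real^3 \<Rightarrow> 'b::{banach, second_countable_topology}"
  assumes g: "continuous_on UNIV g"
    and G: "\<And>z \<xi>. norm (\<xi> - z) \<le> 1 \<Longrightarrow> \<bar>g \<xi>\<bar> \<le> G z"
    and q [measurable]: "q \<in> borel_measurable borel"
    and Gq: "integrable lborel (\<lambda>y. G (x - y) * norm (q y))"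
  shows "isCont (\<lambda>x. LINT y|lborel. g (x - y) *\<^sub>R q y) x"
proof -
  have [measurable]: "g \<in> borel_measurable borel"
    using g by (rule borel_measurable_continuous_onI)
  have "((\<lambda>X. LINT y|lborel. g (X - y) *\<^sub>R q y) \<longlongrightarrow> (LINT y|lborel. g (x - y) *\<^sub>R q y)) (at x within ball x 1)"
    unfolding tendsto_at_iff_sequentially o_def
  proof (intro allI impI)
    fix X assume X: "\<forall>i. X i \<in> ball x 1 - {x}" "X \<longlonglongrightarrow> x"
    show "(\<lambda>i. LINT y|lborel. g (X i - y) *\<^sub>R q y) \<longlonglongrightarrow> (LINT y|lborel. g (x - y) *\<^sub>R q y)"
    proof (rule integral_dominated_convergence[OF _ _ Gq])
      show "AE y in lborel. (\<lambda>i. g (X i - y) *\<^sub>R q y) \<longlonglongrightarrow> g (x - y) *\<^sub>R q y"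
      proof (rule AE_I2)
        fix y
        have "(\<lambda>i. g (X i - y)) \<longlonglongrightarrow> g (x - y)"
          using g by (intro continuous_on_tendsto_compose[of UNIV g] tendsto_intros X) auto
        then show "(\<lambda>i. g (X i - y) *\<^sub>R q y) \<longlonglongrightarrow> g (x - y) *\<^sub>R q y"
          by (intro tendsto_intros)
      qed
      have "norm (X i - x) \<le> 1" for i
        using X(1) by (simp add: dist_norm norm_minus_commute less_imp_le)
      then show "AE y in lborel. norm (g (X i - y) *\<^sub>R q y) \<le> G (x - y) * norm (q y)" for i
        by (auto intro!: mult_right_mono AE_I2 G)
    qed measurable
  qed
  then show ?thesis
    by (simp add: isCont_def at_within_open[of x "ball x 1"])
qed

text \<open>Differentiate \<open>\<integral>u(x - y) dy\<close>, which does not depend on \<open>x\<close>.\<close>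

lemma integral_partial_compact_support:
  fixes u :: "real^3 \<Rightarrow> real"
  assumes u: "\<And>z. (u has_derivative (\<lambda>h. \<Sum>j\<in>UNIV. h $ j *\<^sub>R g j z)) (at z)"
    and g: "\<And>j. continuous_on UNIV (g j)"
    and supp: "\<And>z j. norm z \<ge> r \<Longrightarrow> g j z = 0" "\<And>z. norm z \<ge> r \<Longrightarrow> u z = 0"
  shows "(LINT z|lborel. g j z) = 0"
proof -
  have cu: "continuous_on UNIV u"
    by (rule has_derivative_continuous_on) (rule has_derivative_at_withinI[OF u])
  then have [measurable]: "u \<in> borel_measurable borel"
    by (rule borel_measurable_continuous_onI)
  have [measurable]: "g j \<in> borel_measurable borel" for j
    using g by (rule borel_measurable_continuous_onI)
  have ind: "integrable lborel (\<lambda>z::real^3. c * indicator (cball 0 R) z :: real)" for R c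
    by (intro integrable_mult_right integrable_real_indicator) (use emeasure_lborel_cball_finite[of "0::real^3" R] in auto)
  have "\<exists>B. \<forall>z\<in>cball 0 r. \<bar>v z\<bar> \<le> B" if "continuous_on UNIV v" for v :: "real^3 \<Rightarrow> real"
    using compact_imp_bounded[OF compact_continuous_image[OF continuous_on_subset[OF that] compact_cball]]
    unfolding bounded_iff by (metis image_eqI real_norm_def subset_UNIV)
  then have bd: "\<exists>B. \<forall>z. \<bar>v z\<bar> \<le> B" if "continuous_on UNIV v" "\<And>z. norm z \<ge> r \<Longrightarrow> v z = 0"
    for v :: "real^3 \<Rightarrow> real"
    using that by (metis abs_ge_zero abs_zero mem_cball_0 order_trans linorder_le_cases)
  obtain B where B: "\<And>z. \<bar>u z\<bar> \<le> B"
    using bd[OF cu supp(2)] by blast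
  have "\<forall>j. \<exists>B. \<forall>z. \<bar>g j z\<bar> \<le> B"
    using bd[OF g supp(1)] by blast
  then obtain C where C: "\<And>j z. \<bar>g j z\<bar> \<le> C j"
    by metis
  define D where "D = Max (range C)"
  have D: "\<bar>g j z\<bar> \<le> D" for j z
    using order_trans[OF C[of j z] Max_ge[of "range C" "C j"]] by (simp add: D_def)
  have uint: "integrable lborel u"
  proof (rule Bochner_Integration.integrable_bound[OF ind[of B r]])
    have "\<bar>u z\<bar> \<le> \<bar>B * indicator (cball 0 r) z\<bar>" for z
      using B[of z] supp(2)[of z] by (cases "norm z \<le> r") (auto simp: indicator_def)
    then show "AE z in lborel. norm (u z) \<le> norm (B * indicator (cball 0 r) z)"
      by simp
  qed measurable
  have "((\<lambda>x. LINT y|lborel. u (x - y) *\<^sub>R (1::real)) has_derivative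
    (\<lambda>h. \<Sum>j\<in>UNIV. h $ j *\<^sub>R (LINT y|lborel. g j (x - y) *\<^sub>R (1::real)))) (at x)" for x
  \<comment> \<open>The density is the constant 1. A unit ball around \<open>z\<close> meets the
    support only if \<open>norm z\<close> is at most \<open>r + 1\<close>, hence the enlarged
    radius.\<close>
  proof (rule has_derivative_convolution[OF u g, where G="\<lambda>z. D * indicator (cball 0 (r + 1)) z"])
    show "\<bar>g j \<xi>\<bar> \<le> D * indicator (cball 0 (r + 1)) z" if "norm (\<xi> - z) \<le> 1" for \<xi> z j
    proof (cases "norm \<xi> \<ge> r")
      case True
      then show ?thesis
        using supp(1)[OF True, of j] D[of j \<xi>] by (simp add: indicator_def)
    next
      case False
      have "norm z \<le> norm \<xi> + norm (\<xi> - z)"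
        by (metis norm_minus_commute norm_triangle_sub)
      with False that D[of j \<xi>] show ?thesis
        by (simp add: indicator_def)
    qed
    show "integrable lborel (\<lambda>y. u (x - y) *\<^sub>R (1::real))"
      using integrable_reflect[of u x] uint by simp
    show "integrable lborel (\<lambda>y. D * indicator (cball 0 (r + 1)) (x - y) * norm (1::real))"
      using integrable_reflect[of "\<lambda>z. D * indicator (cball 0 (r + 1)) z" x] ind by simp
  qed auto
  then have "((\<lambda>x::real^3. LINT y|lborel. u y) has_derivative
    (\<lambda>h. \<Sum>j\<in>UNIV. h $ j *\<^sub>R (LINT y|lborel. g j y))) (at 0)"
    by (simp add: integral_reflect[of u] integral_reflect[of "g _"])
  moreover have "((\<lambda>x::real^3. LINT y|lborel. u y) has_derivative (\<lambda>h. 0)) (at 0)"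
    by (rule has_derivative_const)
  ultimately have "(\<lambda>h::real^3. \<Sum>j\<in>UNIV. h $ j *\<^sub>R (LINT y|lborel. g j y)) = (\<lambda>h. 0)"
    by (rule has_derivative_unique)
  from fun_cong[OF this, of "axis j 1"] show ?thesis
    by (simp only: sum_axis_nth)
qed

section \<open>The regularised Newton kernel\<close>

text \<open>For \<open>e = 0\<close> this is 1/|z| with the value 0 at the origin, because
  \<open>inverse 0 = 0\<close>. The exact kernel thus shares all formulas with the regularised ones,
  and comparisons with it need z nonzero, that is, they hold almost everywhere.\<close>

definition soft :: "real \<Rightarrow> real^3 \<Rightarrow> real"
  where "soft e z = inverse (sqrt (z \<bullet> z + e\<^sup>2))"

text \<open>\<open>soft1\<close> and \<open>soft2\<close> are the first and second partial
  derivatives of \<open>soft e\<close>, written as explicit expressions in \<open>z\<close> and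
  \<open>soft e z\<close> rather than through \<open>partial\<close>, so that they also make sense
  at \<open>e = 0\<close>.\<close>

definition soft1 :: "real \<Rightarrow> 3 \<Rightarrow> real^3 \<Rightarrow> real"
  where "soft1 e k z = - (z $ k * soft e z ^ 3)"

definition soft2 :: "real \<Rightarrow> 3 \<Rightarrow> 3 \<Rightarrow> real^3 \<Rightarrow> real"
  where "soft2 e j k z = 3 * z $ j * z $ k * soft e z ^ 5 - (if j = k then soft e z ^ 3 else 0)"

lemma soft_nonneg [simp]: "0 \<le> soft e z"
  by (simp add: soft_def)

lemma soft_0: "soft 0 z = inverse (norm z)"
  by (simp add: soft_def norm_eq_sqrt_inner)

lemma norm_mult_soft_0: "z \<noteq> 0 \<Longrightarrow> norm z * soft 0 z = 1"
  by (simp add: soft_0)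

lemma soft_le_soft_0:
  assumes "z \<noteq> 0"
  shows "soft e z \<le> soft 0 z"
  unfolding soft_def using assms by (intro le_imp_inverse_le) auto

lemma norm_mult_soft_le: "norm z * soft e z \<le> 1"
proof (cases "z = 0")
  case False
  have "norm z * soft e z \<le> norm z * soft 0 z"
    by (intro mult_left_mono soft_le_soft_0 False) auto
  then show ?thesis
    using norm_mult_soft_0[OF False] by simp
qed simp

text \<open>The constant adds the two bounds \<open>soft e z \<le> 1 / e\<close> and
  \<open>norm z * soft e z \<le> 1\<close>. The weight 1/(1 + |z|) has no singularity and changes
  only by a factor when its centre moves.\<close>

lemma soft_le_weight:
  assumes "e > 0"
  shows "soft e z \<le> (1 + 1 / e) / (1 + norm z)"
proof -
  have "e \<le> sqrt (z \<bullet> z + e\<^sup>2)"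
    using assms by (intro real_le_rsqrt) simp
  then have "soft e z \<le> 1 / e"
    unfolding soft_def inverse_eq_divide using assms by (intro frac_le) auto
  then have "soft e z * (1 + norm z) \<le> 1 + 1 / e"
    using norm_mult_soft_le[of z e] by (simp add: algebra_simps)
  then show ?thesis
    by (simp add: pos_le_divide_eq add_pos_nonneg)
qed

lemma has_derivative_soft:
  assumes "e \<noteq> 0"
  shows "(soft e has_derivative (\<lambda>h. - (soft e z ^ 3 * (z \<bullet> h)))) (at z)"
proof -
  have pos: "0 < z \<bullet> z + e\<^sup>2"
    using assms by (simp add: add_nonneg_pos)
  have "((\<lambda>z. z \<bullet> z + e\<^sup>2) has_derivative (\<lambda>h. 2 * (z \<bullet> h))) (at z)"
    by (auto intro!: derivative_eq_intros simp: inner_commute)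
  from has_derivative_real_sqrt[OF pos this]
  have "((\<lambda>z. inverse (sqrt (z \<bullet> z + e\<^sup>2))) has_derivative
      (\<lambda>h. - (inverse (sqrt (z \<bullet> z + e\<^sup>2)) *
        (2 * (z \<bullet> h) * (inverse (sqrt (z \<bullet> z + e\<^sup>2)) / 2)) * inverse (sqrt (z \<bullet> z + e\<^sup>2))))) (at z)"
    by (rule Deriv.has_derivative_inverse[rotated]) (use pos in simp)
  then show ?thesis
    unfolding soft_def[abs_def] by (simp add: power3_eq_cube mult_ac)
qed

lemma inner_axis_sum: "(\<Sum>k\<in>UNIV. h $ k *\<^sub>R (c * z $ k)) = c * (z \<bullet> h)" for z h :: "real^3"
  by (simp add: inner_vec_def sum_distrib_left mult_ac)

lemma has_derivative_soft_sum:
  assumes "e \<noteq> 0"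
  shows "(soft e has_derivative (\<lambda>h. \<Sum>k\<in>UNIV. h $ k *\<^sub>R soft1 e k z)) (at z)"
proof -
  have "(\<Sum>k\<in>UNIV. h $ k *\<^sub>R soft1 e k z) = - (soft e z ^ 3 * (z \<bullet> h))" for h
    using inner_axis_sum[of h "- (soft e z ^ 3)" z] by (simp add: soft1_def mult_ac)
  then show ?thesis
    using has_derivative_soft[OF assms] by simp
qed

lemma has_derivative_soft1_sum:
  assumes "e \<noteq> 0"
  shows "(soft1 e k has_derivative (\<lambda>h. \<Sum>j\<in>UNIV. h $ j *\<^sub>R soft2 e j k z)) (at z)"
proof -
  have "(soft1 e k has_derivative
      (\<lambda>h. - (z $ k * (3 * (- (soft e z ^ 3 * (z \<bullet> h))) * soft e z ^ 2) + h $ k * soft e z ^ 3))) (at z)"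
    unfolding soft1_def[abs_def]
    by (auto intro!: derivative_eq_intros has_derivative_soft assms
        bounded_linear.has_derivative[OF bounded_linear_vec_nth] simp: mult_ac)
  moreover have "(\<Sum>j\<in>UNIV. h $ j *\<^sub>R soft2 e j k z)
      = - (z $ k * (3 * (- (soft e z ^ 3 * (z \<bullet> h))) * soft e z ^ 2) + h $ k * soft e z ^ 3)" for h
  proof -
    have "(\<Sum>j\<in>UNIV. h $ j *\<^sub>R soft2 e j k z)
        = (\<Sum>j\<in>UNIV. h $ j *\<^sub>R ((3 * z $ k * soft e z ^ 5) * z $ j)) - (\<Sum>j\<in>UNIV. if j = k then h $ j * soft e z ^ 3 else 0)"
      unfolding sum_subtractf[symmetric] by (rule sum.cong) (auto simp: soft2_def algebra_simps)
    then show ?thesis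
      unfolding inner_axis_sum by (simp add: power_numeral_reduce algebra_simps)
  qed
  ultimately show ?thesis
    by simp
qed

lemma continuous_on_soft: "e \<noteq> 0 \<Longrightarrow> continuous_on S (soft e)"
  unfolding soft_def by (intro continuous_intros) (simp add: add_nonneg_eq_0_iff)

lemma continuous_on_soft1: "e \<noteq> 0 \<Longrightarrow> continuous_on S (soft1 e k)"
  unfolding soft1_def by (intro continuous_intros continuous_on_soft)

lemma continuous_on_soft2: "e \<noteq> 0 \<Longrightarrow> continuous_on S (soft2 e j k)"
  unfolding soft2_def by (cases "j = k") (auto intro!: continuous_intros continuous_on_soft)

lemma measurable_soft [measurable]:
  "soft e \<in> borel_measurable borel" "soft1 e k \<in> borel_measurable borel" "soft2 e j k \<in> borel_measurable borel"
proof -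
  have [measurable]: "(\<lambda>z::real^3. z $ k) \<in> borel_measurable borel" for k
    by (intro borel_measurable_continuous_onI continuous_intros)
  show [measurable]: "soft e \<in> borel_measurable borel"
    unfolding soft_def[abs_def] by measurable
  show "soft1 e k \<in> borel_measurable borel" "soft2 e j k \<in> borel_measurable borel"
    unfolding soft1_def[abs_def] soft2_def[abs_def] by measurable
qed

text \<open>Each coordinate in the numerator is absorbed by one factor \<open>soft e z\<close>,
  uniformly in \<open>e\<close>. All size bounds for \<open>soft1\<close> and \<open>soft2\<close>
  come from this.\<close>

lemma nth_mult_soft_le: "\<bar>z $ k\<bar> * soft e z \<le> 1"
  by (rule order_trans[OF mult_right_mono[OF component_le_norm_cart] norm_mult_soft_le]) simp

lemma abs_soft1_le: "\<bar>soft1 e k z\<bar> \<le> soft e z ^ 2"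
proof -
  have "\<bar>soft1 e k z\<bar> = (\<bar>z $ k\<bar> * soft e z) * soft e z ^ 2"
    by (simp add: soft1_def abs_mult power_numeral_reduce)
  also have "\<dots> \<le> 1 * soft e z ^ 2"
    by (intro mult_right_mono nth_mult_soft_le) simp
  finally show ?thesis
    by simp
qed

lemma abs_soft2_le: "\<bar>soft2 e j k z\<bar> \<le> 4 * soft e z ^ 3"
proof -
  have "\<bar>3 * z $ j * z $ k * soft e z ^ 5\<bar> = 3 * ((\<bar>z $ j\<bar> * soft e z) * (\<bar>z $ k\<bar> * soft e z)) * soft e z ^ 3"
    by (simp add: abs_mult power_numeral_reduce)
  also have "\<dots> \<le> 3 * (1 * 1) * soft e z ^ 3"
    by (intro mult_right_mono mult_left_mono mult_mono nth_mult_soft_le) auto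
  finally have "\<bar>3 * z $ j * z $ k * soft e z ^ 5\<bar> \<le> 3 * soft e z ^ 3"
    by simp
  moreover have "0 \<le> soft e z ^ 3"
    by simp
  ultimately show ?thesis
    unfolding soft2_def by (smt (verit))
qed

section \<open>Rate of convergence of the regularised kernels\<close>

lemma power_diff_le:
  fixes a b :: real
  assumes "0 \<le> b" "b \<le> a"
  shows "a ^ Suc m - b ^ Suc m \<le> real (Suc m) * a ^ m * (a - b)"
proof (induction m)
  case (Suc m)
  have "a ^ Suc (Suc m) - b ^ Suc (Suc m) = a * (a ^ Suc m - b ^ Suc m) + b ^ Suc m * (a - b)"
    by (simp add: algebra_simps)
  also have "\<dots> \<le> a * (real (Suc m) * a ^ m * (a - b)) + a ^ Suc m * (a - b)"
    using assms by (intro add_mono mult_left_mono mult_right_mono Suc.IH power_mono) auto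
  also have "\<dots> = real (Suc (Suc m)) * a ^ Suc m * (a - b)"
    by (simp add: algebra_simps)
  finally show ?case .
qed simp

text \<open>From sqrt(|z|^2 + e^2) \<le> |z| + e the two kernels differ by at most e / |z|^2: a gain
  of one factor \<open>e\<close> at the price of one more power of 1/|z|. Away from the origin this
  is a uniform rate.\<close>

lemma soft_power_diff:
  assumes "z \<noteq> 0" "e \<ge> 0"
  shows "\<bar>soft e z ^ Suc m - soft 0 z ^ Suc m\<bar> \<le> real (Suc m) * e * soft 0 z ^ Suc (Suc m)"
proof -
  let ?s = "sqrt (z \<bullet> z + e\<^sup>2)"
  have le: "soft e z \<le> soft 0 z"
    by (rule soft_le_soft_0[OF assms(1)])
  have s: "?s \<le> norm z + e"
    using sqrt_add_le_add_sqrt[of "z \<bullet> z" "e\<^sup>2"] assms by (simp add: norm_eq_sqrt_inner)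
  have spos: "0 < ?s"
    using assms by (simp add: add_pos_nonneg)
  have "soft 0 z - soft e z = (?s - norm z) * soft 0 z * soft e z"
    using assms spos unfolding soft_0 soft_def[of e] by (simp add: field_simps)
  also have "\<dots> \<le> e * soft 0 z * soft 0 z"
    using s le assms by (intro mult_mono) auto
  finally have d: "soft 0 z - soft e z \<le> e * soft 0 z * soft 0 z" .
  have "soft 0 z ^ Suc m - soft e z ^ Suc m \<le> real (Suc m) * soft 0 z ^ m * (soft 0 z - soft e z)"
    by (rule power_diff_le) (simp_all add: le)
  also have "\<dots> \<le> real (Suc m) * soft 0 z ^ m * (e * soft 0 z * soft 0 z)"
    by (intro mult_left_mono d) simp
  also have "\<dots> = real (Suc m) * e * soft 0 z ^ Suc (Suc m)"
    by (simp add: algebra_simps)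
  finally show ?thesis
    using power_mono[OF le, of "Suc m"] by simp
qed

lemma abs_soft1_diff_le:
  assumes "z \<noteq> 0" "e \<ge> 0"
  shows "\<bar>soft1 e k z - soft1 0 k z\<bar> \<le> 3 * e * soft 0 z ^ 3"
proof -
  have "\<bar>soft1 e k z - soft1 0 k z\<bar> = \<bar>z $ k\<bar> * \<bar>soft e z ^ 3 - soft 0 z ^ 3\<bar>"
    unfolding soft1_def abs_mult[symmetric] right_diff_distrib by simp
  also have "\<dots> \<le> \<bar>z $ k\<bar> * (3 * e * soft 0 z ^ 4)"
    using soft_power_diff[OF assms, of 2] by (intro mult_left_mono) (simp_all add: numeral_eq_Suc)
  also have "\<dots> = (\<bar>z $ k\<bar> * soft 0 z) * (3 * e * soft 0 z ^ 3)"
    by (simp add: power_numeral_reduce)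
  also have "\<dots> \<le> 1 * (3 * e * soft 0 z ^ 3)"
    using assms by (intro mult_right_mono nth_mult_soft_le) simp
  finally show ?thesis
    by simp
qed

lemma abs_soft2_diff_le:
  assumes "z \<noteq> 0" "e \<ge> 0"
  shows "\<bar>soft2 e j k z - soft2 0 j k z\<bar> \<le> 18 * e * soft 0 z ^ 4"
proof -
  have 3: "\<bar>soft e z ^ 3 - soft 0 z ^ 3\<bar> \<le> 3 * e * soft 0 z ^ 4"
    using soft_power_diff[OF assms, of 2] by (simp add: numeral_eq_Suc)
  have "\<bar>3 * z $ j * z $ k * (soft e z ^ 5 - soft 0 z ^ 5)\<bar>
      = 3 * (\<bar>z $ j\<bar> * \<bar>z $ k\<bar>) * \<bar>soft e z ^ 5 - soft 0 z ^ 5\<bar>"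
    by (simp add: abs_mult)
  also have "\<dots> \<le> 3 * (\<bar>z $ j\<bar> * \<bar>z $ k\<bar>) * (5 * e * soft 0 z ^ 6)"
    using soft_power_diff[OF assms, of 4] by (intro mult_left_mono) (simp_all add: numeral_eq_Suc)
  also have "\<dots> = 15 * ((\<bar>z $ j\<bar> * soft 0 z) * (\<bar>z $ k\<bar> * soft 0 z)) * (e * soft 0 z ^ 4)"
    by (simp add: power_numeral_reduce)
  also have "\<dots> \<le> 15 * (1 * 1) * (e * soft 0 z ^ 4)"
    using assms by (intro mult_right_mono mult_left_mono mult_mono nth_mult_soft_le) auto
  finally have 5: "\<bar>3 * z $ j * z $ k * (soft e z ^ 5 - soft 0 z ^ 5)\<bar> \<le> 15 * e * soft 0 z ^ 4"
    by simp
  have "soft2 e j k z - soft2 0 j k z = 3 * z $ j * z $ k * (soft e z ^ 5 - soft 0 z ^ 5)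
      - (if j = k then soft e z ^ 3 - soft 0 z ^ 3 else 0)"
    by (simp add: soft2_def algebra_simps)
  also have "\<bar>\<dots>\<bar> \<le> \<bar>3 * z $ j * z $ k * (soft e z ^ 5 - soft 0 z ^ 5)\<bar> + \<bar>soft e z ^ 3 - soft 0 z ^ 3\<bar>"
    by (cases "j = k") (auto intro: abs_triangle_ineq4)
  \<comment> \<open>18 = 15 + 3, and 15 is the coefficient 3 in \<open>soft2\<close> times the
    exponent 5.\<close>
  also have "\<dots> \<le> 18 * e * soft 0 z ^ 4"
    using 3 5 by simp
  finally show ?thesis .
qed

lemma soft2_commute: "soft2 e j k z = soft2 e k j z"
  by (simp add: soft2_def mult_ac)

text \<open>Harmonicity of 1/|z| off the origin. The contribution of the origin is not seen here; it
  reappears in \<open>moment_trace\<close>.\<close>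

lemma soft2_0_trace:
  assumes "z \<noteq> 0"
  shows "(\<Sum>j\<in>UNIV. soft2 0 j j z) = 0"
proof -
  have "(\<Sum>j\<in>UNIV. soft2 0 j j z) = 3 * (z \<bullet> z) * soft 0 z ^ 5 - 3 * soft 0 z ^ 3"
    by (simp add: soft2_def sum_3 inner_vec_def algebra_simps)
  also have "z \<bullet> z = (norm z)\<^sup>2"
    by (simp add: dot_square_norm)
  also have "3 * (norm z)\<^sup>2 * soft 0 z ^ 5 = 3 * (norm z * soft 0 z)\<^sup>2 * soft 0 z ^ 3"
    by (simp add: power_numeral_reduce)
  finally show ?thesis
    using norm_mult_soft_0[OF assms] by simp
qed

section \<open>Radial integrals and the cutoff function\<close>

lemma borel_balls [measurable]:
  "ball c r \<in> sets borel" "cball c r \<in> sets borel" for c :: "real^3"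
  by auto

lemma measurable_indicator_radial:
  "(\<lambda>p. indicator {norm (fst p)..r} (snd p) :: ennreal)
    \<in> borel_measurable ((lborel :: (real^3) measure) \<Otimes>\<^sub>M lborel)"
proof -
  have "(\<lambda>p :: (real^3) \<times> real. if norm (fst p) \<le> snd p \<and> snd p \<le> r then 1 else 0 :: ennreal)
      \<in> borel_measurable (lborel \<Otimes>\<^sub>M lborel)"
    by measurable
  then show ?thesis
    by (simp add: indicator_def if_distrib cong: if_cong)
qed

text \<open>A substitute for polar coordinates: a radial function written as the integral of
  \<open>\<phi>\<close> from |z| to \<open>r\<close> is integrated by exchanging the order, so that
  only volumes of balls are needed.\<close>

lemma nn_integral_radial:
  fixes \<phi> :: "real \<Rightarrow> ennreal"
  assumes [measurable]: "\<phi> \<in> borel_measurable borel"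
  shows "(\<integral>\<^sup>+z. (\<integral>\<^sup>+s. \<phi> s * indicator {norm z..r} s \<partial>lborel) \<partial>(lborel :: (real^3) measure))
    = (\<integral>\<^sup>+s. \<phi> s * ennreal (4 / 3 * pi * s ^ 3) * indicator {0..r} s \<partial>lborel)"
proof -
  have "(\<integral>\<^sup>+z. (\<integral>\<^sup>+s. \<phi> s * indicator {norm z..r} s \<partial>lborel) \<partial>(lborel :: (real^3) measure))
      = (\<integral>\<^sup>+s. (\<integral>\<^sup>+z. \<phi> s * indicator {norm z..r} s \<partial>(lborel :: (real^3) measure)) \<partial>lborel)"
    by (rule lborel_pair.Fubini'[symmetric]) (use measurable_indicator_radial[measurable] in \<open>simp add: split_beta', measurable\<close>)
  also have "\<dots> = (\<integral>\<^sup>+s. \<phi> s * ennreal (4 / 3 * pi * s ^ 3) * indicator {0..r} s \<partial>lborel)"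
  proof (rule nn_integral_cong)
    fix s
    have "(\<integral>\<^sup>+z. \<phi> s * indicator {norm z..r} s \<partial>(lborel :: (real^3) measure))
        = (\<integral>\<^sup>+z. (\<phi> s * indicator {..r} s) * indicator (cball (0::real^3) s) z \<partial>lborel)"
      by (rule nn_integral_cong) (auto simp: indicator_def)
    also have "\<dots> = \<phi> s * indicator {..r} s * emeasure lborel (cball (0::real^3) s)"
      by (rule nn_integral_cmult_indicator) simp
    \<comment> \<open>For negative \<open>s\<close> the ball is empty and both sides are 0.\<close>
    also have "\<dots> = \<phi> s * ennreal (4 / 3 * pi * s ^ 3) * indicator {0..r} s"
      by (cases "0 \<le> s") (auto simp: indicator_def emeasure_cball unit_ball_vol_3)
    finally show "(\<integral>\<^sup>+z. \<phi> s * indicator {norm z..r} s \<partial>(lborel :: (real^3) measure))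
      = \<phi> s * ennreal (4 / 3 * pi * s ^ 3) * indicator {0..r} s" .
  qed
  finally show ?thesis .
qed

lemma AE_lborel_nonzero: "AE z in lborel. z \<noteq> (c :: 'a::euclidean_space)"
  by (rule AE_I[where N="{c}"]) auto

text \<open>Inside the ball, 1/|z|^2 = 1/r^2 plus the integral of 2/s^3 from |z| to r. After the
  exchange of integrals the volume factor s^3 cancels the singularity.\<close>

lemma integrable_soft_0_square:
  assumes "r > 0"
  shows "integrable lborel (\<lambda>z::real^3. indicator (ball 0 r) z * soft 0 z ^ 2)"
proof (rule integrableI_bounded)
  have "(\<integral>\<^sup>+z. ennreal (norm (indicator (ball 0 r) z * soft 0 z ^ 2)) \<partial>(lborel :: (real^3) measure))
      \<le> (\<integral>\<^sup>+z. (ennreal (1 / r\<^sup>2) * indicator (cball 0 r) z +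
        (\<integral>\<^sup>+s. ennreal (2 / s ^ 3) * indicator {norm z..r} s \<partial>lborel)) \<partial>(lborel :: (real^3) measure))"
  proof (rule nn_integral_mono)
    fix z :: "real^3"
    show "ennreal (norm (indicator (ball 0 r) z * soft 0 z ^ 2)) \<le> ennreal (1 / r\<^sup>2) * indicator (cball 0 r) z +
        (\<integral>\<^sup>+s. ennreal (2 / s ^ 3) * indicator {norm z..r} s \<partial>lborel)"
    proof (cases "norm z < r \<and> z \<noteq> 0")
      case True
      have "(\<integral>\<^sup>+s. ennreal (2 / s ^ 3) * indicator {norm z..r} s \<partial>lborel) = ennreal (- (1 / r\<^sup>2) - - (1 / (norm z)\<^sup>2))"
      proof (rule nn_integral_FTC_Icc)
        show "((\<lambda>s. - (1 / s\<^sup>2)) has_real_derivative 2 / s ^ 3) (at s)"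
          if "s \<in> {norm z..r}" for s
        proof -
          have "s \<noteq> 0"
            using that True by (metis atLeastAtMost_iff norm_le_zero_iff)
          then show ?thesis
            by (auto intro!: derivative_eq_intros simp: power_numeral_reduce divide_simps)
        qed
        show "0 \<le> 2 / s ^ 3" if "s \<in> {norm z..r}" for s
          using that order_trans[OF norm_ge_zero, of z s] by simp
      qed (use True in auto)
      moreover have "1 / r\<^sup>2 \<le> 1 / (norm z)\<^sup>2"
        using True by (intro frac_le power_mono) auto
      ultimately show ?thesis
        using True assms by (simp add: soft_0 inverse_eq_divide power_divide flip: ennreal_plus)
    qed (auto simp: soft_0 indicator_def)
  qed
  also have "\<dots> = (\<integral>\<^sup>+z. ennreal (1 / r\<^sup>2) * indicator (cball 0 r) z \<partial>(lborel :: (real^3) measure)) +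
        (\<integral>\<^sup>+z. (\<integral>\<^sup>+s. ennreal (2 / s ^ 3) * indicator {norm z..r} s \<partial>lborel) \<partial>(lborel :: (real^3) measure))"
  proof (rule nn_integral_add)
    show "(\<lambda>z::real^3. \<integral>\<^sup>+s. ennreal (2 / s ^ 3) * indicator {norm z..r} s \<partial>lborel) \<in> borel_measurable lborel"
      by (rule lborel.borel_measurable_nn_integral) (use measurable_indicator_radial[measurable] in \<open>simp add: split_beta', measurable\<close>)
  qed measurable
  also have "\<dots> < \<infinity>"
  proof -
    have "(\<integral>\<^sup>+z. (\<integral>\<^sup>+s. ennreal (2 / s ^ 3) * indicator {norm z..r} s \<partial>lborel) \<partial>(lborel :: (real^3) measure))
        = (\<integral>\<^sup>+s. ennreal (2 / s ^ 3) * ennreal (4 / 3 * pi * s ^ 3) * indicator {0..r} s \<partial>lborel)"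
      by (rule nn_integral_radial) measurable
    also have "\<dots> \<le> (\<integral>\<^sup>+s. ennreal (8 / 3 * pi) * indicator {0..r} s \<partial>lborel)"
      by (intro nn_integral_mono) (auto simp: indicator_def simp flip: ennreal_mult)
    also have "\<dots> < \<infinity>"
      using assms by (simp add: nn_integral_cmult_indicator ennreal_mult_less_top)
    finally show ?thesis
      using emeasure_lborel_cball_finite[of "0::real^3" r]
      by (simp add: nn_integral_cmult_indicator ennreal_mult_less_top)
  qed
  finally show "(\<integral>\<^sup>+z. ennreal (norm (indicator (ball 0 r) z * soft 0 z ^ 2)) \<partial>(lborel :: (real^3) measure)) < \<infinity>" .
qed measurable

text \<open>The integrand is the contraction of the gradients of the cutoff and of the kernel, up to
  the factor 4/r^2. It is the integral of 1/s^2 + 1/r^2 from |z| to r, which reduces the value to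
  (4/3) pi (r^2/2 + r^2/4).\<close>

lemma integral_soft_0_quadratic:
  assumes "r > 0"
  shows "(LINT z|(lborel :: (real^3) measure). indicator (ball 0 r) z * (soft 0 z - norm z / r\<^sup>2)) = pi * r\<^sup>2"
proof -
  have nonneg: "0 \<le> indicator (ball 0 r) z * (soft 0 z - norm z / r\<^sup>2)" if "z \<noteq> 0" for z :: "real^3"
  proof -
    have "(norm z)\<^sup>2 \<le> r\<^sup>2" if "norm z < r"
      using that by (intro power_mono) auto
    then show ?thesis
      using that assms by (auto simp: indicator_def soft_0 field_simps power2_eq_square)
  qed
  have "(\<integral>\<^sup>+z. ennreal (indicator (ball 0 r) z * (soft 0 z - norm z / r\<^sup>2)) \<partial>(lborel :: (real^3) measure))
     = (\<integral>\<^sup>+z. (\<integral>\<^sup>+s. ennreal (1 / s\<^sup>2 + 1 / r\<^sup>2) * indicator {norm z..r} s \<partial>lborel) \<partial>(lborel :: (real^3) measure))"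
  proof (rule nn_integral_cong_AE, rule AE_mp[OF AE_lborel_nonzero AE_I2], rule impI)
    fix z :: "real^3" assume "z \<noteq> 0"
    show "ennreal (indicator (ball 0 r) z * (soft 0 z - norm z / r\<^sup>2))
        = (\<integral>\<^sup>+s. ennreal (1 / s\<^sup>2 + 1 / r\<^sup>2) * indicator {norm z..r} s \<partial>lborel)"
    proof (cases "norm z \<le> r")
      case True
      have "(\<integral>\<^sup>+s. ennreal (1 / s\<^sup>2 + 1 / r\<^sup>2) * indicator {norm z..r} s \<partial>lborel)
          = ennreal ((- (1 / r) + r / r\<^sup>2) - (- (1 / norm z) + norm z / r\<^sup>2))"
      proof (rule nn_integral_FTC_Icc)
        show "((\<lambda>s. - (1 / s) + s / r\<^sup>2) has_real_derivative 1 / s\<^sup>2 + 1 / r\<^sup>2) (at s)"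
          if "s \<in> {norm z..r}" for s
        proof -
          have "s \<noteq> 0"
            using that \<open>z \<noteq> 0\<close> by (metis atLeastAtMost_iff norm_le_zero_iff)
          then show ?thesis
            using assms by (auto intro!: derivative_eq_intros simp: power2_eq_square)
        qed
      qed (use True in auto)
      also have "(- (1 / r) + r / r\<^sup>2) - (- (1 / norm z) + norm z / r\<^sup>2) = indicator (ball 0 r) z * (soft 0 z - norm z / r\<^sup>2)"
        using assms True \<open>z \<noteq> 0\<close> by (auto simp: indicator_def soft_0 power2_eq_square inverse_eq_divide)
      finally show ?thesis ..
    qed (simp add: indicator_def)
  qed
  also have "\<dots> = (\<integral>\<^sup>+s. ennreal (1 / s\<^sup>2 + 1 / r\<^sup>2) * ennreal (4 / 3 * pi * s ^ 3) * indicator {0..r} s \<partial>lborel)"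
    by (rule nn_integral_radial) measurable
  also have "\<dots> = (\<integral>\<^sup>+s. ennreal (4 / 3 * pi * (s + s ^ 3 / r\<^sup>2)) * indicator {0..r} s \<partial>lborel)"
  proof (rule nn_integral_cong)
    fix s
    have "(1 / s\<^sup>2 + 1 / r\<^sup>2) * (4 / 3 * pi * s ^ 3) = 4 / 3 * pi * (s + s ^ 3 / r\<^sup>2)"
      using assms by (cases "s = 0") (auto simp: power_numeral_reduce field_simps)
    moreover have "ennreal (1 / s\<^sup>2 + 1 / r\<^sup>2) * ennreal (4 / 3 * pi * s ^ 3)
        = ennreal ((1 / s\<^sup>2 + 1 / r\<^sup>2) * (4 / 3 * pi * s ^ 3))" if "0 \<le> s"
      using that by (intro ennreal_mult[symmetric]) auto
    ultimately show "ennreal (1 / s\<^sup>2 + 1 / r\<^sup>2) * ennreal (4 / 3 * pi * s ^ 3) * indicator {0..r} s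
        = ennreal (4 / 3 * pi * (s + s ^ 3 / r\<^sup>2)) * indicator {0..r} s"
      by (simp add: indicator_def)
  qed
  also have "\<dots> = ennreal (4 / 3 * pi * (r\<^sup>2 / 2 + r ^ 4 / (4 * r\<^sup>2)) - 4 / 3 * pi * (0\<^sup>2 / 2 + 0 ^ 4 / (4 * r\<^sup>2)))"
  proof (rule nn_integral_FTC_Icc)
    show "((\<lambda>s. 4 / 3 * pi * (s\<^sup>2 / 2 + s ^ 4 / (4 * r\<^sup>2))) has_real_derivative
        4 / 3 * pi * (s + s ^ 3 / r\<^sup>2)) (at s)" for s
      using assms by (auto intro!: derivative_eq_intros simp: divide_simps power_numeral_reduce)
  qed (use assms in auto)
  also have "4 / 3 * pi * (r\<^sup>2 / 2 + r ^ 4 / (4 * r\<^sup>2)) - 4 / 3 * pi * (0\<^sup>2 / 2 + 0 ^ 4 / (4 * r\<^sup>2)) = pi * r\<^sup>2"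
    using assms by (simp add: power_numeral_reduce field_simps)
  finally have nn: "(\<integral>\<^sup>+z. ennreal (indicator (ball 0 r) z * (soft 0 z - norm z / r\<^sup>2)) \<partial>(lborel :: (real^3) measure)) = ennreal (pi * r\<^sup>2)" .
  have "has_bochner_integral lborel (\<lambda>z::real^3. indicator (ball 0 r) z * (soft 0 z - norm z / r\<^sup>2)) (pi * r\<^sup>2)"
  proof (rule has_bochner_integral_nn_integral)
    show "(\<lambda>z::real^3. indicator (ball 0 r) z * (soft 0 z - norm z / r\<^sup>2)) \<in> borel_measurable lborel"
      by measurable
  qed (use nn nonneg in \<open>auto intro!: AE_mp[OF AE_lborel_nonzero AE_I2]\<close>)
  then show ?thesis
    by (rule has_bochner_integral_integral_eq)
qed

text \<open>Squaring the truncated paraboloid makes it C^1 across the sphere of radius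
  \<open>r\<close>, which is all that test functions and one integration by parts require. It equals
  1 at the origin only; near the origin \<open>cut_lower\<close> replaces a plateau.\<close>

definition cut :: "real \<Rightarrow> real^3 \<Rightarrow> real"
  where "cut r z = (max 0 (1 - (z \<bullet> z) / r\<^sup>2))\<^sup>2"

definition cut1 :: "real \<Rightarrow> 3 \<Rightarrow> real^3 \<Rightarrow> real"
  where "cut1 r j z = - (4 * max 0 (1 - (z \<bullet> z) / r\<^sup>2) * z $ j / r\<^sup>2)"

lemma DERIV_max_0_square: "((\<lambda>s::real. (max 0 s)\<^sup>2) has_real_derivative 2 * max 0 s) (at s)"
proof -
  consider "s < 0" | "s > 0" | "s = 0"
    by linarith
  then show ?thesis
  proof cases
    case 1
    have "((\<lambda>s::real. 0) has_real_derivative 0) (at s)"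
      by simp
    then have "((\<lambda>s::real. (max 0 s)\<^sup>2) has_real_derivative 0) (at s)"
      by (rule has_field_derivative_transform_within_open[of _ _ _ "{..<0}"]) (use 1 in auto)
    with 1 show ?thesis
      by simp
  next
    case 2
    have "((\<lambda>s::real. s\<^sup>2) has_real_derivative 2 * s) (at s)"
      by (auto intro!: derivative_eq_intros)
    then have "((\<lambda>s::real. (max 0 s)\<^sup>2) has_real_derivative 2 * s) (at s)"
      by (rule has_field_derivative_transform_within_open[of _ _ _ "{0<..}"]) (use 2 in auto)
    with 2 show ?thesis
      by simp
  next
    case 3
    have "((\<lambda>h::real. max 0 h) \<longlongrightarrow> max 0 0) (at 0)"
      by (intro tendsto_intros)
    moreover have "\<forall>\<^sub>F h::real in at 0. max 0 h = ((max 0 h)\<^sup>2 - (max 0 0)\<^sup>2) / h"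
      by (auto simp: eventually_at_filter max_def power2_eq_square)
    ultimately have "((\<lambda>h::real. ((max 0 h)\<^sup>2 - (max 0 0)\<^sup>2) / h) \<longlongrightarrow> 0) (at 0)"
      by (simp add: filterlim_cong)
    with 3 show ?thesis
      by (simp add: DERIV_def)
  qed
qed

lemma has_derivative_cut:
  "(cut r has_derivative (\<lambda>h. \<Sum>j\<in>UNIV. h $ j *\<^sub>R cut1 r j z)) (at z)"
proof -
  let ?m = "max 0 (1 - (z \<bullet> z) / r\<^sup>2)"
  have "((\<lambda>z. 1 - (z \<bullet> z) * inverse (r\<^sup>2)) has_derivative (\<lambda>h. - (2 * (z \<bullet> h) * inverse (r\<^sup>2)))) (at z)"
    by (auto intro!: derivative_eq_intros simp: inner_commute)
  then have "((\<lambda>z. 1 - (z \<bullet> z) / r\<^sup>2) has_derivative (\<lambda>h. - (2 * (z \<bullet> h) / r\<^sup>2))) (at z)"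
    by (simp add: divide_inverse)
  from DERIV_compose_FDERIV[OF DERIV_max_0_square this]
  have "(cut r has_derivative (\<lambda>h. - (2 * (z \<bullet> h) / r\<^sup>2) * (2 * ?m))) (at z)"
    by (simp add: cut_def[abs_def])
  moreover have "(\<Sum>j\<in>UNIV. h $ j *\<^sub>R cut1 r j z) = - (2 * (z \<bullet> h) / r\<^sup>2) * (2 * ?m)" for h
    using inner_axis_sum[of h "- (4 * ?m / r\<^sup>2)" z] by (simp add: cut1_def mult_ac)
  ultimately show ?thesis
    by simp
qed

lemma continuous_on_cut [continuous_intros]: "continuous_on S (cut r)"
  unfolding cut_def by (cases "r = 0") (auto intro!: continuous_intros)

lemma continuous_on_cut1 [continuous_intros]: "continuous_on S (cut1 r j)"
  unfolding cut1_def by (cases "r = 0") (auto intro!: continuous_intros)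

lemma measurable_cut [measurable]:
  "cut r \<in> borel_measurable borel" "cut1 r j \<in> borel_measurable borel"
  by (intro borel_measurable_continuous_onI continuous_intros)+

lemma
  assumes "r > 0" "norm z \<ge> r"
  shows cut_outside: "cut r z = 0" and cut1_outside: "cut1 r j z = 0"
proof -
  have "r\<^sup>2 \<le> z \<bullet> z"
    using assms by (simp add: power_mono dot_square_norm)
  then show "cut r z = 0" "cut1 r j z = 0"
    using assms by (simp_all add: cut_def cut1_def max_def pos_divide_le_eq)
qed

lemma cut_bounds: "0 \<le> cut r z" "cut r z \<le> 1"
  by (auto simp: cut_def max_def power_le_one)

text \<open>With s = |z|/r, 1 - (1 - s^2)^2 is at most 2 s^2, hence at most 2 s. The linear order is
  kept because it matches the Lipschitz bound on the density.\<close>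

lemma cut_lower:
  assumes "r > 0"
  shows "1 - cut r z \<le> 2 * norm z / r"
proof (cases "norm z \<ge> r")
  case True
  then have "1 \<le> norm z / r"
    using assms by simp
  then show ?thesis
    using cut_bounds[of r z] by simp
next
  case False
  define s where "s = norm z / r"
  have s: "0 \<le> s" "s \<le> 1"
    using False assms by (auto simp: s_def)
  have "(z \<bullet> z) / r\<^sup>2 = s\<^sup>2"
    by (simp add: s_def dot_square_norm power_divide)
  moreover have "s\<^sup>2 \<le> s"
    using s by (simp add: power2_eq_square mult_left_le)
  ultimately have "cut r z = (1 - s\<^sup>2)\<^sup>2"
    using s by (simp add: cut_def)
  also have "\<dots> \<ge> 1 - 2 * s\<^sup>2"
    by (simp add: power2_diff)
  finally show ?thesis
    using \<open>s\<^sup>2 \<le> s\<close> by (simp add: s_def)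
qed

lemma abs_cut1_le:
  assumes "r > 0"
  shows "\<bar>cut1 r j z\<bar> \<le> 4 / r"
proof (cases "norm z \<ge> r")
  case True
  then show ?thesis
    using assms by (simp add: cut1_outside)
next
  case False
  let ?m = "max 0 (1 - (z \<bullet> z) / r\<^sup>2)"
  have "\<bar>cut1 r j z\<bar> = 4 * (?m * \<bar>z $ j\<bar>) / r\<^sup>2"
    by (simp add: cut1_def abs_mult)
  also have "\<dots> \<le> 4 * (1 * r) / r\<^sup>2"
    using False component_le_norm_cart[of z j] by (intro divide_right_mono mult_left_mono mult_mono) auto
  also have "\<dots> = 4 / r"
    using assms by (simp add: power2_eq_square)
  finally show ?thesis .
qed

section \<open>The Newtonian potential of a differentiable density\<close>

text \<open>The basic splitting. Within distance \<open>r\<close> the density is bounded by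
  \<open>v\<close>, which may compensate part of the singularity of \<open>D\<close>; beyond it
  \<open>D\<close> is compared with 1/|z|, the kernel against which the density is known to be
  integrable. After reflection the near integral does not depend on \<open>x\<close>, which is what
  later makes the estimates uniform.\<close>

lemma
  fixes D :: "real^3 \<Rightarrow> real" and g :: "real^3 \<Rightarrow> 'b::{banach, second_countable_topology}"
  assumes D [measurable]: "D \<in> borel_measurable borel" and g [measurable]: "g \<in> borel_measurable borel"
    and near: "\<And>y. norm (x - y) < r \<Longrightarrow> norm (g y) \<le> v (x - y)"
    and v [measurable]: "v \<in> borel_measurable borel"
    and Dv: "integrable lborel (\<lambda>z. indicator (ball 0 r) z * (\<bar>D z\<bar> * v z))"
    and far: "\<And>z. norm z \<ge> r \<Longrightarrow> \<bar>D z\<bar> \<le> c * soft 0 z"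
    and sg: "integrable lborel (\<lambda>y. indicator (- ball x r) y * (soft 0 (x - y) * norm (g y)))"
  shows near_far_integrable: "integrable lborel (\<lambda>y. D (x - y) *\<^sub>R g y)"
    and near_far_bound: "norm (LINT y|lborel. D (x - y) *\<^sub>R g y)
      \<le> (LINT z|lborel. indicator (ball 0 r) z * (\<bar>D z\<bar> * v z))
        + c * (LINT y|lborel. indicator (- ball x r) y * (soft 0 (x - y) * norm (g y)))"
proof -
  let ?N = "\<lambda>z. indicator (ball 0 r) z * (\<bar>D z\<bar> * v z)"
  let ?F = "\<lambda>y. indicator (- ball x r) y * (soft 0 (x - y) * norm (g y))"
  have Nm [measurable]: "?N \<in> borel_measurable borel"
    by measurable
  have N: "integrable lborel (\<lambda>y. ?N (x - y))"
    using Dv by (subst integrable_reflect[OF Nm])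
  have bnd: "norm (D (x - y) *\<^sub>R g y) \<le> ?N (x - y) + c * ?F y" for y
  proof (cases "norm (x - y) < r")
    case True
    then have "norm (D (x - y) *\<^sub>R g y) \<le> \<bar>D (x - y)\<bar> * v (x - y)"
      by (simp add: near mult_left_mono)
    with True show ?thesis
      by (simp add: indicator_def dist_norm[of x y])
  next
    case False
    then have "norm (D (x - y) *\<^sub>R g y) \<le> c * soft 0 (x - y) * norm (g y)"
      by (simp add: far mult_right_mono)
    with False show ?thesis
      by (simp add: indicator_def dist_norm[of x y])
  qed
  have NF: "integrable lborel (\<lambda>y. ?N (x - y) + c * ?F y)"
    by (intro Bochner_Integration.integrable_add N integrable_mult_right sg)
  show "integrable lborel (\<lambda>y. D (x - y) *\<^sub>R g y)"
    by (rule Bochner_Integration.integrable_bound[OF NF])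
       (use order_trans[OF bnd abs_ge_self] in auto)
  then have "norm (LINT y|lborel. D (x - y) *\<^sub>R g y) \<le> (LINT y|lborel. ?N (x - y) + c * ?F y)"
    by (rule Bochner_Integration.integral_norm_bound_integral[OF _ NF]) (rule bnd)
  also have "\<dots> = (LINT y|lborel. ?N (x - y)) + c * (LINT y|lborel. ?F y)"
    by (simp only: Bochner_Integration.integral_add[OF N integrable_mult_right[OF sg]] integral_mult_right_zero)
  also have "(LINT y|lborel. ?N (x - y)) = (LINT z|lborel. ?N z)"
    by (rule integral_reflect[OF Nm])
  finally show "norm (LINT y|lborel. D (x - y) *\<^sub>R g y) \<le> (LINT z|lborel. ?N z) + c * (LINT y|lborel. ?F y)" .
qed

lemma near_integrable:
  fixes D v :: "real^3 \<Rightarrow> real"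
  assumes [measurable]: "D \<in> borel_measurable borel" "v \<in> borel_measurable borel"
    and "r > 0" "\<And>z. z \<noteq> 0 \<Longrightarrow> \<bar>D z\<bar> * \<bar>v z\<bar> \<le> C * soft 0 z ^ 2"
  shows "integrable lborel (\<lambda>z. indicator (ball 0 r) z * (\<bar>D z\<bar> * v z))"
proof (rule Bochner_Integration.integrable_bound)
  show "integrable lborel (\<lambda>z::real^3. C * (indicator (ball 0 r) z * soft 0 z ^ 2))"
    using integrable_soft_0_square[OF \<open>r > 0\<close>] by simp
  show "AE z in lborel. norm (indicator (ball 0 r) z * (\<bar>D z\<bar> * v z)) \<le> norm (C * (indicator (ball 0 r) z * soft 0 z ^ 2))"
    by (rule AE_mp[OF AE_lborel_nonzero AE_I2])
       (use assms(4) order_trans[OF assms(4) abs_ge_self] in \<open>auto simp: abs_mult indicator_def\<close>)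
qed measurable

lemma near_tendsto_0:
  fixes D :: "nat \<Rightarrow> real^3 \<Rightarrow> real" and v :: "real^3 \<Rightarrow> real"
  assumes [measurable]: "\<And>n. D n \<in> borel_measurable borel" "v \<in> borel_measurable borel"
    and "r > 0" and bnd: "\<And>n z. z \<noteq> 0 \<Longrightarrow> \<bar>D n z\<bar> * \<bar>v z\<bar> \<le> C * soft 0 z ^ 2"
    and lim: "\<And>z. z \<noteq> 0 \<Longrightarrow> (\<lambda>n. D n z) \<longlonglongrightarrow> 0"
  shows "(\<lambda>n. LINT z|lborel. indicator (ball 0 r) z * (\<bar>D n z\<bar> * v z)) \<longlonglongrightarrow> 0"
proof -
  have "(\<lambda>n. LINT z|lborel. indicator (ball 0 r) z * (\<bar>D n z\<bar> * v z))
      \<longlonglongrightarrow> (LINT z|(lborel :: (real^3) measure). (0::real))"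
  proof (rule integral_dominated_convergence)
    show "integrable lborel (\<lambda>z::real^3. C * (indicator (ball 0 r) z * soft 0 z ^ 2))"
      using integrable_soft_0_square[OF \<open>r > 0\<close>] by simp
    show "AE z in lborel. norm (indicator (ball 0 r) z * (\<bar>D n z\<bar> * v z)) \<le> C * (indicator (ball 0 r) z * soft 0 z ^ 2)" for n
      by (rule AE_mp[OF AE_lborel_nonzero AE_I2]) (use bnd in \<open>auto simp: abs_mult indicator_def\<close>)
    show "AE z in lborel. (\<lambda>n. indicator (ball 0 r) z * (\<bar>D n z\<bar> * v z)) \<longlonglongrightarrow> 0"
    proof (rule AE_mp[OF AE_lborel_nonzero AE_I2], rule impI)
      fix z :: "real^3" assume "z \<noteq> 0"
      have "(\<lambda>n. indicator (ball 0 r) z * (\<bar>D n z\<bar> * v z)) \<longlonglongrightarrow> indicator (ball 0 r) z * (\<bar>0\<bar> * v z)"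
        by (intro tendsto_intros lim \<open>z \<noteq> 0\<close>)
      then show "(\<lambda>n. indicator (ball 0 r) z * (\<bar>D n z\<bar> * v z)) \<longlonglongrightarrow> 0"
        by simp
    qed
  qed measurable
  then show ?thesis
    by simp
qed

lemma has_derivative_uniform_limit:
  fixes f :: "nat \<Rightarrow> real^3 \<Rightarrow> 'b::banach"
  assumes df: "\<And>n x. (f n has_derivative (\<lambda>h. \<Sum>j\<in>UNIV. h $ j *\<^sub>R g n j x)) (at x)"
    and bound: "\<And>n j x. x \<in> ball x0 r \<Longrightarrow> norm (g n j x - g' j x) \<le> a j n"
    and a: "\<And>j. a j \<longlonglongrightarrow> 0"
    and lim: "\<And>x. x \<in> ball x0 r \<Longrightarrow> (\<lambda>n. f n x) \<longlonglongrightarrow> f' x"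
    and x: "x \<in> ball x0 r"
  shows "(f' has_derivative (\<lambda>h. \<Sum>j\<in>UNIV. h $ j *\<^sub>R g' j x)) (at x)"
proof -
  have "\<exists>F. \<forall>x\<in>ball x0 r. (\<lambda>n. f n x) \<longlonglongrightarrow> F x \<and>
      (F has_derivative (\<lambda>h. \<Sum>j\<in>UNIV. h $ j *\<^sub>R g' j x)) (at x within ball x0 r)"
  proof (rule has_derivative_sequence[where ?x0.0=x and l="f' x" and f'="\<lambda>n x h. \<Sum>j\<in>UNIV. h $ j *\<^sub>R g n j x"])
    show "x \<in> ball x0 r" "(\<lambda>n. f n x) \<longlonglongrightarrow> f' x"
      by (rule x, rule lim[OF x])
    show "convex (ball x0 r)"
      by (rule convex_ball)
    show "(f n has_derivative (\<lambda>h. \<Sum>j\<in>UNIV. h $ j *\<^sub>R g n j x)) (at x within ball x0 r)" for n x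
      by (rule has_derivative_at_withinI[OF df])
    fix e :: real assume "e > 0"
    have "(\<lambda>n. \<Sum>j\<in>UNIV. a j n) \<longlonglongrightarrow> (\<Sum>j\<in>(UNIV::3 set). 0)"
      by (intro tendsto_sum a)
    then have "\<forall>\<^sub>F n in sequentially. (\<Sum>j\<in>UNIV. a j n) < e"
      using \<open>e > 0\<close> by (intro order_tendstoD(2)) auto
    then show "\<forall>\<^sub>F n in sequentially. \<forall>x\<in>ball x0 r. \<forall>h.
        norm ((\<Sum>j\<in>UNIV. h $ j *\<^sub>R g n j x) - (\<Sum>j\<in>UNIV. h $ j *\<^sub>R g' j x)) \<le> e * norm h"
    proof eventually_elim
      case (elim n)
      show ?case
      proof (intro ballI allI)
        fix x h assume x: "x \<in> ball x0 r"
        have "norm ((\<Sum>j\<in>UNIV. h $ j *\<^sub>R g n j x) - (\<Sum>j\<in>UNIV. h $ j *\<^sub>R g' j x))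
            = norm (\<Sum>j\<in>UNIV. h $ j *\<^sub>R (g n j x - g' j x))"
          by (simp add: sum_subtractf scaleR_diff_right)
        also have "\<dots> \<le> (\<Sum>j\<in>UNIV. norm h * a j n)"
          by (rule sum_norm_le) (auto intro!: mult_mono component_le_norm_cart bound[OF x])
        also have "\<dots> = (\<Sum>j\<in>UNIV. a j n) * norm h"
          by (simp only: sum_distrib_right mult.commute[of "norm h"])
        also have "\<dots> \<le> e * norm h"
          using elim by (intro mult_right_mono) auto
        finally show "norm ((\<Sum>j\<in>UNIV. h $ j *\<^sub>R g n j x) - (\<Sum>j\<in>UNIV. h $ j *\<^sub>R g' j x)) \<le> e * norm h" .
      qed
    qed
  qed
  then obtain F where F: "\<forall>x\<in>ball x0 r. (\<lambda>n. f n x) \<longlonglongrightarrow> F x \<and>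
      (F has_derivative (\<lambda>h. \<Sum>j\<in>UNIV. h $ j *\<^sub>R g' j x)) (at x within ball x0 r)" ..
  have "(F has_derivative (\<lambda>h. \<Sum>j\<in>UNIV. h $ j *\<^sub>R g' j x)) (at x)"
    using bspec[OF F x] at_within_open[OF x open_ball] by simp
  \<comment> \<open>The theorem on sequences of derivatives only yields some limit function;
    uniqueness of limits identifies it on the ball.\<close>
  moreover have "F y = f' y" if "y \<in> ball x0 r" for y
    using F that by (intro LIMSEQ_unique[OF _ lim[OF that]]) auto
  ultimately show ?thesis
    by (rule has_derivative_transform_within_open[OF _ open_ball x])
qed

text \<open>These are the majorants demanded by \<open>has_derivative_convolution\<close>, with one
  constant for the kernel and its derivatives of order at most two. In 8 = 4 * 2, the 4 is from
  \<open>abs_soft2_le\<close> and the 2 from moving the weight from \<xi> to a point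
  \<open>z\<close> at distance at most 1.\<close>

lemma soft_bounds:
  assumes "e > 0"
  obtains M where "M \<ge> 0"
    "\<And>z \<xi>. norm (\<xi> - z) \<le> 1 \<Longrightarrow> \<bar>soft e \<xi>\<bar> \<le> M / (1 + norm z)"
    "\<And>z \<xi> k. norm (\<xi> - z) \<le> 1 \<Longrightarrow> \<bar>soft1 e k \<xi>\<bar> \<le> M / (1 + norm z)"
    "\<And>z \<xi> j k. norm (\<xi> - z) \<le> 1 \<Longrightarrow> \<bar>soft2 e j k \<xi>\<bar> \<le> M / (1 + norm z)"
proof -
  define c where "c = 1 + 1 / e"
  have c1: "c \<ge> 1"
    using assms by (simp add: c_def)
  have s: "soft e \<xi> \<le> c / (1 + norm \<xi>)" for \<xi>
    using soft_le_weight[OF assms] by (simp add: c_def)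
  have sc: "soft e \<xi> \<le> c" for \<xi>
  proof -
    have "c / (1 + norm \<xi>) \<le> c / 1"
      using c1 by (intro divide_left_mono) (auto simp: add_pos_nonneg)
    with s[of \<xi>] show ?thesis
      by simp
  qed
  have near: "c ^ m * soft e \<xi> \<le> 2 * c ^ Suc m / (1 + norm z)" if "norm (\<xi> - z) \<le> 1" for m \<xi> z
  proof -
    have aux: "1 + a \<le> 2 * (1 + b)" if "a \<le> b + d" "d \<le> 1" "0 \<le> b" for a b d :: real
      using that by (simp add: algebra_simps)
    have "norm z \<le> norm \<xi> + norm (\<xi> - z)"
      by (metis norm_minus_commute norm_triangle_sub)
    from aux[OF this that norm_ge_zero] have "1 + norm z \<le> 2 * (1 + norm \<xi>)" .
    then have "c / (1 + norm \<xi>) \<le> 2 * c / (1 + norm z)"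
      using c1 by (simp add: divide_simps add_pos_nonneg)
    then have "soft e \<xi> \<le> 2 * c / (1 + norm z)"
      by (rule order_trans[OF s])
    then have "c ^ m * soft e \<xi> \<le> c ^ m * (2 * c / (1 + norm z))"
      using c1 by (intro mult_left_mono) auto
    then show ?thesis
      by (simp add: mult_ac)
  qed
  have le: "2 * c ^ Suc m / (1 + norm z) \<le> 8 * c ^ 3 / (1 + norm z)" if "m \<le> 2" for m and z :: "real^3"
  proof (rule divide_right_mono)
    have "c ^ Suc m \<le> c ^ 3" "0 \<le> c ^ 3"
      using that c1 by (auto intro!: power_increasing simp del: power_Suc)
    then show "2 * c ^ Suc m \<le> 8 * c ^ 3"
      by linarith
  qed simp
  show ?thesis
  proof
    show "0 \<le> 8 * c ^ 3"
      using c1 by simp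
    fix z \<xi> :: "real^3" and j k assume near1: "norm (\<xi> - z) \<le> 1"
    show "\<bar>soft e \<xi>\<bar> \<le> 8 * c ^ 3 / (1 + norm z)"
      using near[OF near1, of 0] le[of 0 z] by simp
    have "\<bar>soft1 e k \<xi>\<bar> \<le> soft e \<xi> * soft e \<xi>"
      using abs_soft1_le[of e k \<xi>] by (simp add: power2_eq_square)
    also have "\<dots> \<le> c ^ 1 * soft e \<xi>"
      using sc by (simp add: mult_right_mono)
    finally show "\<bar>soft1 e k \<xi>\<bar> \<le> 8 * c ^ 3 / (1 + norm z)"
      using near[OF near1, of 1] le[of 1 z] by simp
    have "\<bar>soft2 e j k \<xi>\<bar> \<le> 4 * (soft e \<xi> ^ 2 * soft e \<xi>)"
      using abs_soft2_le[of e j k \<xi>] by (simp add: power_numeral_reduce mult_ac)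
    also have "\<dots> \<le> 4 * (c ^ 2 * soft e \<xi>)"
      using sc by (intro mult_left_mono mult_right_mono power_mono) auto
    also have "\<dots> \<le> 4 * (2 * c ^ 3 / (1 + norm z))"
      using near[OF near1, of 2] by (intro mult_left_mono) (auto simp: numeral_eq_Suc)
    finally show "\<bar>soft2 e j k \<xi>\<bar> \<le> 8 * c ^ 3 / (1 + norm z)"
      by simp
  qed
qed

section \<open>The regularising sequence and convolutions with the density\<close>

definition eps :: "nat \<Rightarrow> real"
  where "eps n = inverse (real (Suc n))"

lemma eps_pos: "eps n > 0"
  by (simp add: eps_def)

lemma eps_tendsto: "eps \<longlonglongrightarrow> 0"
  using LIMSEQ_inverse_real_of_nat by (simp add: eps_def[abs_def])

lemma soft1_eps_tendsto:
  assumes "z \<noteq> 0"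
  shows "(\<lambda>n. soft1 (eps n) k z - soft1 0 k z) \<longlonglongrightarrow> 0"
proof (rule Lim_null_comparison)
  show "\<forall>\<^sub>F n in sequentially. norm (soft1 (eps n) k z - soft1 0 k z) \<le> 3 * eps n * soft 0 z ^ 3"
    using abs_soft1_diff_le[OF assms less_imp_le[OF eps_pos]] by simp
  show "(\<lambda>n. 3 * eps n * soft 0 z ^ 3) \<longlonglongrightarrow> 0"
    by (intro tendsto_mult_left_zero tendsto_mult_right_zero eps_tendsto)
qed

lemma soft2_eps_tendsto:
  assumes "z \<noteq> 0"
  shows "(\<lambda>n. soft2 (eps n) j k z - soft2 0 j k z) \<longlonglongrightarrow> 0"
proof (rule Lim_null_comparison)
  show "\<forall>\<^sub>F n in sequentially. norm (soft2 (eps n) j k z - soft2 0 j k z) \<le> 18 * eps n * soft 0 z ^ 4"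
    using abs_soft2_diff_le[OF assms less_imp_le[OF eps_pos]] by simp
  show "(\<lambda>n. 18 * eps n * soft 0 z ^ 4) \<longlonglongrightarrow> 0"
    by (intro tendsto_mult_left_zero tendsto_mult_right_zero eps_tendsto)
qed

lemma soft_eps_tendsto:
  assumes "z \<noteq> 0"
  shows "(\<lambda>n. soft (eps n) z) \<longlonglongrightarrow> soft 0 z"
proof -
  have "(\<lambda>n. inverse (sqrt (z \<bullet> z + (eps n)\<^sup>2))) \<longlonglongrightarrow> inverse (sqrt (z \<bullet> z + 0\<^sup>2))"
    using assms by (intro tendsto_intros eps_tendsto) auto
  then show ?thesis
    by (simp add: soft_def)
qed

locale newton_density =
  fixes \<Omega> :: "(real^3) set" and Q :: "real^3 \<Rightarrow> 'b::euclidean_space"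
  assumes open_domain: "open \<Omega>" and nonempty: "\<Omega> \<noteq> {}"
    and C1: "C1_on \<Omega> Q"
    and integrable_kernel: "\<And>x. x \<in> \<Omega> \<Longrightarrow> set_integrable lborel \<Omega> (\<lambda>y. (1 / norm (x - y)) *\<^sub>R Q y)"
begin

definition q :: "real^3 \<Rightarrow> 'b"
  where "q y = indicator \<Omega> y *\<^sub>R Q y"

definition conv :: "(real^3 \<Rightarrow> real) \<Rightarrow> real^3 \<Rightarrow> 'b"
  where "conv k x = (LINT y|lborel. k (x - y) *\<^sub>R q y)"

lemma measurable_q [measurable]: "q \<in> borel_measurable borel"
  unfolding q_def[abs_def]
  using borel_measurable_continuous_on_indicator[OF _ C1_on_continuous[OF C1]] open_domain by simp

lemma integrable_soft_q: "x \<in> \<Omega> \<Longrightarrow> integrable lborel (\<lambda>y. soft 0 (x - y) *\<^sub>R q y)"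
  using integrable_kernel[of x]
  by (simp add: set_integrable_def soft_0 inverse_eq_divide q_def scaleR_left_commute)

lemma integrable_soft_norm_q: "x \<in> \<Omega> \<Longrightarrow> integrable lborel (\<lambda>y. soft 0 (x - y) * norm (q y))"
  using integrable_norm[OF integrable_soft_q] by simp

text \<open>Convergence of the potential at a single point \<open>x0\<close> is enough, because 1/(1
  + |x - y|) \<le> (1 + |x - x0|)/|x0 - y|. The point \<open>x\<close> is therefore arbitrary, not
  restricted to \<Omega>.\<close>

lemma integrable_weight_q: "integrable lborel (\<lambda>y. M / (1 + norm (x - y)) * norm (q y))"
proof -
  obtain x0 where x0: "x0 \<in> \<Omega>"
    using nonempty by blast
  show ?thesis
  proof (rule Bochner_Integration.integrable_bound)
    show "integrable lborel (\<lambda>y. (\<bar>M\<bar> * (1 + norm (x - x0))) * (soft 0 (x0 - y) * norm (q y)))"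
      using integrable_soft_norm_q[OF x0] by simp
    show "AE y in lborel. norm (M / (1 + norm (x - y)) * norm (q y))
        \<le> norm ((\<bar>M\<bar> * (1 + norm (x - x0))) * (soft 0 (x0 - y) * norm (q y)))"
    proof (rule AE_mp[OF AE_lborel_nonzero[of x0] AE_I2], rule impI)
      fix y assume "y \<noteq> x0"
      then have pos: "norm (x0 - y) > 0"
        by simp
      have "norm (x0 - y) \<le> norm (x - x0) + norm (x - y)"
        by (metis norm_minus_commute norm_triangle_ineq diff_add_cancel add_diff_eq)
      also have "\<dots> \<le> (1 + norm (x - x0)) * (1 + norm (x - y))"
        by (simp add: algebra_simps)
      finally have "1 / (1 + norm (x - y)) \<le> (1 + norm (x - x0)) * soft 0 (x0 - y)"
        using pos by (simp add: soft_0 divide_simps add_pos_nonneg mult_ac)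
      then have "\<bar>M\<bar> * (1 / (1 + norm (x - y))) * norm (q y)
          \<le> \<bar>M\<bar> * ((1 + norm (x - x0)) * soft 0 (x0 - y)) * norm (q y)"
        by (intro mult_right_mono mult_left_mono) auto
      then show "norm (M / (1 + norm (x - y)) * norm (q y))
        \<le> norm ((\<bar>M\<bar> * (1 + norm (x - x0))) * (soft 0 (x0 - y) * norm (q y)))"
        by (simp add: abs_mult mult_ac)
    qed
  qed measurable
qed

lemma integrable_bounded_kernel:
  assumes [measurable]: "k \<in> borel_measurable borel" and "\<And>z. \<bar>k z\<bar> \<le> M / (1 + norm z)"
  shows "integrable lborel (\<lambda>y. k (x - y) *\<^sub>R q y)"
proof (rule Bochner_Integration.integrable_bound[OF integrable_weight_q[of M x]])
  have "norm (k (x - y) *\<^sub>R q y) \<le> norm (M / (1 + norm (x - y)) * norm (q y))" for y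
    using mult_right_mono[OF order_trans[OF assms(2)[of "x - y"] abs_ge_self] norm_ge_zero[of "q y"]]
    by (simp add: abs_mult)
  then show "AE y in lborel. norm (k (x - y) *\<^sub>R q y) \<le> norm (M / (1 + norm (x - y)) * norm (q y))"
    by simp
qed measurable

lemma
  assumes e: "e > 0"
  shows integrable_soft1_q: "integrable lborel (\<lambda>y. soft1 e k (x - y) *\<^sub>R q y)"
    and integrable_soft2_q: "integrable lborel (\<lambda>y. soft2 e j k (x - y) *\<^sub>R q y)"
    and has_derivative_conv_soft:
      "(conv (soft e) has_derivative (\<lambda>h. \<Sum>j\<in>UNIV. h $ j *\<^sub>R conv (soft1 e j) x)) (at x)"
    and has_derivative_conv_soft1:
      "(conv (soft1 e k) has_derivative (\<lambda>h. \<Sum>j\<in>UNIV. h $ j *\<^sub>R conv (soft2 e j k) x)) (at x)"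
    and isCont_conv_soft2: "isCont (conv (soft2 e j k)) x"
proof -
  obtain M where M: "M \<ge> 0"
    "\<And>z \<xi>. norm (\<xi> - z) \<le> 1 \<Longrightarrow> \<bar>soft e \<xi>\<bar> \<le> M / (1 + norm z)"
    "\<And>z \<xi> k. norm (\<xi> - z) \<le> 1 \<Longrightarrow> \<bar>soft1 e k \<xi>\<bar> \<le> M / (1 + norm z)"
    "\<And>z \<xi> j k. norm (\<xi> - z) \<le> 1 \<Longrightarrow> \<bar>soft2 e j k \<xi>\<bar> \<le> M / (1 + norm z)"
    using soft_bounds[OF e] by blast
  have "e \<noteq> 0"
    using e by simp
  note deriv = has_derivative_soft_sum[OF this] has_derivative_soft1_sum[OF this]
    continuous_on_soft1[OF this] continuous_on_soft2[OF this]
  have 0: "integrable lborel (\<lambda>y. soft e (x - y) *\<^sub>R q y)"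
    by (rule integrable_bounded_kernel[where M=M]) (use M(2) in auto)
  show 1: "integrable lborel (\<lambda>y. soft1 e k (x - y) *\<^sub>R q y)"
    by (rule integrable_bounded_kernel[where M=M]) (use M(3) in auto)
  show 2: "integrable lborel (\<lambda>y. soft2 e j k (x - y) *\<^sub>R q y)"
    by (rule integrable_bounded_kernel[where M=M]) (use M(4) in auto)
  show "(conv (soft e) has_derivative (\<lambda>h. \<Sum>j\<in>UNIV. h $ j *\<^sub>R conv (soft1 e j) x)) (at x)"
    unfolding conv_def[abs_def]
    by (rule has_derivative_convolution[OF deriv(1) deriv(3) M(3) measurable_q 0 integrable_weight_q])
  show "(conv (soft1 e k) has_derivative (\<lambda>h. \<Sum>j\<in>UNIV. h $ j *\<^sub>R conv (soft2 e j k) x)) (at x)"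
    unfolding conv_def[abs_def]
    by (rule has_derivative_convolution[OF deriv(2) deriv(4) M(4) measurable_q 1 integrable_weight_q])
  show "isCont (conv (soft2 e j k)) x"
    unfolding conv_def[abs_def]
    by (rule isCont_convolution[OF deriv(4) M(4) measurable_q integrable_weight_q])
qed

lemma conv_soft_tendsto:
  assumes "x \<in> \<Omega>"
  shows "(\<lambda>n. conv (soft (eps n)) x) \<longlonglongrightarrow> conv (soft 0) x"
  unfolding conv_def
proof (rule integral_dominated_convergence[OF _ _ integrable_soft_norm_q[OF assms]])
  show "AE y in lborel. (\<lambda>n. soft (eps n) (x - y) *\<^sub>R q y) \<longlonglongrightarrow> soft 0 (x - y) *\<^sub>R q y"
    by (rule AE_mp[OF AE_lborel_nonzero[of x] AE_I2]) (auto intro!: tendsto_intros soft_eps_tendsto)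
  show "AE y in lborel. norm (soft (eps n) (x - y) *\<^sub>R q y) \<le> soft 0 (x - y) * norm (q y)" for n
    by (rule AE_mp[OF AE_lborel_nonzero[of x] AE_I2]) (auto intro!: mult_right_mono soft_le_soft_0)
qed measurable

text \<open>If |x0 - x| < r \<le> |x - y|, then |x0 - y| < 2 |x - y|. Hence the far integrals
  centred at all \<open>x\<close> in the ball are bounded by one number attached to
  \<open>x0\<close>.\<close>

lemma far_integral:
  assumes x0: "x0 \<in> \<Omega>" and x: "x \<in> ball x0 r"
    and g: "\<And>y. norm (x - y) \<ge> r \<Longrightarrow> g y = q y" and [measurable]: "g \<in> borel_measurable borel"
  shows "integrable lborel (\<lambda>y. indicator (- ball x r) y * (soft 0 (x - y) * norm (g y)))"
    and "(LINT y|lborel. indicator (- ball x r) y * (soft 0 (x - y) * norm (g y)))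
      \<le> 2 * (LINT y|lborel. soft 0 (x0 - y) * norm (q y))"
proof -
  let ?I = "\<lambda>y. indicator (- ball x r) y * (soft 0 (x - y) * norm (g y))"
  have I: "integrable lborel (\<lambda>y. 2 * (soft 0 (x0 - y) * norm (q y)))"
    using integrable_soft_norm_q[OF x0] by simp
  have b: "?I y \<le> 2 * (soft 0 (x0 - y) * norm (q y))" if "y \<noteq> x0" for y
  proof (cases "norm (x - y) \<ge> r")
    case True
    have d: "norm (x0 - x) < r"
      using x by (simp add: dist_norm)
    then have pos: "norm (x - y) > 0" "norm (x0 - y) > 0"
      using True that norm_ge_zero[of "x0 - x"] by (linarith, simp)
    have "norm (x0 - y) \<le> norm (x0 - x) + norm (x - y)"
      by (metis diff_add_cancel add_diff_eq norm_triangle_ineq)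
    then have "norm (x0 - y) \<le> 2 * norm (x - y)"
      using True d by linarith
    then have "soft 0 (x - y) \<le> 2 * soft 0 (x0 - y)"
      using pos by (simp add: soft_0 divide_simps)
    then have "soft 0 (x - y) * norm (q y) \<le> 2 * soft 0 (x0 - y) * norm (q y)"
      by (intro mult_right_mono) auto
    with True show ?thesis
      by (simp add: g indicator_def dist_norm[of x y])
  qed (simp add: indicator_def dist_norm[of x y])
  show int: "integrable lborel ?I"
  proof (rule Bochner_Integration.integrable_bound[OF I])
    show "AE y in lborel. norm (?I y) \<le> norm (2 * (soft 0 (x0 - y) * norm (q y)))"
      by (rule AE_mp[OF AE_lborel_nonzero[of x0] AE_I2]) (use b in \<open>auto simp: abs_mult\<close>)
  qed measurable
  have "(LINT y|lborel. ?I y) \<le> (LINT y|lborel. 2 * (soft 0 (x0 - y) * norm (q y)))"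
    by (rule integral_mono_AE[OF int I], rule AE_mp[OF AE_lborel_nonzero[of x0] AE_I2]) (use b in simp)
  then show "(LINT y|lborel. ?I y) \<le> 2 * (LINT y|lborel. soft 0 (x0 - y) * norm (q y))"
    by simp
qed

text \<open>The radius is doubled so that the points within distance \<open>r\<close> of any
  \<open>x\<close> in \<open>ball x0 r\<close> still lie in the region where the bounds
  hold.\<close>

lemma local_bounds:
  assumes "x0 \<in> \<Omega>"
  obtains r L where "r > 0" "L \<ge> 0" "cball x0 (2 * r) \<subseteq> \<Omega>"
    "\<forall>y\<in>cball x0 (2 * r). norm (Q y) \<le> L"
    "\<forall>x\<in>cball x0 (2 * r). \<forall>y\<in>cball x0 (2 * r). norm (Q x - Q y) \<le> L * norm (x - y)"
proof -
  obtain \<delta> where \<delta>: "\<delta> > 0" "cball x0 \<delta> \<subseteq> \<Omega>"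
    using open_domain assms open_contains_cball_eq by metis
  define r where "r = \<delta> / 2"
  have r: "r > 0" "cball x0 (2 * r) \<subseteq> \<Omega>"
    using \<delta> by (auto simp: r_def)
  have bd: "\<exists>B. \<forall>y\<in>cball x0 (2 * r). norm (u y) \<le> B" if "continuous_on \<Omega> u" for u :: "real^3 \<Rightarrow> 'b"
    using compact_imp_bounded[OF compact_continuous_image[OF continuous_on_subset[OF that r(2)] compact_cball]]
    by (simp add: bounded_iff)
  from bd[OF C1_on_continuous[OF C1]]
  obtain B where "\<forall>y\<in>cball x0 (2 * r). norm (Q y) \<le> B" ..
  then have B: "norm (Q y) \<le> B" if "y \<in> cball x0 (2 * r)" for y
    using that by blast
  have "\<forall>k. \<exists>B. \<forall>y\<in>cball x0 (2 * r). norm (partial k Q y) \<le> B"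
    by (intro allI bd C1_on_partial C1)
  from choice[OF this] obtain D where "\<forall>k. \<forall>y\<in>cball x0 (2 * r). norm (partial k Q y) \<le> D k" ..
  then have D: "norm (partial k Q y) \<le> D k" if "y \<in> cball x0 (2 * r)" for k y
    using that by blast
  have x0r: "x0 \<in> cball x0 (2 * r)"
    using r by simp
  \<comment> \<open>One constant serves both as a bound of \<open>Q\<close> and as a Lipschitz
    constant.\<close>
  define L where "L = B + (\<Sum>k\<in>UNIV. D k)"
  have B0: "0 \<le> B"
    using norm_ge_zero B[OF x0r] by (rule order_trans)
  have "0 \<le> D k" for k
    using norm_ge_zero D[OF x0r] by (rule order_trans)
  then have D0: "0 \<le> (\<Sum>k\<in>UNIV. D k)"
    by (simp add: sum_nonneg)
  note pos = B0 D0
  have lip: "norm (Q x - Q y) \<le> (\<Sum>k\<in>UNIV. D k) * norm (x - y)"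
    if "x \<in> cball x0 (2 * r)" "y \<in> cball x0 (2 * r)" for x y
  proof (rule differentiable_bound[where f=Q and S="cball x0 (2 * r)" and f'="\<lambda>z h. \<Sum>k\<in>UNIV. h $ k *\<^sub>R partial k Q z"])
    fix z assume z: "z \<in> cball x0 (2 * r)"
    show "(Q has_derivative (\<lambda>h. \<Sum>k\<in>UNIV. h $ k *\<^sub>R partial k Q z)) (at z within cball x0 (2 * r))"
      by (rule has_derivative_at_withinI[OF has_derivative_partials[OF C1_on_differentiable[OF C1 subsetD[OF r(2) z]]]])
    show "onorm (\<lambda>h::real^3. \<Sum>k\<in>UNIV. h $ k *\<^sub>R partial k Q z) \<le> (\<Sum>k\<in>UNIV. D k)"
    proof (rule onorm_le)
      fix h :: "real^3"
      have "norm (\<Sum>k\<in>UNIV. h $ k *\<^sub>R partial k Q z) \<le> (\<Sum>k\<in>UNIV. norm h * D k)"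
        by (rule sum_norm_le) (auto intro!: mult_mono component_le_norm_cart D[OF z])
      then show "norm (\<Sum>k\<in>UNIV. h $ k *\<^sub>R partial k Q z) \<le> (\<Sum>k\<in>UNIV. D k) * norm h"
        by (simp only: sum_distrib_right mult.commute[of "norm h"])
    qed
  qed (use that in auto)
  show ?thesis
  proof (rule that[of r L])
    show "\<forall>x\<in>cball x0 (2 * r). \<forall>y\<in>cball x0 (2 * r). norm (Q x - Q y) \<le> L * norm (x - y)"
    proof (intro ballI)
      fix x y assume "x \<in> cball x0 (2 * r)" "y \<in> cball x0 (2 * r)"
      from lip[OF this] show "norm (Q x - Q y) \<le> L * norm (x - y)"
        by (rule order_trans) (use pos in \<open>simp add: L_def mult_right_mono\<close>)
    qed
    show "\<forall>y\<in>cball x0 (2 * r). norm (Q y) \<le> L"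
    proof
      show "norm (Q y) \<le> L" if "y \<in> cball x0 (2 * r)" for y
        using B[OF that] pos by (simp add: L_def)
    qed
  qed (use r pos in \<open>auto simp: L_def\<close>)
qed

end

section \<open>Kernel differences near and far from the singularity\<close>

lemma soft_0_le_inverse:
  assumes "r > 0" "norm z \<ge> r"
  shows "soft 0 z \<le> 1 / r"
  using assms by (simp add: soft_0 inverse_eq_divide frac_le)

lemma soft1_diff_near:
  assumes "z \<noteq> 0"
  shows "\<bar>soft1 e k z - soft1 0 k z\<bar> \<le> 2 * soft 0 z ^ 2"
proof -
  have "soft e z ^ 2 \<le> soft 0 z ^ 2"
    by (intro power_mono soft_le_soft_0 assms) simp
  then show ?thesis
    using abs_soft1_le[of e k z] abs_soft1_le[of 0 k z] by linarith
qed

lemma soft2_diff_near: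
  assumes "z \<noteq> 0"
  shows "\<bar>soft2 e j k z - soft2 0 j k z\<bar> \<le> 8 * soft 0 z ^ 3"
proof -
  have "soft e z ^ 3 \<le> soft 0 z ^ 3"
    by (intro power_mono soft_le_soft_0 assms) simp
  then show ?thesis
    using abs_soft2_le[of e j k z] abs_soft2_le[of 0 j k z] by linarith
qed

lemma norm_mult_soft_0_cube: "norm z * soft 0 z ^ 3 \<le> soft 0 z ^ 2"
  using mult_right_mono[OF norm_mult_soft_le[of z 0], of "soft 0 z ^ 2"]
  by (simp add: power_numeral_reduce mult_ac)

text \<open>Surplus powers of 1/|z| are exchanged for powers of 1/r, and exactly one is kept, since
  only that one is known to be integrable against the density at infinity.\<close>

lemma soft_0_power_far:
  assumes "r > 0" "norm z \<ge> r" "c \<ge> 0"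
  shows "c * soft 0 z ^ Suc m \<le> (c / r ^ m) * soft 0 z"
proof -
  have "soft 0 z ^ m \<le> 1 / r ^ m"
    using power_mono[OF soft_0_le_inverse[OF assms(1,2)], of m] by (simp add: power_one_over)
  from mult_right_mono[OF mult_left_mono[OF this assms(3)] soft_nonneg[of 0 z]] show ?thesis
    by (simp add: mult_ac)
qed

lemma
  assumes r: "r > 0" and z: "norm z \<ge> r"
  shows soft1_far: "\<bar>soft1 0 k z\<bar> \<le> (1 / r) * soft 0 z"
    and soft2_far: "\<bar>soft2 0 j k z\<bar> \<le> (4 / r ^ 2) * soft 0 z"
  using abs_soft1_le[of 0 k z] soft_0_power_far[OF r z, of 1 1]
    abs_soft2_le[of 0 j k z] soft_0_power_far[OF r z, of 4 2] by (simp_all add: eval_nat_numeral)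

lemma
  assumes r: "r > 0" and z: "norm z \<ge> r" and e: "e \<ge> 0"
  shows soft1_diff_far: "\<bar>soft1 e k z - soft1 0 k z\<bar> \<le> (3 * e / r ^ 2) * soft 0 z"
    and soft2_diff_far: "\<bar>soft2 e j k z - soft2 0 j k z\<bar> \<le> (18 * e / r ^ 3) * soft 0 z"
proof -
  have z0: "z \<noteq> 0"
    using assms by auto
  show "\<bar>soft1 e k z - soft1 0 k z\<bar> \<le> (3 * e / r ^ 2) * soft 0 z"
    using abs_soft1_diff_le[OF z0 e, of k] soft_0_power_far[OF r z, of "3 * e" 2] e
    by (simp add: eval_nat_numeral)
  show "\<bar>soft2 e j k z - soft2 0 j k z\<bar> \<le> (18 * e / r ^ 3) * soft 0 z"
    using abs_soft2_diff_le[OF z0 e, of j k] soft_0_power_far[OF r z, of "18 * e" 3] e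
    by (simp add: eval_nat_numeral)
qed

text \<open>This is the integral of the second derivative of the kernel against the cutoff, after
  one integration by parts. In this form the singularity is only |z|^-2, so the expression also
  converges at \<open>e = 0\<close>.\<close>

definition moment :: "real \<Rightarrow> real \<Rightarrow> 3 \<Rightarrow> 3 \<Rightarrow> real"
  where "moment e r j k = - (LINT z|lborel. cut1 r j z * soft1 e k z)"

lemma abs_cut1_soft1_le:
  assumes "r > 0" "z \<noteq> 0"
  shows "\<bar>cut1 r j z * soft1 e k z\<bar> \<le> 4 / r * (indicator (ball 0 r) z * soft 0 z ^ 2)"
proof (cases "norm z \<ge> r")
  case True
  then show ?thesis
    using assms by (simp add: cut1_outside)
next
  case False
  have "soft e z ^ 2 \<le> soft 0 z ^ 2"
    by (intro power_mono soft_le_soft_0 assms) simp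
  with abs_soft1_le[of e k z] have "\<bar>soft1 e k z\<bar> \<le> soft 0 z ^ 2"
    by (rule order_trans)
  then have "\<bar>cut1 r j z\<bar> * \<bar>soft1 e k z\<bar> \<le> 4 / r * soft 0 z ^ 2"
    using assms by (intro mult_mono abs_cut1_le) auto
  with False show ?thesis
    by (simp add: abs_mult indicator_def)
qed

lemma integrable_cut1_soft1:
  assumes "r > 0"
  shows "integrable lborel (\<lambda>z. cut1 r j z * soft1 e k z)"
proof (rule Bochner_Integration.integrable_bound)
  show "integrable lborel (\<lambda>z::real^3. 4 / r * (indicator (ball 0 r) z * soft 0 z ^ 2))"
    using integrable_soft_0_square[OF assms] by simp
  show "AE z in lborel. norm (cut1 r j z * soft1 e k z) \<le> norm (4 / r * (indicator (ball 0 r) z * soft 0 z ^ 2))"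
    by (rule AE_mp[OF AE_lborel_nonzero[of 0] AE_I2])
       (use order_trans[OF abs_cut1_soft1_le[OF assms] abs_ge_self] in simp)
qed measurable

lemma moment_tendsto:
  assumes "r > 0"
  shows "(\<lambda>n. moment (eps n) r j k) \<longlonglongrightarrow> moment 0 r j k"
  unfolding moment_def
proof (intro tendsto_minus integral_dominated_convergence)
  show "integrable lborel (\<lambda>z::real^3. 4 / r * (indicator (ball 0 r) z * soft 0 z ^ 2))"
    using integrable_soft_0_square[OF assms] by simp
  show "AE z in lborel. (\<lambda>n. cut1 r j z * soft1 (eps n) k z) \<longlonglongrightarrow> cut1 r j z * soft1 0 k z"
    by (rule AE_mp[OF AE_lborel_nonzero[of 0] AE_I2])
       (use LIM_zero_cancel[OF soft1_eps_tendsto] in \<open>auto intro!: tendsto_mult\<close>)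
  show "AE z in lborel. norm (cut1 r j z * soft1 (eps n) k z) \<le> 4 / r * (indicator (ball 0 r) z * soft 0 z ^ 2)" for n
    by (rule AE_mp[OF AE_lborel_nonzero[of 0] AE_I2]) (use abs_cut1_soft1_le[OF assms] in simp)
qed measurable

text \<open>The point mass of the Laplacian of 1/|z|, seen through the cutoff; hence the value is
  independent of \<open>r\<close>. The contraction of \<open>cut1\<close> with \<open>soft1\<close>
  is 4/r^2 times the integrand of \<open>integral_soft_0_quadratic\<close>.\<close>

lemma moment_trace:
  assumes "r > 0"
  shows "(\<Sum>j\<in>UNIV. moment 0 r j j) = - (4 * pi)"
proof -
  have "(\<Sum>j\<in>UNIV. moment 0 r j j) = - (LINT z|lborel. (\<Sum>j\<in>UNIV. cut1 r j z * soft1 0 j z))"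
    unfolding moment_def by (simp add: sum_negf integral_sum integrable_cut1_soft1 assms)
  also have "(LINT z|lborel. (\<Sum>j\<in>UNIV. cut1 r j z * soft1 0 j z))
      = (LINT z|(lborel :: (real^3) measure). 4 / r\<^sup>2 * (indicator (ball 0 r) z * (soft 0 z - norm z / r\<^sup>2)))"
  proof (rule integral_cong_AE)
    show "AE z in lborel. (\<Sum>j\<in>UNIV. cut1 r j z * soft1 0 j z)
        = 4 / r\<^sup>2 * (indicator (ball 0 r) z * (soft 0 z - norm z / r\<^sup>2))"
    proof (rule AE_mp[OF AE_lborel_nonzero[of 0] AE_I2], rule impI)
      fix z :: "real^3" assume z: "z \<noteq> 0"
      let ?m = "max 0 (1 - (z \<bullet> z) / r\<^sup>2)"
      have "(\<Sum>j\<in>UNIV. cut1 r j z * soft1 0 j z) = 4 / r\<^sup>2 * (?m * ((z \<bullet> z) * soft 0 z ^ 3))"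
        by (simp add: cut1_def soft1_def sum_3 inner_vec_def algebra_simps)
      also have "(z \<bullet> z) * soft 0 z ^ 3 = (norm z * soft 0 z)\<^sup>2 * soft 0 z"
        by (simp add: power_mult_distrib dot_square_norm power_numeral_reduce)
      also have "\<dots> = soft 0 z"
        using norm_mult_soft_0[OF z] by simp
      also have "?m * soft 0 z = indicator (ball 0 r) z * (soft 0 z - norm z / r\<^sup>2)"
      proof (cases "norm z < r")
        case True
        then have "(z \<bullet> z) / r\<^sup>2 \<le> 1"
          using assms by (simp add: dot_square_norm power_mono divide_le_eq)
        then have "?m * soft 0 z = (1 - (z \<bullet> z) / r\<^sup>2) * soft 0 z"
          by simp
        also have "\<dots> = soft 0 z - norm z * (norm z * soft 0 z) / r\<^sup>2"
          by (simp add: dot_square_norm power2_eq_square algebra_simps)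
        finally show ?thesis
          using True norm_mult_soft_0[OF z] by (simp add: indicator_def)
      next
        case False
        then have "1 \<le> (z \<bullet> z) / r\<^sup>2"
          using assms by (simp add: dot_square_norm power_mono le_divide_eq)
        with False show ?thesis
          by (simp add: indicator_def)
      qed
      finally show "(\<Sum>j\<in>UNIV. cut1 r j z * soft1 0 j z)
        = 4 / r\<^sup>2 * (indicator (ball 0 r) z * (soft 0 z - norm z / r\<^sup>2))" .
    qed
  qed measurable
  also have "\<dots> = 4 / r\<^sup>2 * (pi * r\<^sup>2)"
    using integral_soft_0_quadratic[OF assms] by simp
  finally show ?thesis
    using assms by simp
qed

lemma
  assumes e: "e > 0" and r: "r > 0"
  shows integrable_cut_soft2: "integrable lborel (\<lambda>z. soft2 e j k z * cut r z)"
    and integral_cut_soft2: "(LINT z|lborel. soft2 e j k z * cut r z) = moment e r j k"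
proof -
  have e0: "e \<noteq> 0"
    using e by simp
  obtain M where M: "M \<ge> 0" "\<And>z \<xi>. norm (\<xi> - z) \<le> 1 \<Longrightarrow> \<bar>soft2 e j k \<xi>\<bar> \<le> M / (1 + norm z)"
    using soft_bounds[OF e] by metis
  have M': "\<bar>soft2 e j k z\<bar> \<le> M" for z
  proof -
    have "M / (1 + norm z) \<le> M / 1"
      using M(1) by (intro divide_left_mono) (auto simp: add_pos_nonneg)
    then show ?thesis
      using M(2)[of z z] by simp
  qed
  show int: "integrable lborel (\<lambda>z. soft2 e j k z * cut r z)"
  proof (rule Bochner_Integration.integrable_bound)
    show "integrable lborel (\<lambda>z::real^3. M * indicator (cball 0 r) z)"
      by (intro integrable_mult_right integrable_real_indicator) (use emeasure_lborel_cball_finite[of "0::real^3" r] in auto)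
    show "AE z in lborel. norm (soft2 e j k z * cut r z) \<le> norm (M * indicator (cball 0 r) z)"
    proof (rule AE_I2)
      fix z
      show "norm (soft2 e j k z * cut r z) \<le> norm (M * indicator (cball 0 r) z)"
      proof (cases "norm z \<ge> r")
        case False
        have "\<bar>soft2 e j k z\<bar> * \<bar>cut r z\<bar> \<le> M * 1"
          using M(1) by (intro mult_mono M') (auto simp: cut_bounds)
        then show ?thesis
          using False M(1) by (simp add: abs_mult indicator_def)
      qed (use r in \<open>simp add: cut_outside\<close>)
    qed
  qed measurable
  \<comment> \<open>The integrand is the \<open>j\<close>-th partial derivative of the compactly
    supported function \<open>cut r z * soft1 e k z\<close>.\<close>
  have "(LINT z|lborel. cut1 r j z * soft1 e k z + soft2 e j k z * cut r z) = 0"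
  proof (rule integral_partial_compact_support[where u="\<lambda>z. cut r z * soft1 e k z"
      and g="\<lambda>j z. cut1 r j z * soft1 e k z + soft2 e j k z * cut r z" and r=r])
    show "((\<lambda>z. cut r z * soft1 e k z) has_derivative
        (\<lambda>h. \<Sum>j\<in>UNIV. h $ j *\<^sub>R (cut1 r j z * soft1 e k z + soft2 e j k z * cut r z))) (at z)" for z
      by (rule has_derivative_eq_rhs[OF has_derivative_mult[OF has_derivative_cut has_derivative_soft1_sum[OF e0]]])
         (auto simp: fun_eq_iff sum_distrib_left sum_distrib_right sum.distrib algebra_simps)
    show "continuous_on UNIV (\<lambda>z. cut1 r j z * soft1 e k z + soft2 e j k z * cut r z)" for j
      by (intro continuous_intros continuous_on_soft1 continuous_on_soft2 e0)
  qed (simp_all add: cut_outside cut1_outside r)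
  then show "(LINT z|lborel. soft2 e j k z * cut r z) = moment e r j k"
    by (simp add: moment_def Bochner_Integration.integral_add[OF integrable_cut1_soft1[OF r] int])
qed

context newton_density
begin

text \<open>Near \<open>x\<close> this is \<open>O(|x - y|)\<close>, so it can be integrated against the singular second
  derivatives of the kernel.\<close>

definition remainder :: "real \<Rightarrow> real^3 \<Rightarrow> real^3 \<Rightarrow> 'b"
  where "remainder r x y = q y - cut r (x - y) *\<^sub>R Q x"

text \<open>The candidate for the second derivatives: the right-hand side of
  \<open>conv_soft2_eq\<close> at \<open>e = 0\<close>. The parameter \<open>r\<close> is only an
  auxiliary choice and disappears once \<open>hess\<close> is identified with a derivative.\<close>

definition hess :: "real \<Rightarrow> 3 \<Rightarrow> 3 \<Rightarrow> real^3 \<Rightarrow> 'b"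
  where "hess r j k x = (LINT y|lborel. soft2 0 j k (x - y) *\<^sub>R remainder r x y) + moment 0 r j k *\<^sub>R Q x"

lemma measurable_remainder [measurable]: "remainder r x \<in> borel_measurable borel"
  unfolding remainder_def[abs_def] by measurable

lemma q_eq: "y \<in> \<Omega> \<Longrightarrow> q y = Q y"
  by (simp add: q_def)

context
  fixes x0 r L
  assumes x0: "x0 \<in> \<Omega>" and r: "r > 0" and L: "L \<ge> 0" and sub: "cball x0 (2 * r) \<subseteq> \<Omega>"
    and bound_ball: "\<forall>y\<in>cball x0 (2 * r). norm (Q y) \<le> L"
    and lipschitz_ball: "\<forall>x\<in>cball x0 (2 * r). \<forall>y\<in>cball x0 (2 * r). norm (Q x - Q y) \<le> L * norm (x - y)"
begin

lemmas bound = bspec[OF bound_ball]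

lemmas lipschitz = bspec[OF bspec[OF lipschitz_ball]]

lemma near_cball:
  assumes "x \<in> ball x0 r" "norm (x - y) < r"
  shows "x \<in> cball x0 (2 * r)" "y \<in> cball x0 (2 * r)"
proof -
  have "dist x0 y \<le> dist x0 x + dist x y"
    by (rule dist_triangle)
  then show "y \<in> cball x0 (2 * r)"
    using assms by (simp add: dist_norm[of x y])
  show "x \<in> cball x0 (2 * r)"
    using assms r by simp
qed

lemma norm_q_near: "x \<in> ball x0 r \<Longrightarrow> norm (x - y) < r \<Longrightarrow> norm (q y) \<le> L"
  using near_cball[of x y] sub bound[of y] by (auto simp: q_eq)

lemma norm_remainder_near:
  assumes "x \<in> ball x0 r" "norm (x - y) < r"
  shows "norm (remainder r x y) \<le> (L + 2 * L / r) * norm (x - y)"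
proof -
  note near = near_cball[OF assms]
  \<comment> \<open>The first summand is Lipschitz and gives \<open>L\<close>; the second is the
    defect of the cutoff times the bound of \<open>Q\<close> and gives
    \<open>2 * L / r\<close>.\<close>
  have "remainder r x y = (Q y - Q x) + (1 - cut r (x - y)) *\<^sub>R Q x"
    using near sub by (auto simp: remainder_def q_eq algebra_simps)
  also have "norm \<dots> \<le> norm (Q y - Q x) + \<bar>1 - cut r (x - y)\<bar> * norm (Q x)"
    by (metis norm_scaleR norm_triangle_ineq)
  also have "\<dots> \<le> L * norm (x - y) + (2 * norm (x - y) / r) * L"
  proof (intro add_mono mult_mono)
    show "norm (Q y - Q x) \<le> L * norm (x - y)"
      using lipschitz[OF near(2,1)] by (simp add: norm_minus_commute)
    show "\<bar>1 - cut r (x - y)\<bar> \<le> 2 * norm (x - y) / r"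
      using cut_lower[OF r, of "x - y"] cut_bounds(2)[of r "x - y"] by simp
  qed (use bound[OF near(1)] r in auto)
  finally show ?thesis
    by (simp add: algebra_simps)
qed

lemma remainder_far: "norm (x - y) \<ge> r \<Longrightarrow> remainder r x y = q y"
  by (simp add: remainder_def cut_outside r)

text \<open>The error \<open>a n\<close> must not depend on \<open>x\<close>. Its near part is an
  integral over a fixed ball and tends to 0 by dominated convergence with majorant |z|^-2; its far
  part carries the explicit factor \<open>eps n\<close>.\<close>

lemma conv_soft1_uniform:
  "\<exists>a. a \<longlonglongrightarrow> 0 \<and> (\<forall>n. \<forall>x\<in>ball x0 r. norm (conv (soft1 (eps n) k) x - conv (soft1 0 k) x) \<le> a n)"
proof -
  define D where "D n z = soft1 (eps n) k z - soft1 0 k z" for n z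
  define I where "I = (LINT y|lborel. soft 0 (x0 - y) * norm (q y))"
  define a where "a n = (LINT z|lborel. indicator (ball 0 r) z * (\<bar>D n z\<bar> * L)) + (3 * eps n / r\<^sup>2) * (2 * I)" for n
  have [measurable]: "D n \<in> borel_measurable borel" for n
    unfolding D_def by measurable
  have Dnear: "\<bar>D n z\<bar> * \<bar>L\<bar> \<le> (2 * L) * soft 0 z ^ 2" if "z \<noteq> 0" for n z
    using mult_right_mono[OF soft1_diff_near[OF that, of "eps n" k] L] L by (simp add: D_def mult_ac)
  have snear: "\<bar>soft1 0 k z\<bar> * \<bar>L\<bar> \<le> L * soft 0 z ^ 2" for z
    using mult_right_mono[OF abs_soft1_le[of 0 k z] L] L by (simp add: mult_ac)
  have "a \<longlonglongrightarrow> 0 + (3 * 0 / r\<^sup>2) * (2 * I)"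
    unfolding a_def[abs_def] using r
    by (intro tendsto_intros eps_tendsto near_tendsto_0[where C="2 * L"] Dnear)
       (auto simp: D_def intro: soft1_eps_tendsto)
  then have a0: "a \<longlonglongrightarrow> 0"
    by simp
  have "norm (conv (soft1 (eps n) k) x - conv (soft1 0 k) x) \<le> a n" if x: "x \<in> ball x0 r" for n x
  proof -
    note far = far_integral[OF x0 x refl measurable_q]
    have i0: "integrable lborel (\<lambda>y. soft1 0 k (x - y) *\<^sub>R q y)"
      by (rule near_far_integrable[where r=r and v="\<lambda>_. L" and c="1 / r"])
         (use near_integrable[of _ "\<lambda>_. L", OF _ _ r snear] far(1) norm_q_near[OF x] soft1_far[OF r] in auto)
    have "conv (soft1 (eps n) k) x - conv (soft1 0 k) x = (LINT y|lborel. D n (x - y) *\<^sub>R q y)"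
      unfolding conv_def D_def scaleR_diff_left
      by (rule Bochner_Integration.integral_diff[symmetric, OF integrable_soft1_q[OF eps_pos] i0])
    also have "norm \<dots> \<le> (LINT z|lborel. indicator (ball 0 r) z * (\<bar>D n z\<bar> * L)) + (3 * eps n / r\<^sup>2) *
        (LINT y|lborel. indicator (- ball x r) y * (soft 0 (x - y) * norm (q y)))"
    proof (rule near_far_bound)
      show "\<bar>D n z\<bar> \<le> (3 * eps n / r\<^sup>2) * soft 0 z" if "norm z \<ge> r" for z
        using soft1_diff_far[OF r that less_imp_le[OF eps_pos]] by (simp add: D_def)
      show "integrable lborel (\<lambda>z. indicator (ball 0 r) z * (\<bar>D n z\<bar> * L))"
        by (rule near_integrable[of _ "\<lambda>_. L", OF _ _ r Dnear]) auto
    qed (use far(1) norm_q_near[OF x] in auto)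
    also have "\<dots> \<le> a n"
      unfolding a_def I_def using far(2) eps_pos[of n] r by (intro add_left_mono mult_left_mono) auto
    finally show ?thesis .
  qed
  with a0 show ?thesis
    by (intro exI[of _ a] conjI allI ballI)
qed

text \<open>The term cut(x - y) Q(x) is subtracted and added back; Q(x) is constant in y, so the
  added integral is \<open>moment e r j k\<close> times Q(x). For \<open>e > 0\<close> both pieces
  converge without any cancellation.\<close>

lemma conv_soft2_eq:
  assumes e: "e > 0"
  shows "conv (soft2 e j k) x = (LINT y|lborel. soft2 e j k (x - y) *\<^sub>R remainder r x y) + moment e r j k *\<^sub>R Q x"
    and "integrable lborel (\<lambda>y. soft2 e j k (x - y) *\<^sub>R remainder r x y)"
proof -
  let ?c = "\<lambda>z. soft2 e j k z * cut r z"
  have m: "?c \<in> borel_measurable borel"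
    by measurable
  have ci: "integrable lborel (\<lambda>y. ?c (x - y))"
    using integrable_cut_soft2[OF e r] by (subst integrable_reflect[OF m])
  have cv: "(LINT y|lborel. ?c (x - y)) = moment e r j k"
    unfolding integral_reflect[OF m] by (rule integral_cut_soft2[OF e r])
  have eq: "soft2 e j k (x - y) *\<^sub>R remainder r x y = soft2 e j k (x - y) *\<^sub>R q y - ?c (x - y) *\<^sub>R Q x" for y
    by (simp add: remainder_def scaleR_diff_right)
  note ci2 = integrable_scaleR_left[OF ci, of "Q x"]
  show int: "integrable lborel (\<lambda>y. soft2 e j k (x - y) *\<^sub>R remainder r x y)"
    unfolding eq by (intro Bochner_Integration.integrable_diff integrable_soft2_q[OF e] ci2)
  have "(LINT y|lborel. soft2 e j k (x - y) *\<^sub>R remainder r x y) = conv (soft2 e j k) x - moment e r j k *\<^sub>R Q x"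
    unfolding eq Bochner_Integration.integral_diff[OF integrable_soft2_q[OF e] ci2] conv_def
    using ci by (simp add: cv)
  then show "conv (soft2 e j k) x = (LINT y|lborel. soft2 e j k (x - y) *\<^sub>R remainder r x y) + moment e r j k *\<^sub>R Q x"
    by simp
qed

lemma integrable_soft2_remainder:
  assumes x: "x \<in> ball x0 r"
  shows "integrable lborel (\<lambda>y. soft2 0 j k (x - y) *\<^sub>R remainder r x y)"
proof (rule near_far_integrable[where r=r and v="\<lambda>z. (L + 2 * L / r) * norm z" and c="4 / r ^ 2"])
  have "\<bar>soft2 0 j k z\<bar> * \<bar>(L + 2 * L / r) * norm z\<bar> \<le> (4 * (L + 2 * L / r)) * soft 0 z ^ 2" for z
  proof -
    have "\<bar>soft2 0 j k z\<bar> * ((L + 2 * L / r) * norm z) \<le> (4 * soft 0 z ^ 3) * ((L + 2 * L / r) * norm z)"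
      using L r by (intro mult_right_mono abs_soft2_le) auto
    also have "\<dots> = (4 * (L + 2 * L / r)) * (norm z * soft 0 z ^ 3)"
      by simp
    also have "\<dots> \<le> (4 * (L + 2 * L / r)) * soft 0 z ^ 2"
      using L r by (intro mult_left_mono norm_mult_soft_0_cube) auto
    finally show ?thesis
      using L r by (simp add: abs_mult)
  qed
  then show "integrable lborel (\<lambda>z. indicator (ball 0 r) z * (\<bar>soft2 0 j k z\<bar> * ((L + 2 * L / r) * norm z)))"
    by (intro near_integrable[of _ "\<lambda>z. (L + 2 * L / r) * norm z"] r) auto
  show "integrable lborel (\<lambda>y. indicator (- ball x r) y * (soft 0 (x - y) * norm (remainder r x y)))"
    by (rule far_integral(1)[OF x0 x remainder_far measurable_remainder])
qed (use norm_remainder_near[OF x] soft2_far[OF r] in auto)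

lemma conv_soft2_uniform:
  "\<exists>a. a \<longlonglongrightarrow> 0 \<and> (\<forall>n. \<forall>x\<in>ball x0 r. norm (conv (soft2 (eps n) j k) x - hess r j k x) \<le> a n)"
proof -
  define C where "C = L + 2 * L / r"
  have C: "C \<ge> 0"
    using L r by (simp add: C_def)
  define D where "D n z = soft2 (eps n) j k z - soft2 0 j k z" for n z
  define I where "I = (LINT y|lborel. soft 0 (x0 - y) * norm (q y))"
  \<comment> \<open>Besides the near and far parts there is a third error from the moments. In the
    near part the factor \<open>C * norm z\<close> from the remainder lowers the singularity from
    |z|^-3 to |z|^-2.\<close>
  define a where "a n = (LINT z|lborel. indicator (ball 0 r) z * (\<bar>D n z\<bar> * (C * norm z))) + (18 * eps n / r ^ 3) * (2 * I)
    + \<bar>moment (eps n) r j k - moment 0 r j k\<bar> * L" for n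
  have [measurable]: "D n \<in> borel_measurable borel" for n
    unfolding D_def by measurable
  have Dnear: "\<bar>D n z\<bar> * \<bar>C * norm z\<bar> \<le> (8 * C) * soft 0 z ^ 2" if "z \<noteq> 0" for n z
  proof -
    have "\<bar>D n z\<bar> * (C * norm z) \<le> (8 * soft 0 z ^ 3) * (C * norm z)"
      unfolding D_def using C by (intro mult_right_mono soft2_diff_near[OF that]) auto
    also have "\<dots> = (8 * C) * (norm z * soft 0 z ^ 3)"
      by simp
    also have "\<dots> \<le> (8 * C) * soft 0 z ^ 2"
      using C by (intro mult_left_mono norm_mult_soft_0_cube) auto
    finally show ?thesis
      using C by (simp add: abs_mult)
  qed
  have m: "D n \<in> borel_measurable borel" "(\<lambda>z::real^3. C * norm z) \<in> borel_measurable borel" for n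
    by measurable
  have lim: "(\<lambda>n. D n z) \<longlonglongrightarrow> 0" if "z \<noteq> 0" for z
    unfolding D_def by (rule soft2_eps_tendsto[OF that])
  note t1 = near_tendsto_0[where D=D and v="\<lambda>z. C * norm z", OF m r Dnear lim]
  have t2: "(\<lambda>n. (18 * eps n / r ^ 3) * (2 * I)) \<longlonglongrightarrow> 0"
    using tendsto_mult_left[OF eps_tendsto, of "18 / r ^ 3 * (2 * I)"] by (simp add: mult_ac)
  have t3: "(\<lambda>n. \<bar>moment (eps n) r j k - moment 0 r j k\<bar> * L) \<longlonglongrightarrow> 0"
    by (rule tendsto_mult_left_zero[OF tendsto_rabs_zero[OF LIM_zero[OF moment_tendsto[OF r]]]])
  have a0: "a \<longlonglongrightarrow> 0"
    using tendsto_add[OF tendsto_add[OF t1 t2] t3] unfolding a_def[abs_def] by simp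
  have "norm (conv (soft2 (eps n) j k) x - hess r j k x) \<le> a n" if x: "x \<in> ball x0 r" for n x
  proof -
    note far = far_integral[OF x0 x remainder_far measurable_remainder]
    note eq = conv_soft2_eq[OF eps_pos[of n], of j k x]
    let ?R = "LINT y|lborel. D n (x - y) *\<^sub>R remainder r x y"
    have "?R = (LINT y|lborel. soft2 (eps n) j k (x - y) *\<^sub>R remainder r x y)
        - (LINT y|lborel. soft2 0 j k (x - y) *\<^sub>R remainder r x y)"
      unfolding D_def scaleR_diff_left
      by (rule Bochner_Integration.integral_diff[OF eq(2) integrable_soft2_remainder[OF x]])
    then have "conv (soft2 (eps n) j k) x - hess r j k x = ?R + (moment (eps n) r j k - moment 0 r j k) *\<^sub>R Q x"
      by (simp add: eq(1) hess_def scaleR_diff_left)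
    then have 1: "norm (conv (soft2 (eps n) j k) x - hess r j k x)
        \<le> norm ?R + \<bar>moment (eps n) r j k - moment 0 r j k\<bar> * norm (Q x)"
      using norm_triangle_ineq[of ?R "(moment (eps n) r j k - moment 0 r j k) *\<^sub>R Q x"] by simp
    let ?N = "LINT z|lborel. indicator (ball 0 r) z * (\<bar>D n z\<bar> * (C * norm z))"
    let ?F = "LINT y|lborel. indicator (- ball x r) y * (soft 0 (x - y) * norm (remainder r x y))"
    have 2: "norm ?R \<le> ?N + (18 * eps n / r ^ 3) * ?F"
    proof (rule near_far_bound[where D="D n" and g="remainder r x" and v="\<lambda>z. C * norm z" and x=x and r=r
          and c="18 * eps n / r ^ 3"])
      show "\<bar>D n z\<bar> \<le> (18 * eps n / r ^ 3) * soft 0 z" if "norm z \<ge> r" for z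
        using soft2_diff_far[OF r that less_imp_le[OF eps_pos]] by (simp add: D_def)
      show "integrable lborel (\<lambda>z. indicator (ball 0 r) z * (\<bar>D n z\<bar> * (C * norm z)))"
        by (rule near_integrable[where D="D n" and v="\<lambda>z. C * norm z", OF m r Dnear])
      show "integrable lborel (\<lambda>y. indicator (- ball x r) y * (soft 0 (x - y) * norm (remainder r x y)))"
        by (rule far(1))
      show "norm (remainder r x y) \<le> C * norm (x - y)" if "norm (x - y) < r" for y
        unfolding C_def by (rule norm_remainder_near[OF x that])
    qed measurable
    have 3: "(18 * eps n / r ^ 3) * ?F \<le> (18 * eps n / r ^ 3) * (2 * I)"
      unfolding I_def using eps_pos[of n] r by (intro mult_left_mono far(2)) auto
    have 4: "\<bar>moment (eps n) r j k - moment 0 r j k\<bar> * norm (Q x) \<le> \<bar>moment (eps n) r j k - moment 0 r j k\<bar> * L"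
      using x r by (intro mult_left_mono bound) auto
    from 1 2 3 4 show ?thesis
      unfolding a_def by linarith
  qed
  with a0 show ?thesis
    by (intro exI[of _ a] conjI allI ballI)
qed

lemma hess_properties:
  assumes x: "x \<in> ball x0 r"
  shows has_derivative_conv_soft_0: "(conv (soft 0) has_derivative (\<lambda>h. \<Sum>j\<in>UNIV. h $ j *\<^sub>R conv (soft1 0 j) x)) (at x)"
    and has_derivative_conv_soft1_0: "(conv (soft1 0 k) has_derivative (\<lambda>h. \<Sum>j\<in>UNIV. h $ j *\<^sub>R hess r j k x)) (at x)"
    and conv_soft1_tendsto: "(\<lambda>n. conv (soft1 (eps n) k) x) \<longlonglongrightarrow> conv (soft1 0 k) x"
    and isCont_hess: "isCont (hess r j k) x"
    and hess_commute: "hess r j k x = hess r k j x"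
    and hess_trace: "(\<Sum>j\<in>UNIV. hess r j j x) = - (4 * pi) *\<^sub>R Q x"
proof -
  have sub': "ball x0 r \<subseteq> \<Omega>"
    by (rule subset_trans[OF _ sub]) (use r in auto)
  have "\<forall>k. \<exists>a. a \<longlonglongrightarrow> 0 \<and>
    (\<forall>n. \<forall>x\<in>ball x0 r. norm (conv (soft1 (eps n) k) x - conv (soft1 0 k) x) \<le> a n)"
    by (rule allI) (rule conv_soft1_uniform)
  from choice[OF this] obtain a where "\<forall>k. a k \<longlonglongrightarrow> 0 \<and>
    (\<forall>n. \<forall>x\<in>ball x0 r. norm (conv (soft1 (eps n) k) x - conv (soft1 0 k) x) \<le> a k n)" ..
  then have a: "a k \<longlonglongrightarrow> 0"
      "x \<in> ball x0 r \<Longrightarrow> norm (conv (soft1 (eps n) k) x - conv (soft1 0 k) x) \<le> a k n" for k n x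
    by simp_all
  have "\<forall>jk. \<exists>b. b \<longlonglongrightarrow> 0 \<and> (\<forall>n. \<forall>x\<in>ball x0 r.
      norm (conv (soft2 (eps n) (fst jk) (snd jk)) x - hess r (fst jk) (snd jk) x) \<le> b n)"
    by (rule allI) (rule conv_soft2_uniform)
  from choice[OF this] obtain b where "\<forall>jk. b jk \<longlonglongrightarrow> 0 \<and> (\<forall>n. \<forall>x\<in>ball x0 r.
      norm (conv (soft2 (eps n) (fst jk) (snd jk)) x - hess r (fst jk) (snd jk) x) \<le> b jk n)" ..
  from this[rule_format, of "(_, _)"]
  have b: "b (j, k) \<longlonglongrightarrow> 0"
      "x \<in> ball x0 r \<Longrightarrow> norm (conv (soft2 (eps n) j k) x - hess r j k x) \<le> b (j, k) n" for j k n x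
    by simp_all
  have c1: "(\<lambda>n. conv (soft1 (eps n) k) x) \<longlonglongrightarrow> conv (soft1 0 k) x" if "x \<in> ball x0 r" for k x
    by (rule LIM_zero_cancel, rule Lim_null_comparison[OF _ a(1)[of k]]) (use a(2)[OF that] in simp)
  have c2: "(\<lambda>n. conv (soft2 (eps n) j k) x) \<longlonglongrightarrow> hess r j k x" if "x \<in> ball x0 r" for j k x
    by (rule LIM_zero_cancel, rule Lim_null_comparison[OF _ b(1)[of j k]]) (use b(2)[OF that] in simp)
  show "(\<lambda>n. conv (soft1 (eps n) k) x) \<longlonglongrightarrow> conv (soft1 0 k) x"
    by (rule c1[OF x])
  show "(conv (soft 0) has_derivative (\<lambda>h. \<Sum>j\<in>UNIV. h $ j *\<^sub>R conv (soft1 0 j) x)) (at x)"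
    by (rule has_derivative_uniform_limit[where f="\<lambda>n. conv (soft (eps n))" and g="\<lambda>n j. conv (soft1 (eps n) j)"
          and a=a and ?x0.0=x0 and r=r])
       (rule has_derivative_conv_soft[OF eps_pos] a(2) a(1) conv_soft_tendsto[OF subsetD[OF sub']] x; assumption)+
  show "(conv (soft1 0 k) has_derivative (\<lambda>h. \<Sum>j\<in>UNIV. h $ j *\<^sub>R hess r j k x)) (at x)"
    by (rule has_derivative_uniform_limit[where f="\<lambda>n. conv (soft1 (eps n) k)" and g="\<lambda>n j. conv (soft2 (eps n) j k)"
          and a="\<lambda>j. b (j, k)" and ?x0.0=x0 and r=r])
       (rule has_derivative_conv_soft1[OF eps_pos] b(2) b(1) c1 x; assumption)+
  \<comment> \<open>Symmetry passes to the limit from the regularised second derivatives.\<close>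
  show "hess r j k x = hess r k j x"
    by (rule LIMSEQ_unique[OF c2[OF x, of j k]])
       (use c2[OF x, of k j] in \<open>simp add: soft2_commute[of _ j k, abs_def]\<close>)
  have "continuous_on (ball x0 r) (hess r j k)"
  proof (rule uniform_limit_theorem)
    show "\<forall>\<^sub>F n in sequentially. continuous_on (ball x0 r) (conv (soft2 (eps n) j k))"
      using isCont_conv_soft2[OF eps_pos] by (simp add: continuous_at_imp_continuous_on)
    show "uniform_limit (ball x0 r) (\<lambda>n. conv (soft2 (eps n) j k)) (hess r j k) sequentially"
    proof (rule uniform_limitI)
      fix e :: real assume "e > 0"
      with b(1)[of j k] have "\<forall>\<^sub>F n in sequentially. b (j, k) n < e"
        by (rule order_tendstoD(2))
      then show "\<forall>\<^sub>F n in sequentially. \<forall>x\<in>ball x0 r. dist (conv (soft2 (eps n) j k) x) (hess r j k x) < e"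
        by eventually_elim (simp only: dist_norm, intro ballI le_less_trans[OF b(2)])
    qed
  qed simp
  then show "isCont (hess r j k) x"
    using x by (simp add: continuous_on_eq_continuous_at)
  \<comment> \<open>The trace of \<open>soft2 0\<close> vanishes for \<open>y \<noteq> x\<close>, so
    the integral contributes nothing and the whole Laplacian comes from the moments.\<close>
  have "(\<Sum>j\<in>UNIV. hess r j j x) = (LINT y|lborel. (\<Sum>j\<in>UNIV. soft2 0 j j (x - y) *\<^sub>R remainder r x y))
      + (\<Sum>j\<in>UNIV. moment 0 r j j) *\<^sub>R Q x"
    unfolding hess_def by (simp add: sum.distrib integral_sum integrable_soft2_remainder[OF x] scaleR_sum_left)
  also have "(LINT y|lborel. (\<Sum>j\<in>UNIV. soft2 0 j j (x - y) *\<^sub>R remainder r x y)) = (LINT y|(lborel :: (real^3) measure). 0)"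
  proof (rule integral_cong_AE)
    show "AE y in lborel. (\<Sum>j\<in>UNIV. soft2 0 j j (x - y) *\<^sub>R remainder r x y) = 0"
      by (rule AE_mp[OF AE_lborel_nonzero[of x] AE_I2]) (auto simp: soft2_0_trace simp flip: scaleR_sum_left)
  qed measurable
  finally show "(\<Sum>j\<in>UNIV. hess r j j x) = - (4 * pi) *\<^sub>R Q x"
    using moment_trace[OF r] by simp
qed

end

end

section \<open>Locality of partial derivatives and passage to the whole domain\<close>

lemma
  assumes "open \<Omega>" "\<And>y. y \<in> \<Omega> \<Longrightarrow> u y = v y" "x \<in> \<Omega>"
  shows partial_cong_open: "partial k u x = partial k v x"
    and differentiable_cong_open: "u differentiable at x \<longleftrightarrow> v differentiable at x"
proof -
  have iff: "(u has_derivative u') (at x) \<longleftrightarrow> (v has_derivative u') (at x)" for u'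
    using has_derivative_transform_within_open[of u u' x UNIV \<Omega> v]
      has_derivative_transform_within_open[of v u' x UNIV \<Omega> u] assms by auto
  then show "u differentiable at x \<longleftrightarrow> v differentiable at x"
    by (simp add: differentiable_def)
  have "\<forall>\<^sub>F t in nhds 0. x + t *\<^sub>R axis k 1 \<in> \<Omega>"
  proof (rule topological_tendstoD[OF _ assms(1)])
    have "((\<lambda>t. x + t *\<^sub>R axis k 1) \<longlongrightarrow> x + 0 *\<^sub>R axis k 1) (nhds (0::real))"
      by (intro tendsto_intros filterlim_ident)
    then show "((\<lambda>t. x + t *\<^sub>R axis k 1) \<longlongrightarrow> x) (nhds (0::real))"
      by simp
  qed (rule assms(3))
  then have "\<forall>\<^sub>F t in nhds 0. u (x + t *\<^sub>R axis k 1) = v (x + t *\<^sub>R axis k 1)"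
    by eventually_elim (rule assms(2))
  then show "partial k u x = partial k v x"
    unfolding partial_def by (intro vector_derivative_cong_eq) simp_all
qed

lemma C1_on_cong_open:
  assumes "open \<Omega>" "\<And>y. y \<in> \<Omega> \<Longrightarrow> u y = v y" "C1_on \<Omega> v"
  shows "C1_on \<Omega> u"
  unfolding C1_on_def
proof (intro conjI ballI allI)
  show "u differentiable at x" if "x \<in> \<Omega>" for x
    using differentiable_cong_open[OF assms(1,2) that] C1_on_differentiable[OF assms(3) that] by simp
  show "continuous_on \<Omega> (partial k u)" for k
    by (rule continuous_on_eq[OF C1_on_partial[OF assms(3), of k]])
       (simp add: partial_cong_open[OF assms(1,2)])
qed

context newton_density
begin

text \<open>At each point a radius is chosen separately. Since \<open>hess r j k\<close> agrees with
  \<open>partial j (conv (soft1 0 k))\<close> on a whole ball, the statements can be made without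
  \<open>r\<close>, and continuity at the centre is enough.\<close>

lemma
  assumes x: "x \<in> \<Omega>"
  shows has_derivative_newton: "(conv (soft 0) has_derivative (\<lambda>h. \<Sum>j\<in>UNIV. h $ j *\<^sub>R conv (soft1 0 j) x)) (at x)"
    and newton1_tendsto: "(\<lambda>n. conv (soft1 (eps n) k) x) \<longlonglongrightarrow> conv (soft1 0 k) x"
    and differentiable_newton1: "conv (soft1 0 k) differentiable at x"
    and isCont_partial_newton1: "isCont (partial j (conv (soft1 0 k))) x"
    and partial_newton1_commute: "partial j (conv (soft1 0 k)) x = partial k (conv (soft1 0 j)) x"
    and partial_newton1_trace: "(\<Sum>j\<in>UNIV. partial j (conv (soft1 0 j)) x) = - (4 * pi) *\<^sub>R Q x"
proof -
  obtain r L where rL: "r > 0" "L \<ge> 0" "cball x (2 * r) \<subseteq> \<Omega>"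
    "\<forall>y\<in>cball x (2 * r). norm (Q y) \<le> L"
    "\<forall>y\<in>cball x (2 * r). \<forall>z\<in>cball x (2 * r). norm (Q y - Q z) \<le> L * norm (y - z)"
    by (rule local_bounds[OF x], rule that)
  note H = hess_properties[OF x rL]
  have xx: "x \<in> ball x r"
    using rL(1) by simp
  show "(conv (soft 0) has_derivative (\<lambda>h. \<Sum>j\<in>UNIV. h $ j *\<^sub>R conv (soft1 0 j) x)) (at x)"
    by (rule H(1)[OF xx])
  show "(\<lambda>n. conv (soft1 (eps n) k) x) \<longlonglongrightarrow> conv (soft1 0 k) x"
    by (rule H(3)[OF xx])
  show "conv (soft1 0 k) differentiable at x"
    unfolding differentiable_def by (rule exI, rule H(2)[OF xx])
  have p: "partial j (conv (soft1 0 k)) y = hess r j k y" if "y \<in> ball x r" for y j k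
    by (rule partial_eq_coeff[OF H(2)[OF that]])
  show "isCont (partial j (conv (soft1 0 k))) x"
  proof (rule isCont_cong[THEN iffD2, OF _ H(4)[OF xx, of j k]])
    show "\<forall>\<^sub>F y in nhds x. partial j (conv (soft1 0 k)) y = hess r j k y"
      using eventually_nhds_in_open[OF open_ball xx] by eventually_elim (rule p)
  qed
  show "partial j (conv (soft1 0 k)) x = partial k (conv (soft1 0 j)) x"
    unfolding p[OF xx] by (rule H(5)[OF xx])
  show "(\<Sum>j\<in>UNIV. partial j (conv (soft1 0 j)) x) = - (4 * pi) *\<^sub>R Q x"
    unfolding p[OF xx] by (rule H(6)[OF xx])
qed

lemma C1_on_newton1: "C1_on \<Omega> (conv (soft1 0 k))"
  unfolding C1_on_def
  by (intro conjI ballI allI differentiable_newton1 continuous_at_imp_continuous_on isCont_partial_newton1)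

end

lemma Bop_eq_newton:
  assumes "newton_density \<Omega> Q"
  shows "Bop \<Omega> Q x = (1 / (4 * pi)) *\<^sub>R newton_density.conv \<Omega> Q (soft 0) x"
proof -
  interpret newton_density \<Omega> Q
    by (rule assms)
  have "indicator \<Omega> y *\<^sub>R ((1 / norm (x - y)) *\<^sub>R Q y) = soft 0 (x - y) *\<^sub>R q y" for y
    by (simp add: soft_0 q_def inverse_eq_divide scaleR_left_commute)
  then show ?thesis
    unfolding Bop_def set_lebesgue_integral_def conv_def by simp
qed

section \<open>The divergence of the regularised potential\<close>

lemma has_derivative_reflect:
  assumes "\<And>z. (u has_derivative (\<lambda>h. \<Sum>j\<in>UNIV. h $ j *\<^sub>R g j z)) (at z)"
  shows "((\<lambda>y. u (x - y)) has_derivative (\<lambda>h. \<Sum>j\<in>UNIV. h $ j *\<^sub>R (- g j (x - y)))) (at y)"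
proof -
  have "((\<lambda>y. x - y) has_derivative (\<lambda>h. - h)) (at y)"
    by (auto intro!: derivative_eq_intros)
  from has_derivative_compose[OF this assms] show ?thesis
    by simp
qed

text \<open>Up to sign, the sum is the integral of the y-gradient of \<open>soft e (x - y)\<close>
  paired with the density, which the zero normal trace annihilates for compactly supported test
  functions. The kernel is therefore multiplied by \<open>cut R\<close>, and \<open>R\<close> tends
  to infinity.\<close>

lemma div_regularised_newton:
  fixes Q :: "real^3 \<Rightarrow> complex^3"
  assumes nd: "newton_density \<Omega> Q" and zt: "zero_normal_trace \<Omega> Q" and e: "e > 0"
  shows "(\<Sum>k\<in>UNIV. newton_density.conv \<Omega> Q (soft1 e k) x $ k) = 0"
proof -
  interpret newton_density \<Omega> Q
    by (rule nd)
  have e0: "e \<noteq> 0"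
    using e by simp
  obtain M where M: "M \<ge> 0"
    "\<And>z \<xi>. norm (\<xi> - z) \<le> 1 \<Longrightarrow> \<bar>soft e \<xi>\<bar> \<le> M / (1 + norm z)"
    "\<And>z \<xi> k. norm (\<xi> - z) \<le> 1 \<Longrightarrow> \<bar>soft1 e k \<xi>\<bar> \<le> M / (1 + norm z)"
    by (rule soft_bounds[OF e], rule that)
  have [measurable]: "(\<lambda>y. q y $ k) \<in> borel_measurable borel" for k
    by (rule measurable_compose[OF measurable_q]) (intro borel_measurable_continuous_onI continuous_intros)
  \<comment> \<open>The \<open>k\<close>-th partial derivative of the truncated kernel, by the
    product rule.\<close>
  define g where "g R k z = cut1 R k z * soft e z + soft1 e k z * cut R z" for R k z
  have [measurable]: "g R k \<in> borel_measurable borel" for R k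
    unfolding g_def[abs_def] by measurable
  have deriv: "((\<lambda>z. cut R z * soft e z) has_derivative (\<lambda>h. \<Sum>k\<in>UNIV. h $ k *\<^sub>R g R k z)) (at z)" for R z
    unfolding g_def
    by (rule has_derivative_eq_rhs[OF has_derivative_mult[OF has_derivative_cut has_derivative_soft_sum[OF e0]]])
       (auto simp: fun_eq_iff sum_distrib_left sum_distrib_right sum.distrib algebra_simps)
  have zero: "(LINT y|lborel. (\<Sum>k\<in>UNIV. g R k (x - y) *\<^sub>R (q y $ k))) = 0" if R: "R > 0" for R
  proof -
    let ?\<eta> = "\<lambda>y. cut R (x - y) * soft e (x - y)"
    note d = has_derivative_reflect[OF deriv, of R x]
    have "continuous_on UNIV (\<lambda>y. - g R k (x - y))" for k
    proof -
      have "continuous_on UNIV (g R k)"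
        unfolding g_def[abs_def] by (intro continuous_intros continuous_on_soft continuous_on_soft1 e0)
      then have "continuous_on UNIV (\<lambda>y. g R k (x - y))"
        by (rule continuous_on_compose2) (auto intro!: continuous_intros)
      then show ?thesis
        by (rule continuous_on_minus)
    qed
    then have "C1_on UNIV ?\<eta>"
      by (intro C1_onI[OF d])
    moreover have "\<exists>K. compact K \<and> (\<forall>y. y \<notin> K \<longrightarrow> ?\<eta> y = 0)"
      by (rule exI[of _ "cball x R"]) (auto simp: dist_norm cut_outside[OF R])
    ultimately have "(LINT y:\<Omega>|lborel. (\<Sum>k\<in>UNIV. partial k ?\<eta> y *\<^sub>R Q y $ k)) = 0"
      using zt[unfolded zero_normal_trace_def, rule_format, of ?\<eta>] by blast
    moreover have "indicator \<Omega> y *\<^sub>R (\<Sum>k\<in>UNIV. partial k ?\<eta> y *\<^sub>R Q y $ k)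
        = - (\<Sum>k\<in>UNIV. g R k (x - y) *\<^sub>R (q y $ k))" for y
      unfolding partial_eq_coeff[OF d] by (simp add: q_def indicator_def sum_negf)
    ultimately show ?thesis
      by (simp add: set_lebesgue_integral_def)
  qed
  let ?s = "\<lambda>y. \<Sum>k\<in>UNIV. soft1 e k (x - y) *\<^sub>R (q y $ k)"
  have "(\<lambda>n. LINT y|lborel. (\<Sum>k\<in>UNIV. g (real (Suc n)) k (x - y) *\<^sub>R (q y $ k))) \<longlonglongrightarrow> (LINT y|lborel. ?s y)"
  proof (rule integral_dominated_convergence)
    \<comment> \<open>15 = 3 (4 + 1): three components, each with a bound 4 for \<open>cut1\<close>
      and 1 for \<open>cut\<close>. The radii \<open>Suc n\<close> are at least 1, so 4/R is at most
      4.\<close>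
    show "integrable lborel (\<lambda>y. (15 * M) / (1 + norm (x - y)) * norm (q y))"
      by (rule integrable_weight_q)
    show "AE y in lborel. norm (\<Sum>k\<in>UNIV. g (real (Suc n)) k (x - y) *\<^sub>R (q y $ k))
        \<le> (15 * M) / (1 + norm (x - y)) * norm (q y)" for n
    proof (rule AE_I2)
      fix y
      let ?w = "M / (1 + norm (x - y))"
      have "norm (g (real (Suc n)) k (x - y) *\<^sub>R (q y $ k)) \<le> (5 * ?w) * norm (q y)" for k
      proof -
        have "\<bar>cut1 (real (Suc n)) k (x - y)\<bar> \<le> 4"
          using abs_cut1_le[of "real (Suc n)" k "x - y"]
          by (rule order_trans) (simp_all add: divide_le_eq)
        then have "\<bar>cut1 (real (Suc n)) k (x - y) * soft e (x - y)\<bar> \<le> 4 * ?w"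
          unfolding abs_mult using M(2)[of "x - y" "x - y"] by (intro mult_mono) auto
        moreover have "\<bar>soft1 e k (x - y) * cut (real (Suc n)) (x - y)\<bar> \<le> ?w * 1"
          unfolding abs_mult using M(3)[of "x - y" "x - y" k] M(1)
          by (intro mult_mono) (auto simp: cut_bounds)
        ultimately have "\<bar>g (real (Suc n)) k (x - y)\<bar> \<le> 5 * ?w"
          unfolding g_def by linarith
        moreover have "norm (q y $ k) \<le> norm (q y)"
          by (rule Finite_Cartesian_Product.norm_nth_le)
        ultimately show ?thesis
          unfolding norm_scaleR using M(1) by (intro mult_mono) auto
      qed
      then have "norm (\<Sum>k\<in>UNIV. g (real (Suc n)) k (x - y) *\<^sub>R (q y $ k)) \<le> (\<Sum>k\<in>(UNIV::3 set). (5 * ?w) * norm (q y))"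
        by (intro sum_norm_le)
      then show "norm (\<Sum>k\<in>UNIV. g (real (Suc n)) k (x - y) *\<^sub>R (q y $ k)) \<le> (15 * M) / (1 + norm (x - y)) * norm (q y)"
        by simp
    qed
    show "AE y in lborel. (\<lambda>n. \<Sum>k\<in>UNIV. g (real (Suc n)) k (x - y) *\<^sub>R (q y $ k)) \<longlonglongrightarrow> ?s y"
    proof (rule AE_I2, rule tendsto_sum)
      fix y and k :: 3
      have inv: "(\<lambda>n. c / real (Suc n)) \<longlonglongrightarrow> 0" for c :: real
        using tendsto_mult_left[OF LIMSEQ_inverse_real_of_nat, of c] by (simp add: divide_inverse)
      have "(\<lambda>n. cut1 (real (Suc n)) k (x - y)) \<longlonglongrightarrow> 0"
        by (rule Lim_null_comparison[OF _ inv[of 4]]) (simp add: abs_cut1_le del: of_nat_Suc)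
      moreover have "(\<lambda>n. 1 - cut (real (Suc n)) (x - y)) \<longlonglongrightarrow> 0"
        by (rule Lim_null_comparison[OF _ inv[of "2 * norm (x - y)"]])
           (use cut_lower[of "real (Suc _)" "x - y"] cut_bounds(2)[of "real (Suc _)" "x - y"] in \<open>simp del: of_nat_Suc\<close>)
      then have "(\<lambda>n. 1 - (1 - cut (real (Suc n)) (x - y))) \<longlonglongrightarrow> 1 - 0"
        by (intro tendsto_diff tendsto_const)
      ultimately have "(\<lambda>n. g (real (Suc n)) k (x - y)) \<longlonglongrightarrow> 0 * soft e (x - y) + soft1 e k (x - y) * 1"
        unfolding g_def by (intro tendsto_add tendsto_mult tendsto_const) simp_all
      then show "(\<lambda>n. g (real (Suc n)) k (x - y) *\<^sub>R (q y $ k)) \<longlonglongrightarrow> soft1 e k (x - y) *\<^sub>R (q y $ k)"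
        by (intro tendsto_scaleR tendsto_const) simp
    qed
  qed measurable
  then have "(LINT y|lborel. ?s y) = 0"
    by (simp add: zero LIMSEQ_const_iff)
  moreover have "conv (soft1 e k) x $ k = (LINT y|lborel. soft1 e k (x - y) *\<^sub>R (q y $ k))"
    and "integrable lborel (\<lambda>y. soft1 e k (x - y) *\<^sub>R (q y $ k))" for k
    using integral_bounded_linear[OF bounded_linear_vec_nth[of k] integrable_soft1_q[OF e, of k x]]
      integrable_bounded_linear[OF bounded_linear_vec_nth[of k] integrable_soft1_q[OF e, of k x]]
    by (simp_all add: conv_def)
  ultimately show ?thesis
    by simp
qed

section \<open>Potentials by line integration\<close>

text \<open>A coordinate form of the Leibniz rule: the derivative is packaged as a bounded linear
  operator \<open>B\<close>, whose continuity reduces to that of its three coefficients.\<close>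

lemma leibniz_rule_partials:
  fixes F :: "real^3 \<Rightarrow> real \<Rightarrow> complex" and F' :: "3 \<Rightarrow> real^3 \<Rightarrow> real \<Rightarrow> complex"
  assumes U: "open U" "convex U" "x \<in> U"
    and F: "\<And>x t. x \<in> U \<Longrightarrow> t \<in> {0..1} \<Longrightarrow> ((\<lambda>x. F x t) has_derivative (\<lambda>h. \<Sum>j\<in>UNIV. h $ j *\<^sub>R F' j x t)) (at x)"
    and Fi: "\<And>x. x \<in> U \<Longrightarrow> continuous_on {0..1} (F x)"
    and F': "\<And>j. continuous_on (U \<times> {0..1}) (\<lambda>(x, t). F' j x t)"
  shows "((\<lambda>x. integral {0..1} (F x)) has_derivative
    (\<lambda>h. \<Sum>j\<in>UNIV. h $ j *\<^sub>R integral {0..1} (F' j x))) (at x)"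
proof -
  define B where "B y t = (\<Sum>j\<in>UNIV. blinfun_scaleR_left (F' j y t) o\<^sub>L blinfun_inner_left (axis j 1 :: real^3))" for y t
  have B: "blinfun_apply (B y t) h = (\<Sum>j\<in>UNIV. h $ j *\<^sub>R F' j y t)" for y t and h :: "real^3"
    by (simp add: B_def blinfun.sum_left inner_axis)
  have contB: "continuous_on (U \<times> {0..1}) (\<lambda>(y, t). B y t)"
  proof -
    have bl: "bounded_linear (\<lambda>c. blinfun_scaleR_left c o\<^sub>L blinfun_inner_left (axis j 1 :: real^3))" for j
      by (intro bounded_linear_intros)
    have "continuous_on (U \<times> {0..1}) (\<lambda>p. \<Sum>j\<in>UNIV. blinfun_scaleR_left (F' j (fst p) (snd p)) o\<^sub>L blinfun_inner_left (axis j 1 :: real^3))"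
      using F' by (intro continuous_on_sum bounded_linear.continuous_on[OF bl]) (simp add: split_beta')
    then show ?thesis
      by (simp add: B_def split_beta')
  qed
  have contF': "continuous_on {0..1} (F' j x)" for j
  proof -
    have "continuous_on {0..1} (\<lambda>t. (\<lambda>(y, t). F' j y t) (x, t))"
      by (rule continuous_on_compose2[OF F'[of j]]) (use U in \<open>auto intro!: continuous_intros\<close>)
    then show ?thesis
      by simp
  qed
  have contBx: "continuous_on {0..1} (B x)"
  proof -
    have "continuous_on {0..1} (\<lambda>t. (\<lambda>(y, t). B y t) (x, t))"
      by (rule continuous_on_compose2[OF contB]) (use U in \<open>auto intro!: continuous_intros\<close>)
    then show ?thesis
      by simp
  qed
  have "((\<lambda>x. integral (cbox 0 1) (F x)) has_derivative integral (cbox 0 1) (B x)) (at x within U)"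
  proof (rule leibniz_rule[where fx=B])
    show "((\<lambda>x. F x t) has_derivative blinfun_apply (B y t)) (at y within U)" if "y \<in> U" "t \<in> cbox 0 1" for y t
      unfolding B using that by (intro has_derivative_at_withinI[OF F]) auto
    show "F y integrable_on cbox 0 1" if "y \<in> U" for y
      using Fi[OF that] by (intro integrable_continuous) simp
    show "continuous_on (U \<times> cbox 0 1) (\<lambda>(y, t). B y t)"
      using contB by simp
  qed (use U in auto)
  moreover have "blinfun_apply (integral {0..1} (B x)) h = (\<Sum>j\<in>UNIV. h $ j *\<^sub>R integral {0..1} (F' j x))" for h
  proof -
    have "blinfun_apply (integral {0..1} (B x)) h = integral {0..1} (\<lambda>t. blinfun_apply (B x t) h)"
      using integral_linear[OF integrable_continuous_real[OF contBx], of "\<lambda>f. blinfun_apply f h"]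
      by (simp add: o_def blinfun.bounded_linear_left)
    also have "\<dots> = (\<Sum>j\<in>UNIV. h $ j *\<^sub>R integral {0..1} (F' j x))"
      unfolding B by (subst integral_sum) (auto intro!: integrable_continuous_real continuous_intros contF')
    finally show ?thesis .
  qed
  then have "blinfun_apply (integral {0..1} (B x)) = (\<lambda>h. \<Sum>j\<in>UNIV. h $ j *\<^sub>R integral {0..1} (F' j x))"
    by (rule ext)
  ultimately show ?thesis
    by (simp add: at_within_open[OF U(3,1)])
qed

text \<open>Real directions are paired with complex fields, so \<open>cdot\<close> does not apply.
  As a bounded bilinear map it comes with a product rule.\<close>

definition pairing :: "real^3 \<Rightarrow> complex^3 \<Rightarrow> complex"
  where "pairing v e = (\<Sum>k\<in>UNIV. v $ k *\<^sub>R e $ k)"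

lemma bounded_bilinear_pairing: "bounded_bilinear pairing"
  unfolding pairing_def[abs_def]
proof (rule bounded_bilinear.intro)
  show "\<exists>K. \<forall>(v::real^3) (e::complex^3). norm (\<Sum>k\<in>UNIV. v $ k *\<^sub>R e $ k) \<le> norm v * norm e * K"
  proof (intro exI allI)
    fix v :: "real^3" and e :: "complex^3"
    have "norm (\<Sum>k\<in>UNIV. v $ k *\<^sub>R e $ k) \<le> (\<Sum>k\<in>(UNIV::3 set). norm v * norm e)"
      by (rule sum_norm_le) (auto intro!: mult_mono component_le_norm_cart Finite_Cartesian_Product.norm_nth_le)
    then show "norm (\<Sum>k\<in>UNIV. v $ k *\<^sub>R e $ k) \<le> norm v * norm e * 3"
      by simp
  qed
qed (simp_all add: algebra_simps sum.distrib scaleR_sum_right)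

lemma pairing_axis: "pairing (axis k 1) e = e $ k"
  unfolding pairing_def by (rule sum_axis_nth)

text \<open>For a curl-free field, moving the segment changes the line integral by end-point terms
  only. The variation of the integrand in direction \<open>h\<close> is the
  \<open>t\<close>-derivative of \<open>pairing (c' h t) (E (c x t))\<close>, because the Jacobian
  of \<open>E\<close> is symmetric.\<close>

lemma has_derivative_line_integral:
  fixes E :: "real^3 \<Rightarrow> complex^3" and A P :: "real^3 \<Rightarrow> real^3"
  assumes \<Omega>: "open \<Omega>" and E: "C1_on \<Omega> E"
    and sym: "\<And>x j k. x \<in> \<Omega> \<Longrightarrow> partial j E x $ k = partial k E x $ j"
    and A: "\<And>x. (A has_derivative A') (at x)" and P: "\<And>x. (P has_derivative P') (at x)"
    and U: "open U" "convex U" "x \<in> U"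
    and seg: "\<And>x. x \<in> U \<Longrightarrow> closed_segment (A x) (P x) \<subseteq> \<Omega>"
  shows "((\<lambda>x. integral {0..1} (\<lambda>t. pairing (P x - A x) (E (A x + t *\<^sub>R (P x - A x))))) has_derivative
    (\<lambda>h. pairing (P' h) (E (P x)) - pairing (A' h) (E (A x)))) (at x)"
proof -
  interpret pairing: bounded_bilinear pairing
    by (rule bounded_bilinear_pairing)
  define d where "d x = P x - A x" for x
  define d' where "d' h = P' h - A' h" for h
  define c where "c x t = A x + t *\<^sub>R d x" for x t
  define c' where "c' h t = A' h + t *\<^sub>R d' h" for h t
  define E' where "E' y v = (\<Sum>j\<in>UNIV. v $ j *\<^sub>R partial j E y)" for y and v :: "real^3"
  have lin: "linear A'" "linear P'"
    by (rule has_derivative_linear[OF A], rule has_derivative_linear[OF P])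
  have d: "(d has_derivative d') (at y)" for y
    unfolding d_def[abs_def] d'_def[abs_def] by (intro has_derivative_diff A P)
  have cx: "((\<lambda>y. c y t) has_derivative (\<lambda>h. c' h t)) (at y)" for y t
    unfolding c_def c'_def by (intro has_derivative_add A has_derivative_scaleR_right d)
  have ct: "((\<lambda>t. c y t) has_derivative (\<lambda>s. s *\<^sub>R d y)) (at t within S)" for y t S
    unfolding c_def by (auto intro!: derivative_eq_intros)
  have c\<Omega>: "c y t \<in> \<Omega>" if "y \<in> U" "t \<in> {0..1}" for y t
  proof -
    have "c y t = (1 - t) *\<^sub>R A y + t *\<^sub>R P y"
      by (simp add: c_def d_def algebra_simps)
    then show ?thesis
      using seg[OF that(1)] that(2) by (auto simp: closed_segment_def)
  qed
  have E': "(E has_derivative E' y) (at y)" if "y \<in> \<Omega>" for y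
    unfolding E'_def[abs_def] by (rule has_derivative_partials[OF C1_on_differentiable[OF E that]])
  \<comment> \<open>The symmetric Jacobian lets the variation and the tangent of the path change
    places.\<close>
  have symE: "pairing v (E' y u) = pairing u (E' y v)" if "y \<in> \<Omega>" for u v y
    using sym[OF that, of 1 2] sym[OF that, of 1 3] sym[OF that, of 2 3]
    by (simp add: pairing_def E'_def sum_3 algebra_simps)
  define F where "F y t = pairing (d y) (E (c y t))" for y t
  define G where "G y t h = pairing (d y) (E' (c y t) (c' h t)) + pairing (d' h) (E (c y t))" for y t h
  have contA: "continuous_on S A" and contP: "continuous_on S P" for S
    by (rule has_derivative_continuous_on, rule has_derivative_at_withinI, rule A)
       (rule has_derivative_continuous_on, rule has_derivative_at_withinI, rule P)
  have contc: "continuous_on (U \<times> {0..1}) (\<lambda>p. c (fst p) (snd p))"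
    unfolding c_def d_def
    by (intro continuous_intros continuous_on_compose2[OF contA[of UNIV]] continuous_on_compose2[OF contP[of UNIV]]) auto
  have contd: "continuous_on (U \<times> {0..1::real}) (\<lambda>p. d (fst p))"
    unfolding d_def
    by (intro continuous_intros continuous_on_compose2[OF contA[of UNIV]] continuous_on_compose2[OF contP[of UNIV]]) auto
  have contcomp: "continuous_on (U \<times> {0..1}) (\<lambda>p. u (c (fst p) (snd p)))" if "continuous_on \<Omega> u" for u :: "real^3 \<Rightarrow> complex^3"
    by (rule continuous_on_compose2[OF that contc]) (auto intro: c\<Omega>)
  note contE = contcomp[OF C1_on_continuous[OF E]] and contE' = contcomp[OF C1_on_partial[OF E]]
  have Fx: "((\<lambda>y. F y t) has_derivative G y t) (at y)" if "y \<in> U" "t \<in> {0..1}" for y t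
    unfolding F_def G_def[abs_def]
    by (rule pairing.FDERIV[OF d has_derivative_compose[OF cx E'[OF c\<Omega>[OF that]]]])
  have G_linear: "G y t h = (\<Sum>j\<in>UNIV. h $ j *\<^sub>R G y t (axis j 1))" if "y \<in> U" "t \<in> {0..1}" for y t h
  proof -
    have "linear (G y t)"
      by (rule has_derivative_linear[OF Fx[OF that]])
    then have "(\<Sum>j\<in>UNIV. h $ j *\<^sub>R G y t (axis j 1)) = G y t (\<Sum>j\<in>UNIV. h $ j *\<^sub>R axis j 1)"
      by (simp add: linear_sum linear_cmul)
    then show ?thesis
      by (simp add: basis_expansion flip: scalar_mult_eq_scaleR)
  qed
  have main: "((\<lambda>y. integral {0..1} (F y)) has_derivative
    (\<lambda>h. \<Sum>j\<in>UNIV. h $ j *\<^sub>R integral {0..1} (\<lambda>t. G x t (axis j 1)))) (at x)"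
  proof (rule leibniz_rule_partials[OF U])
    show "((\<lambda>y. F y t) has_derivative (\<lambda>h. \<Sum>j\<in>UNIV. h $ j *\<^sub>R G y t (axis j 1))) (at y)"
      if "y \<in> U" "t \<in> {0..1}" for y t
      using Fx[OF that] by (rule has_derivative_eq_rhs) (rule ext, rule G_linear[OF that])
    show "continuous_on {0..1} (F y)" if "y \<in> U" for y
    proof -
      have "continuous_on (U \<times> {0..1}) (\<lambda>p. F (fst p) (snd p))"
        unfolding F_def by (intro pairing.continuous_on contd contE)
      then have "continuous_on {0..1} (\<lambda>t. F (fst (y, t)) (snd (y, t)))"
        by (rule continuous_on_compose2) (use that in \<open>auto intro!: continuous_intros\<close>)
      then show ?thesis
        by simp
    qed
    show "continuous_on (U \<times> {0..1}) (\<lambda>(y, t). G y t (axis j 1))" for j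
      unfolding G_def split_beta' E'_def c'_def
      by (intro continuous_intros pairing.continuous_on contd contE contE')
  qed
  have "integral {0..1} (\<lambda>t. G x t h) = pairing (P' h) (E (P x)) - pairing (A' h) (E (A x))" for h
  proof -
    \<comment> \<open>\<open>G\<close> was obtained as a derivative in the base point; here it is
      recognised as a derivative in \<open>t\<close> and integrated.\<close>
    have "((\<lambda>t. G x t h) has_integral (pairing (c' h 1) (E (c x 1)) - pairing (c' h 0) (E (c x 0)))) {0..1}"
    proof (rule fundamental_theorem_of_calculus)
      fix t :: real assume t: "t \<in> {0..1}"
      have c't: "(c' h has_derivative (\<lambda>s. s *\<^sub>R d' h)) (at t within {0..1})"
        unfolding c'_def[abs_def] by (auto intro!: derivative_eq_intros)
      have "((\<lambda>t. pairing (c' h t) (E (c x t))) has_derivative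
          (\<lambda>s. pairing (c' h t) (E' (c x t) (s *\<^sub>R d x)) + pairing (s *\<^sub>R d' h) (E (c x t)))) (at t within {0..1})"
        by (rule pairing.FDERIV[OF c't has_derivative_compose[OF ct E'[OF c\<Omega>[OF U(3) t]]]])
      moreover have "pairing (c' h t) (E' (c x t) (s *\<^sub>R d x)) + pairing (s *\<^sub>R d' h) (E (c x t)) = s *\<^sub>R G x t h" for s
      proof -
        have "pairing (c' h t) (E' (c x t) (s *\<^sub>R d x)) = s *\<^sub>R pairing (c' h t) (E' (c x t) (d x))"
          by (simp add: E'_def pairing.scaleR_right scaleR_sum_right[symmetric] flip: scaleR_scaleR)
        also have "\<dots> = s *\<^sub>R pairing (d x) (E' (c x t) (c' h t))"
          using symE[OF c\<Omega>[OF U(3) t]] by simp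
        finally show ?thesis
          by (simp add: G_def pairing.scaleR_left scaleR_add_right)
      qed
      ultimately show "((\<lambda>t. pairing (c' h t) (E (c x t))) has_vector_derivative G x t h) (at t within {0..1})"
        by (simp add: has_vector_derivative_def)
    qed simp
    then show ?thesis
      by (simp add: integral_unique c'_def d'_def c_def d_def)
  qed
  note int = this
  define L where "L h = pairing (P' h) (E (P x)) - pairing (A' h) (E (A x))" for h
  have L: "linear L"
    by (rule linearI)
       (simp_all add: L_def linear_add[OF lin(1)] linear_add[OF lin(2)] linear_cmul[OF lin(1)]
          linear_cmul[OF lin(2)] pairing.add_left pairing.scaleR_left scaleR_diff_right)
  have "(\<Sum>j\<in>UNIV. h $ j *\<^sub>R integral {0..1} (\<lambda>t. G x t (axis j 1))) = L h" for h
  proof -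
    have "(\<Sum>j\<in>UNIV. h $ j *\<^sub>R L (axis j 1)) = L (\<Sum>j\<in>UNIV. h $ j *\<^sub>R axis j 1)"
      by (simp add: linear_sum[OF L] linear_cmul[OF L])
    also have "(\<Sum>j\<in>UNIV. h $ j *\<^sub>R axis j 1) = h"
      by (simp add: basis_expansion flip: scalar_mult_eq_scaleR)
    finally show ?thesis
      by (simp only: int L_def)
  qed
  then have "(\<lambda>h. \<Sum>j\<in>UNIV. h $ j *\<^sub>R integral {0..1} (\<lambda>t. G x t (axis j 1))) = L"
    by (rule ext)
  with main have "((\<lambda>y. integral {0..1} (F y)) has_derivative L) (at x)"
    by (simp only:)
  then show ?thesis
    unfolding F_def[abs_def] c_def d_def L_def[abs_def] .
qed

text \<open>Integrate the mixed derivative along the \<open>k\<close> direction, differentiate under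
  the integral in the \<open>j\<close> direction, and then differentiate in the upper limit. The
  result makes the gradient of a harmonic function curl-free.\<close>

lemma partial_commute:
  fixes u :: "real^3 \<Rightarrow> complex"
  assumes \<Omega>: "open \<Omega>" and u: "C1_on \<Omega> u" and pu: "\<And>k. C1_on \<Omega> (partial k u)" and x: "x \<in> \<Omega>"
  shows "partial j (partial k u) x = partial k (partial j u) x"
proof -
  obtain r where r: "r > 0" "ball x r \<subseteq> \<Omega>"
    using \<Omega> x by (auto simp: open_contains_ball)
  \<comment> \<open>With both steps at most r/3 the point stays at distance at most 2r/3 <
    r.\<close>
  define \<delta> where "\<delta> = r / 3"
  have \<delta>: "\<delta> > 0"
    using r by (simp add: \<delta>_def)
  define y where "y s t = x + s *\<^sub>R axis j 1 + t *\<^sub>R axis k (1::real)" for s t :: real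
  have y\<Omega>: "y s t \<in> \<Omega>" if "\<bar>s\<bar> \<le> \<delta>" "\<bar>t\<bar> \<le> \<delta>" for s t
  proof -
    have "norm (s *\<^sub>R axis j 1 + t *\<^sub>R axis k (1::real)) \<le> \<bar>s\<bar> + \<bar>t\<bar>"
      by (rule order_trans[OF norm_triangle_ineq]) simp
    also have "\<dots> < r"
      using that \<delta> unfolding \<delta>_def by linarith
    finally have "dist (y s t) x < r"
      by (simp add: y_def dist_norm algebra_simps)
    then show ?thesis
      using r(2) by (auto simp: dist_commute)
  qed
  have dt: "((\<lambda>t. v (y s t)) has_vector_derivative partial k v (y s t)) (at t within S)"
    and ds: "((\<lambda>s. v (y s t)) has_vector_derivative partial j v (y s t)) (at s within S)"
    if "\<bar>s\<bar> \<le> \<delta>" "\<bar>t\<bar> \<le> \<delta>" "C1_on \<Omega> v" for v :: "real^3 \<Rightarrow> complex" and s t S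
  proof -
    note dv = has_derivative_partials[OF C1_on_differentiable[OF that(3) y\<Omega>[OF that(1,2)]]]
    have "((\<lambda>t. y s t) has_derivative (\<lambda>h. h *\<^sub>R axis k 1)) (at t within S)"
      unfolding y_def by (auto intro!: derivative_eq_intros)
    from has_derivative_compose[OF this dv]
    show "((\<lambda>t. v (y s t)) has_vector_derivative partial k v (y s t)) (at t within S)"
      unfolding has_vector_derivative_def
      by (simp add: sum_axis_nth flip: scaleR_scaleR scaleR_sum_right)
    have "((\<lambda>s. y s t) has_derivative (\<lambda>h. h *\<^sub>R axis j 1)) (at s within S)"
      unfolding y_def by (auto intro!: derivative_eq_intros)
    from has_derivative_compose[OF this dv]
    show "((\<lambda>s. v (y s t)) has_vector_derivative partial j v (y s t)) (at s within S)"
      unfolding has_vector_derivative_def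
      by (simp add: sum_axis_nth flip: scaleR_scaleR scaleR_sum_right)
  qed
  have conty: "continuous_on S (\<lambda>p. y (fst p) (snd p))" for S
    unfolding y_def by (intro continuous_intros)
  have contp: "continuous_on ({- \<delta>..\<delta>} \<times> {0..t}) (\<lambda>p. v (y (fst p) (snd p)))"
    if "continuous_on \<Omega> v" "t \<le> \<delta>" for v :: "real^3 \<Rightarrow> complex" and t
    by (rule continuous_on_compose2[OF that(1) conty]) (use that(2) in \<open>auto intro!: y\<Omega>\<close>)
  have contt: "continuous_on {0..t} (\<lambda>\<tau>. v (y s \<tau>))"
    if "continuous_on \<Omega> v" "t \<le> \<delta>" "\<bar>s\<bar> \<le> \<delta>" for v :: "real^3 \<Rightarrow> complex" and s t
  proof -
    have "continuous_on {0..t} (\<lambda>\<tau>. v (y (fst (s, \<tau>)) (snd (s, \<tau>))))"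
      by (rule continuous_on_compose2[OF contp[OF that(1,2)]]) (use that in \<open>auto intro!: continuous_intros\<close>)
    then show ?thesis
      by simp
  qed
  let ?ujk = "partial j (partial k u)"
  have eq: "integral {0..t} (\<lambda>\<tau>. ?ujk (y 0 \<tau>)) = partial j u (y 0 t) - partial j u (y 0 0)"
    if t: "0 \<le> t" "t \<le> \<delta>" for t
  proof -
    have G: "integral {0..t} (\<lambda>\<tau>. partial k u (y s \<tau>)) = u (y s t) - u (y s 0)" if "s \<in> {- \<delta>..\<delta>}" for s
    proof (rule integral_unique, rule fundamental_theorem_of_calculus[OF t(1)])
      show "((\<lambda>\<tau>. u (y s \<tau>)) has_vector_derivative partial k u (y s \<tau>)) (at \<tau> within {0..t})"
        if "\<tau> \<in> {0..t}" for \<tau>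
        using that t \<open>s \<in> {- \<delta>..\<delta>}\<close> by (intro dt[OF _ _ u]) auto
    qed
    \<comment> \<open>The \<open>s\<close>-derivative at 0 of one function is computed twice: under
      the integral sign, and from its closed form \<open>G\<close>.\<close>
    have "((\<lambda>s. integral (cbox 0 t) (\<lambda>\<tau>. partial k u (y s \<tau>))) has_vector_derivative
        integral (cbox 0 t) (\<lambda>\<tau>. ?ujk (y 0 \<tau>))) (at 0 within {- \<delta>..\<delta>})"
    proof (rule leibniz_rule_vector_derivative)
      show "((\<lambda>s. partial k u (y s \<tau>)) has_vector_derivative ?ujk (y s \<tau>)) (at s within {- \<delta>..\<delta>})"
        if "s \<in> {- \<delta>..\<delta>}" "\<tau> \<in> cbox 0 t" for s \<tau>
        using that t by (intro ds[OF _ _ pu]) auto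
      show "(\<lambda>\<tau>. partial k u (y s \<tau>)) integrable_on cbox 0 t" if "s \<in> {- \<delta>..\<delta>}" for s
      proof -
        have "\<bar>s\<bar> \<le> \<delta>"
          using that by auto
        from integrable_continuous_real[OF contt[OF C1_on_continuous[OF pu] t(2) this]] show ?thesis
          by simp
      qed
      show "continuous_on ({- \<delta>..\<delta>} \<times> cbox 0 t) (\<lambda>(s, \<tau>). ?ujk (y s \<tau>))"
        using contp[OF C1_on_partial[OF pu] t(2)] by (simp add: split_beta')
    qed (use \<delta> in auto)
    then have 1: "((\<lambda>s. integral {0..t} (\<lambda>\<tau>. partial k u (y s \<tau>))) has_vector_derivative
        integral {0..t} (\<lambda>\<tau>. ?ujk (y 0 \<tau>))) (at 0 within {- \<delta>..\<delta>})"
      by simp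
    have "((\<lambda>s. u (y s t) - u (y s 0)) has_vector_derivative (partial j u (y 0 t) - partial j u (y 0 0))) (at 0 within {- \<delta>..\<delta>})"
      using t \<delta> by (intro has_vector_derivative_diff ds[OF _ _ u]) auto
    then have 2: "((\<lambda>s. integral {0..t} (\<lambda>\<tau>. partial k u (y s \<tau>))) has_vector_derivative
        (partial j u (y 0 t) - partial j u (y 0 0))) (at 0 within {- \<delta>..\<delta>})"
      by (rule has_vector_derivative_transform[rotated 2]) (use \<delta> G in auto)
    show ?thesis
      by (rule vector_derivative_unique_within_closed_interval[OF _ _ 1[folded cbox_interval[of "- \<delta>" \<delta>]] 2[folded cbox_interval[of "- \<delta>" \<delta>]]]) (use \<delta> in auto)
  qed
  \<comment> \<open>The same method in \<open>t\<close>, with one-sided derivatives at 0: once by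
    the fundamental theorem, once by \<open>eq\<close>.\<close>
  have 1: "((\<lambda>t. integral {0..t} (\<lambda>\<tau>. ?ujk (y 0 \<tau>))) has_vector_derivative ?ujk (y 0 0)) (at 0 within {0..\<delta>})"
    by (rule integral_has_vector_derivative[OF contt[OF C1_on_partial[OF pu]]]) (use \<delta> in auto)
  have 2: "((\<lambda>t. integral {0..t} (\<lambda>\<tau>. ?ujk (y 0 \<tau>))) has_vector_derivative partial k (partial j u) (y 0 0)) (at 0 within {0..\<delta>})"
  proof (rule has_vector_derivative_transform)
    show "((\<lambda>t. partial j u (y 0 t) - partial j u (y 0 0)) has_vector_derivative partial k (partial j u) (y 0 0)) (at 0 within {0..\<delta>})"
      using has_vector_derivative_diff[OF dt[OF _ _ pu[of j], of 0 0] has_vector_derivative_const[of "partial j u (y 0 0)"]] \<delta>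
      by simp
  qed (use eq \<delta> in auto)
  have "?ujk (y 0 0) = partial k (partial j u) (y 0 0)"
    by (rule vector_derivative_unique_within_closed_interval[OF _ _ 1[folded cbox_interval[of 0 \<delta>]] 2[folded cbox_interval[of 0 \<delta>]]])
       (use \<delta> in auto)
  then show ?thesis
    by (simp add: y_def)
qed

section \<open>The curl of the Newtonian vector potential\<close>

text \<open>This collects what the quaternionic computation needs to know about rot B[f w], so that
  the integral operator does not appear there.\<close>

definition solenoidal_inverse_curl :: "(real^3) set \<Rightarrow> (real^3 \<Rightarrow> complex^3) \<Rightarrow> (real^3 \<Rightarrow> complex^3) \<Rightarrow> bool"
  where "solenoidal_inverse_curl \<Omega> Q C \<longleftrightarrow> C1_on \<Omega> C \<and>
    (\<forall>x\<in>\<Omega>. rot C x = Q x \<and> (\<Sum>k\<in>UNIV. partial k (\<lambda>y. C y $ k) x) = 0)"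

text \<open>The factor 1/(4 pi) in \<open>Bop\<close> normalises the trace of the second derivatives
  to -Q. That the curl is again divergence-free needs only their symmetry.\<close>

lemma
  assumes \<Omega>: "open \<Omega>" "\<Omega> \<noteq> {}" and Q: "C1_on \<Omega> Q"
    and B: "Bop_defined \<Omega> Q" and zt: "zero_normal_trace \<Omega> Q"
  shows Bop_differentiable: "x \<in> \<Omega> \<Longrightarrow> Bop \<Omega> Q differentiable at x"
    and rot_Bop: "solenoidal_inverse_curl \<Omega> Q (rot (Bop \<Omega> Q))"
proof -
  have nd: "newton_density \<Omega> Q"
    using \<Omega> Q B by unfold_locales (auto simp: Bop_defined_def)
  interpret newton_density \<Omega> Q
    by (rule nd)
  \<comment> \<open>\<open>V k\<close> is the \<open>k\<close>-th partial derivative of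
    \<open>Bop \<Omega> Q\<close>, but as a function on the whole space.\<close>
  define V where "V k y = (1 / (4 * pi)) *\<^sub>R conv (soft1 0 k) y" for k y
  have bl: "bounded_linear (\<lambda>v::complex^3. (1 / (4 * pi)) *\<^sub>R v)"
    by (rule bounded_linear_scaleR_right)
  have dB: "(Bop \<Omega> Q has_derivative (\<lambda>h. \<Sum>j\<in>UNIV. h $ j *\<^sub>R V j x)) (at x)" if "x \<in> \<Omega>" for x
  proof -
    have "Bop \<Omega> Q = (\<lambda>x. (1 / (4 * pi)) *\<^sub>R conv (soft 0) x)"
      by (rule ext) (rule Bop_eq_newton[OF nd])
    moreover have "(1 / (4 * pi)) *\<^sub>R (\<Sum>j\<in>UNIV. h $ j *\<^sub>R conv (soft1 0 j) x) = (\<Sum>j\<in>UNIV. h $ j *\<^sub>R V j x)" for h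
      unfolding V_def scaleR_sum_right by (rule sum.cong) (simp_all add: mult_ac)
    ultimately show ?thesis
      using bounded_linear.has_derivative[OF bl has_derivative_newton[OF that]] by (simp only:)
  qed
  show diffB: "Bop \<Omega> Q differentiable at x" if "x \<in> \<Omega>" for x
    unfolding differentiable_def by (rule exI, rule dB[OF that])
  have V: "C1_on \<Omega> (V k)" for k
    unfolding V_def[abs_def] by (rule C1_on_bounded_linear[OF bl C1_on_newton1])
  have pV: "partial j (V k) x = (1 / (4 * pi)) *\<^sub>R partial j (conv (soft1 0 k)) x" if "x \<in> \<Omega>" for x j k
    unfolding V_def[abs_def] by (rule partial_bounded_linear[OF bl differentiable_newton1[OF that]])
  have V_sym: "partial j (V k) x = partial k (V j) x" if "x \<in> \<Omega>" for x j k
    unfolding pV[OF that] partial_newton1_commute[OF that, of j k] ..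
  have V_trace: "(\<Sum>j\<in>UNIV. partial j (V j) x) = - Q x" if "x \<in> \<Omega>" for x
    unfolding pV[OF that] scaleR_sum_right[symmetric] partial_newton1_trace[OF that] by simp
  have V_div: "(\<Sum>k\<in>UNIV. V k x $ k) = 0" if "x \<in> \<Omega>" for x
  proof -
    \<comment> \<open>All terms of this sequence are 0, by the zero normal trace at the positive
      parameter \<open>eps n\<close>.\<close>
    have "(\<lambda>n. \<Sum>k\<in>UNIV. conv (soft1 (eps n) k) x $ k) \<longlonglongrightarrow> (\<Sum>k\<in>UNIV. conv (soft1 0 k) x $ k)"
      by (intro tendsto_sum tendsto_vec_nth newton1_tendsto[OF that])
    then have "(\<Sum>k\<in>UNIV. conv (soft1 0 k) x $ k) = 0"
      by (simp add: div_regularised_newton[OF nd zt eps_pos] LIMSEQ_const_iff)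
    then show ?thesis
      by (simp add: V_def flip: scaleR_sum_right)
  qed
  have Vi: "C1_on \<Omega> (\<lambda>y. V k y $ i)" for k i
    using V[of k] C1_on_vec_iff by blast
  have pVi: "partial j (\<lambda>y. V k y $ i) x = partial j (V k) x $ i" if "x \<in> \<Omega>" for j k i x
    by (rule partial_nth[OF C1_on_differentiable[OF V that]])
  note dVi = C1_on_differentiable[OF Vi]
  have V_div': "(\<Sum>k\<in>UNIV. partial j (V k) x $ k) = 0" if x: "x \<in> \<Omega>" for j x
  proof -
    \<comment> \<open>The divergence vanishes on the whole open set, so its partial derivatives
      vanish too; this is the grad div term.\<close>
    have "partial j (\<lambda>y. (V 1 y $ 1 + V 2 y $ 2) + V 3 y $ 3) x = partial j (\<lambda>y. 0) x"
      using V_div by (intro partial_cong_open[OF \<Omega>(1) _ x]) (simp add: sum_3)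
    also have "partial j (\<lambda>y. 0 :: complex) x = 0"
      using partial_eq[OF has_derivative_const] .
    also have "partial j (\<lambda>y. (V 1 y $ 1 + V 2 y $ 2) + V 3 y $ 3) x
        = partial j (V 1) x $ 1 + partial j (V 2) x $ 2 + partial j (V 3) x $ 3"
      by (simp add: partial_add dVi[OF x] differentiable_add pVi[OF x])
    finally show ?thesis
      by (simp add: sum_3)
  qed
  have pB: "partial k (\<lambda>y. Bop \<Omega> Q y $ i) x = V k x $ i" if "x \<in> \<Omega>" for k i x
    by (simp add: partial_nth[OF diffB[OF that]] partial_eq_coeff[OF dB[OF that]])
  \<comment> \<open>A formula for the curl without \<open>partial\<close>, valid on \<Omega>, which
    can then be differentiated component by component.\<close>
  define C where "C y = (vector [V 2 y $ 3 - V 3 y $ 2, V 3 y $ 1 - V 1 y $ 3, V 1 y $ 2 - V 2 y $ 1] :: complex^3)" for y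
  have C_nth: "C y $ 1 = V 2 y $ 3 - V 3 y $ 2" "C y $ 2 = V 3 y $ 1 - V 1 y $ 3" "C y $ 3 = V 1 y $ 2 - V 2 y $ 1" for y
    by (simp_all add: C_def)
  have rotB: "rot (Bop \<Omega> Q) y = C y" if "y \<in> \<Omega>" for y
    by (simp add: rot_def C_def pB[OF that])
  have C1C: "C1_on \<Omega> C"
    unfolding C1_on_vec_iff forall_3 C_nth by (intro conjI C1_on_diff Vi)
  have C1r: "C1_on \<Omega> (rot (Bop \<Omega> Q))"
    by (rule C1_on_cong_open[OF \<Omega>(1) rotB C1C])
  have pr: "partial j (\<lambda>y. rot (Bop \<Omega> Q) y $ i) x = partial j (\<lambda>y. C y $ i) x" if "x \<in> \<Omega>" for x j i
    by (rule partial_cong_open[OF \<Omega>(1) _ that]) (simp add: rotB)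
  show "solenoidal_inverse_curl \<Omega> Q (rot (Bop \<Omega> Q))"
    unfolding solenoidal_inverse_curl_def
  proof (intro conjI ballI C1r)
    fix x assume x: "x \<in> \<Omega>"
    note p = pr[OF x] C_nth partial_diff[OF dVi[OF x] dVi[OF x]] pVi[OF x]
    have 1: "partial j (V 1) x $ 1 + partial j (V 2) x $ 2 + partial j (V 3) x $ 3 = 0" for j
      using V_div'[OF x, of j] by (simp add: sum_3)
    have 2: "partial 1 (V 1) x $ i + partial 2 (V 2) x $ i + partial 3 (V 3) x $ i = - Q x $ i" for i
      using arg_cong[OF V_trace[OF x], of "\<lambda>v. v $ i"] by (simp add: sum_3)
    note s = V_sym[OF x, of 2 1] V_sym[OF x, of 3 1] V_sym[OF x, of 3 2]
    \<comment> \<open>Componentwise, \<open>1\<close> is the vanishing gradient of the divergence,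
      \<open>2\<close> is the Laplace equation, and \<open>s\<close> exchanges mixed derivatives;
      the rest is linear algebra.\<close>
    have "rot (rot (Bop \<Omega> Q)) x $ 1 = Q x $ 1"
      using 1[of 1] 2[of 1] unfolding rot_def[of "rot _"] vector_3 p s by algebra
    moreover have "rot (rot (Bop \<Omega> Q)) x $ 2 = Q x $ 2"
      using 1[of 2] 2[of 2] unfolding rot_def[of "rot _"] vector_3 p s by algebra
    moreover have "rot (rot (Bop \<Omega> Q)) x $ 3 = Q x $ 3"
      using 1[of 3] 2[of 3] unfolding rot_def[of "rot _"] vector_3 p s by algebra
    ultimately show "rot (rot (Bop \<Omega> Q)) x = Q x"
      by (simp add: vec_eq_iff forall_3)
    show "(\<Sum>k\<in>UNIV. partial k (\<lambda>y. rot (Bop \<Omega> Q) y $ k) x) = 0"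
      unfolding sum_3 p s by simp
  qed
qed

section \<open>The path potential\<close>

text \<open>The substitution replaces an oriented interval with moving end points by the fixed
  interval from 0 to 1, also when \<open>b < a\<close>.\<close>

lemma interval_integral_affine:
  fixes g :: "real \<Rightarrow> complex"
  assumes "continuous_on (closed_segment a b) g"
  shows "(LBINT \<xi>=ereal a..ereal b. g \<xi>) = integral {0..1} (\<lambda>t. (b - a) *\<^sub>R g (a + t * (b - a)))"
proof -
  have img: "(\<lambda>t. a + t * (b - a)) ` {0..1} = closed_segment a b"
    unfolding closed_segment_def by (auto simp: algebra_simps image_def Bex_def)
  have "(LBINT t=ereal 0..ereal 1. (b - a) *\<^sub>R g (a + t * (b - a)))
      = (LBINT \<xi>=ereal (a + 0 * (b - a))..ereal (a + 1 * (b - a)). g \<xi>)"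
    by (rule interval_integral_substitution_finite)
       (auto intro!: derivative_eq_intros simp: img assms)
  moreover have "(LBINT t=ereal 0..ereal 1. (b - a) *\<^sub>R g (a + t * (b - a)))
      = integral {0..1} (\<lambda>t. (b - a) *\<^sub>R g (a + t * (b - a)))"
  proof (rule interval_integral_eq_integral)
    have "continuous_on {0..1} (\<lambda>t. g (a + t * (b - a)))"
      by (rule continuous_on_compose2[OF assms]) (use img in \<open>auto intro!: continuous_intros\<close>)
    then show "set_integrable lborel {0..1} (\<lambda>t. (b - a) *\<^sub>R g (a + t * (b - a)))"
      by (intro borel_integrable_atLeastAtMost' continuous_intros)
  qed simp
  ultimately show ?thesis
    by simp
qed

text \<open>Each of the three integrals is a line integral along a segment whose end points depend
  linearly on \<open>x\<close> up to constants, so \<open>has_derivative_line_integral\<close>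
  applies to every leg.\<close>

lemma scalar_potential_path_potential:
  assumes \<Omega>: "open \<Omega>" and E: "C1_on \<Omega> E" and rotE: "\<And>x. x \<in> \<Omega> \<Longrightarrow> rot E x = 0"
    and adm: "path_admissible \<Omega> p"
  shows "scalar_potential \<Omega> E (path_potential p c E)"
proof -
  define P0 :: "real^3 \<Rightarrow> real^3" where "P0 x = p" for x
  define P1 :: "real^3 \<Rightarrow> real^3" where "P1 x = vector [x $ 1, p $ 2, p $ 3]" for x
  define P2 :: "real^3 \<Rightarrow> real^3" where "P2 x = vector [x $ 1, x $ 2, p $ 3]" for x
  define P3 :: "real^3 \<Rightarrow> real^3" where "P3 x = x" for x
  note Pdef = P0_def P1_def P2_def P3_def
  define D1 :: "real^3 \<Rightarrow> real^3" where "D1 h = h $ 1 *\<^sub>R axis 1 1" for h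
  define D2 :: "real^3 \<Rightarrow> real^3" where "D2 h = h $ 1 *\<^sub>R axis 1 1 + h $ 2 *\<^sub>R axis 2 1" for h
  have e1: "P1 x = x $ 1 *\<^sub>R axis 1 1 + (p $ 2 *\<^sub>R axis 2 1 + p $ 3 *\<^sub>R axis 3 1)"
    and e2: "P2 x = (x $ 1 *\<^sub>R axis 1 1 + x $ 2 *\<^sub>R axis 2 1) + p $ 3 *\<^sub>R axis 3 1" for x
    by (simp_all add: Pdef vec_eq_iff forall_3 axis_def)
  have nth: "((\<lambda>x::real^3. x $ k *\<^sub>R v) has_derivative (\<lambda>h. h $ k *\<^sub>R v)) (at x)" for k and v :: "real^3" and x
    by (intro bounded_linear_imp_has_derivative bounded_linear_compose[OF bounded_linear_scaleR_left bounded_linear_vec_nth])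
  have d0: "(P0 has_derivative (\<lambda>h. 0)) (at x)" for x
    unfolding P0_def[abs_def] by (rule has_derivative_const)
  have d1: "(P1 has_derivative D1) (at x)" for x
    unfolding e1[abs_def] D1_def[abs_def]
    using has_derivative_add[OF nth[of 1 "axis 1 1" x] has_derivative_const] by simp
  have d2: "(P2 has_derivative D2) (at x)" for x
    unfolding e2[abs_def] D2_def[abs_def]
    using has_derivative_add[OF has_derivative_add[OF nth[of 1 "axis 1 1" x] nth[of 2 "axis 2 1" x]] has_derivative_const] by simp
  have d3: "(P3 has_derivative (\<lambda>h. h)) (at x)" for x
    unfolding P3_def[abs_def] by (rule has_derivative_ident)
  have seg: "closed_segment (P0 x) (P1 x) \<subseteq> \<Omega>" "closed_segment (P1 x) (P2 x) \<subseteq> \<Omega>" "closed_segment (P2 x) (P3 x) \<subseteq> \<Omega>"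
    if "x \<in> \<Omega>" for x
    using adm that unfolding path_admissible_def Pdef by blast+
  have nth': "partial j (\<lambda>y. E y $ k) x = partial j E x $ k" if "x \<in> \<Omega>" for j k x
    by (rule partial_nth[OF C1_on_differentiable[OF E that]])
  have sym: "partial j E x $ k = partial k E x $ j" if x: "x \<in> \<Omega>" for x j k
  proof -
    have "rot E x $ 1 = 0" "rot E x $ 2 = 0" "rot E x $ 3 = 0"
      using rotE[OF x] by simp_all
    then have "partial 2 E x $ 3 = partial 3 E x $ 2" "partial 3 E x $ 1 = partial 1 E x $ 3"
      "partial 1 E x $ 2 = partial 2 E x $ 1"
      by (simp_all add: rot_def nth'[OF x])
    then show ?thesis
      using exhaust_3[of j] exhaust_3[of k] by auto
  qed
  define I where "I A P x = integral {0..1} (\<lambda>t. pairing (P x - A x) (E (A x + t *\<^sub>R (P x - A x))))"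
    for A P :: "real^3 \<Rightarrow> real^3" and x
  have path: "path_potential p c E x = I P0 P1 x + I P1 P2 x + I P2 P3 x + c" if x: "x \<in> \<Omega>" for x
  proof -
    \<comment> \<open>Only the \<open>k\<close>-th coordinate varies along the leg, so the pairing
      with \<open>B - A\<close> picks the \<open>k\<close>-th component of \<open>E\<close>;
      \<open>l\<close> parametrises the leg by that coordinate.\<close>
    have leg: "(LBINT \<xi>=ereal (A $ k)..ereal (B $ k). E (l \<xi>) $ k) = integral {0..1} (\<lambda>t. pairing (B - A) (E (A + t *\<^sub>R (B - A))))"
      if AB: "closed_segment A B \<subseteq> \<Omega>" and l: "\<And>t. l (A $ k + t * (B $ k - A $ k)) = A + t *\<^sub>R (B - A)"
        and ax: "B - A = (B $ k - A $ k) *\<^sub>R axis k 1" and cl: "continuous_on UNIV l" for A B :: "real^3" and k l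
    proof -
      have in_seg: "A + t *\<^sub>R (B - A) \<in> closed_segment A B" if "0 \<le> t" "t \<le> 1" for t
        using that by (auto simp: closed_segment_def algebra_simps intro!: exI[of _ t])
      have "l \<xi> \<in> \<Omega>" if \<xi>: "\<xi> \<in> closed_segment (A $ k) (B $ k)" for \<xi>
      proof -
        obtain t where t: "0 \<le> t" "t \<le> 1" "\<xi> = (1 - t) *\<^sub>R A $ k + t *\<^sub>R B $ k"
          using \<xi> unfolding closed_segment_def by blast
        then have "\<xi> = A $ k + t * (B $ k - A $ k)"
          by (simp add: algebra_simps)
        then show ?thesis
          using in_seg[OF t(1,2)] AB by (auto simp: l)
      qed
      then have "continuous_on (closed_segment (A $ k) (B $ k)) (\<lambda>\<xi>. E (l \<xi>))"
        by (intro continuous_on_compose2[OF C1_on_continuous[OF E] continuous_on_subset[OF cl]]) auto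
      then have "(LBINT \<xi>=ereal (A $ k)..ereal (B $ k). E (l \<xi>) $ k)
          = integral {0..1} (\<lambda>t. (B $ k - A $ k) *\<^sub>R E (l (A $ k + t * (B $ k - A $ k))) $ k)"
        by (intro interval_integral_affine continuous_on_component)
      also have "\<dots> = integral {0..1} (\<lambda>t. pairing (B - A) (E (A + t *\<^sub>R (B - A))))"
      proof -
        have "pairing (B - A) e = (B $ k - A $ k) *\<^sub>R e $ k" for e
          by (subst ax) (simp add: bounded_bilinear.scaleR_left[OF bounded_bilinear_pairing] pairing_axis)
        then show ?thesis
          by (simp add: l)
      qed
      finally show ?thesis .
    qed
    have line: "continuous_on UNIV (\<lambda>\<xi>::real. \<xi> *\<^sub>R axis i 1 + u)" for i :: 3 and u :: "real^3"
      by (intro continuous_intros)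
    have v: "continuous_on UNIV (\<lambda>\<xi>. vector [\<xi>, a, b] :: real^3)"
      "continuous_on UNIV (\<lambda>\<xi>. vector [a, \<xi>, b] :: real^3)"
      "continuous_on UNIV (\<lambda>\<xi>. vector [a, b, \<xi>] :: real^3)" for a b
      by (rule continuous_on_eq[OF line[of 1 "vector [0, a, b]"]], simp add: vec_eq_iff forall_3 axis_def)
         (rule continuous_on_eq[OF line[of 2 "vector [a, 0, b]"]], simp add: vec_eq_iff forall_3 axis_def,
          rule continuous_on_eq[OF line[of 3 "vector [a, b, 0]"]], simp add: vec_eq_iff forall_3 axis_def)
    have "(LBINT \<xi>=p $ 1..x $ 1. E (vector [\<xi>, p $ 2, p $ 3]) $ 1) = I P0 P1 x"
    proof -
      have nth: "P0 x $ 1 = p $ 1" "P1 x $ 1 = x $ 1"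
        by (simp_all add: Pdef)
      have "(LBINT \<xi>=ereal (P0 x $ 1)..ereal (P1 x $ 1). E (vector [\<xi>, p $ 2, p $ 3]) $ 1) = I P0 P1 x"
        unfolding I_def
        by (rule leg[OF seg(1)[OF x] _ _ v(1)]) (simp_all add: Pdef vec_eq_iff forall_3 axis_def)
      then show ?thesis
        unfolding nth .
    qed
    moreover have "(LBINT \<xi>=p $ 2..x $ 2. E (vector [x $ 1, \<xi>, p $ 3]) $ 2) = I P1 P2 x"
    proof -
      have nth: "P1 x $ 2 = p $ 2" "P2 x $ 2 = x $ 2"
        by (simp_all add: Pdef)
      have "(LBINT \<xi>=ereal (P1 x $ 2)..ereal (P2 x $ 2). E (vector [x $ 1, \<xi>, p $ 3]) $ 2) = I P1 P2 x"
        unfolding I_def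
        by (rule leg[OF seg(2)[OF x] _ _ v(2)]) (simp_all add: Pdef vec_eq_iff forall_3 axis_def)
      then show ?thesis
        unfolding nth .
    qed
    moreover have "(LBINT \<xi>=p $ 3..x $ 3. E (vector [x $ 1, x $ 2, \<xi>]) $ 3) = I P2 P3 x"
    proof -
      have nth: "P2 x $ 3 = p $ 3" "P3 x $ 3 = x $ 3"
        by (simp_all add: Pdef)
      have "(LBINT \<xi>=ereal (P2 x $ 3)..ereal (P3 x $ 3). E (vector [x $ 1, x $ 2, \<xi>]) $ 3) = I P2 P3 x"
        unfolding I_def
        by (rule leg[OF seg(3)[OF x] _ _ v(3)]) (simp_all add: Pdef vec_eq_iff forall_3 axis_def)
      then show ?thesis
        unfolding nth .
    qed
    ultimately show ?thesis
      unfolding path_potential_def by simp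
  qed
  have deriv: "(path_potential p c E has_derivative (\<lambda>h. pairing h (E x))) (at x)" if x: "x \<in> \<Omega>" for x
  proof -
    obtain r where r: "r > 0" "ball x r \<subseteq> \<Omega>"
      using \<Omega> x by (auto simp: open_contains_ball)
    have U: "open (ball x r)" "convex (ball x r)" "x \<in> ball x r"
      using r by auto
    have I: "(I A P has_derivative (\<lambda>h. pairing (P' h) (E (P x)) - pairing (A' h) (E (A x)))) (at x)"
      if "\<And>x. (A has_derivative A') (at x)" "\<And>x. (P has_derivative P') (at x)"
        "\<And>x. x \<in> \<Omega> \<Longrightarrow> closed_segment (A x) (P x) \<subseteq> \<Omega>" for A P A' P'
      unfolding I_def[abs_def]
      by (rule has_derivative_line_integral[OF \<Omega> E sym that(1,2) U that(3)[OF subsetD[OF r(2)]]])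
    \<comment> \<open>A telescoping sum: the terms at \<open>P1\<close> and \<open>P2\<close> cancel
      between consecutive legs, the starting point does not move, and the last end point is
      \<open>x\<close> itself.\<close>
    have "((\<lambda>x. I P0 P1 x + I P1 P2 x + I P2 P3 x + c) has_derivative (\<lambda>h.
        (pairing (D1 h) (E (P1 x)) - pairing 0 (E (P0 x))) + (pairing (D2 h) (E (P2 x)) - pairing (D1 h) (E (P1 x)))
        + (pairing h (E (P3 x)) - pairing (D2 h) (E (P2 x))) + 0)) (at x)"
      by (intro has_derivative_add has_derivative_const I d0 d1 d2 d3 seg)
    then have "((\<lambda>x. I P0 P1 x + I P1 P2 x + I P2 P3 x + c) has_derivative (\<lambda>h. pairing h (E x))) (at x)"
      by (simp add: P3_def bounded_bilinear.zero_left[OF bounded_bilinear_pairing])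
    then show ?thesis
      by (rule has_derivative_transform_within_open[OF _ \<Omega> x]) (simp add: path)
  qed
  show ?thesis
    unfolding scalar_potential_def
  proof (intro ballI conjI)
    fix x assume x: "x \<in> \<Omega>"
    show "path_potential p c E differentiable at x"
      unfolding differentiable_def by (rule exI, rule deriv[OF x])
    show "grad (path_potential p c E) x = E x"
      by (simp add: grad_def vec_eq_iff partial_eq[OF deriv[OF x]] pairing_axis)
  qed
qed

section \<open>Quaternionic form\<close>

text \<open>Multiplying by the units from the other side changes only the sign of the cross product,
  hence of the curl.\<close>

lemma
  assumes "(\<lambda>y. vect (Q y)) differentiable at x"
  shows Dl_eq: "Dl Q x = CQ (- (\<Sum>k\<in>UNIV. partial k (\<lambda>y. vect (Q y) $ k) x))
      (grad (\<lambda>y. scal (Q y)) x + rot (\<lambda>y. vect (Q y)) x)"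
    and Dr_eq: "Dr Q x = CQ (- (\<Sum>k\<in>UNIV. partial k (\<lambda>y. vect (Q y) $ k) x))
      (grad (\<lambda>y. scal (Q y)) x - rot (\<lambda>y. vect (Q y)) x)"
  by (simp_all add: Dl_def Dr_def qpartial_def imu_def of_vec_def times_cquat_def plus_cquat_def
      grad_def rot_def partial_nth[OF assms] cdot_def ccross_def axis_def sum_3 vec_eq_iff forall_3)

lemma partial_const: "partial k (\<lambda>y. c) x = 0"
  by (rule partial_eq[OF has_derivative_const])

lemma Dlog_eq: "Dlog f x = CQ 0 ((1 / f x) *s grad f x)"
proof -
  have "Dl (\<lambda>y. of_scalar (f y)) x = CQ 0 (grad f x)"
    by (subst Dl_eq) (simp_all add: of_scalar_def partial_const rot_def)
  then show ?thesis
    by (simp add: Dlog_def of_scalar_def times_cquat_def cdot_def ccross_def vec_eq_iff forall_3)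
qed

text \<open>By the quotient rule, the curl of v/f is 1/f times rot v + v x (grad f)/f, which is the
  vector part of the equation when the scalar part of \<open>w\<close> vanishes.\<close>

lemma rot_eq_0_of_Vekua:
  assumes \<Omega>: "open \<Omega>" and f: "C1_on \<Omega> f" "\<forall>x\<in>\<Omega>. f x \<noteq> 0" and w: "qC1_on \<Omega> w" "\<forall>x\<in>\<Omega>. scal (w x) = 0"
    and eq: "Dl w x + w x * Dlog f x = 0" and x: "x \<in> \<Omega>"
  shows "rot (\<lambda>y. (1 / f y) *s vect (w y)) x = 0"
proof -
  have v: "C1_on \<Omega> (\<lambda>y. vect (w y))"
    using w(1) by (simp add: qC1_on_def)
  then have vi: "C1_on \<Omega> (\<lambda>y. vect (w y) $ i)" for i
    by (simp add: C1_on_vec_iff[of _ "\<lambda>y. vect (w y)"])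
  \<comment> \<open>The scalar part is 0 only on \<Omega>; openness turns this into a vanishing
    gradient.\<close>
  have "grad (\<lambda>y. scal (w y)) x = 0"
    using partial_cong_open[OF \<Omega> _ x, of "\<lambda>y. scal (w y)" "\<lambda>y. 0"] w(2)
    by (simp add: grad_def vec_eq_iff partial_const)
  then have r: "rot (\<lambda>y. vect (w y)) x + ccross (vect (w x)) ((1 / f x) *s grad f x) = 0"
    using eq w(2) x unfolding Dl_eq[OF C1_on_differentiable[OF v x]] Dlog_eq
    by (simp add: times_cquat_def plus_cquat_def zero_cquat_def)
  have nz: "f x \<noteq> 0"
    using f(2) x by simp
  have p: "partial j (\<lambda>y. vect (w y) $ i / f y) x
      = (partial j (\<lambda>y. vect (w y) $ i) x * f x - vect (w x) $ i * partial j f x) / (f x)\<^sup>2" for i j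
    by (rule partial_divide[OF C1_on_differentiable[OF vi x] C1_on_differentiable[OF f(1) x] nz])
  have "rot (\<lambda>y. (1 / f y) *s vect (w y)) x
      = (1 / f x) *s (rot (\<lambda>y. vect (w y)) x + ccross (vect (w x)) ((1 / f x) *s grad f x))"
    using nz by (simp add: rot_def p ccross_def grad_def vec_eq_iff forall_3 divide_simps power2_eq_square)
      (simp add: algebra_simps)
  then show ?thesis
    by (simp add: r)
qed

text \<open>In both operators the terms with grad f cancel. The scalar part then contributes v/2
  through f grad \<phi>, and the vector part contributes v/2 in size through the curl of
  \<open>C\<close>. For \<open>Dl\<close> the two have opposite signs and cancel, for
  \<open>Dr\<close> the curl changes sign and they add up to v; this explains the factor
  1/2.\<close>

lemma solution_of_main_Vekua:
  assumes \<Omega>: "open \<Omega>" and f: "C1_on \<Omega> f" "\<forall>x\<in>\<Omega>. f x \<noteq> 0"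
    and C: "solenoidal_inverse_curl \<Omega> (\<lambda>x. f x *s v x) C"
    and v: "C1_on \<Omega> v"
    and \<phi>: "scalar_potential \<Omega> (\<lambda>x. (1 / f x) *s v x) \<phi>" and h: "harmonic_on \<Omega> h"
    and W: "W = (\<lambda>x. of_scalar (1 / 2) * (of_scalar (f x * \<phi> x) - of_vec ((1 / f x) *s C x)
             + of_vec ((1 / f x) *s grad h x)))"
  shows "qC1_on \<Omega> W \<and> (\<forall>x\<in>\<Omega>. Dl W x - Dlog f x * qconj (W x) = 0) \<and>
    (\<forall>x\<in>\<Omega>. of_vec (v x) = Dr W x - qconj (W x) * Dlog f x)"
proof -
  have bl: "bounded_linear (\<lambda>z::complex. z / 2)"
    by (rule bounded_linear_divide)
  \<comment> \<open>N = grad h - C is divergence-free and has curl -f v: the harmonic function adds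
    a field that is both curl-free and divergence-free.\<close>
  define N where "N i y = partial i h y - C y $ i" for i y
  have sW: "scal (W y) = (f y * \<phi> y) / 2" and vW: "vect (W y) $ i = (N i y / f y) / 2" for y i
    by (simp_all add: W of_scalar_def of_vec_def times_cquat_def plus_cquat_def minus_cquat_def
        cdot_def ccross_def N_def grad_def diff_divide_distrib forall_3 vec_eq_iff)
       (use exhaust_3[of i] in \<open>auto simp: diff_divide_distrib mult.commute\<close>)
  have C1C: "C1_on \<Omega> (\<lambda>y. C y $ i)" for i
    using C C1_on_vec_iff unfolding solenoidal_inverse_curl_def by blast
  have h1: "C1_on \<Omega> h" "C1_on \<Omega> (partial i h)" for i
    using h by (simp_all add: harmonic_on_def)
  have N: "C1_on \<Omega> (N i)" for i
    unfolding N_def[abs_def] by (rule C1_on_diff[OF h1(2) C1C])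
  have p\<phi>: "partial k \<phi> x = v x $ k / f x" if "x \<in> \<Omega>" for k x
    using \<phi> that by (auto simp: scalar_potential_def grad_def vec_eq_iff)
  \<comment> \<open>A scalar potential is only assumed differentiable; its partial derivatives are
    continuous because they equal the components of v/f.\<close>
  have C1\<phi>: "C1_on \<Omega> \<phi>"
    unfolding C1_on_def
  proof (intro conjI ballI allI)
    show "\<phi> differentiable at x" if "x \<in> \<Omega>" for x
      using \<phi> that by (simp add: scalar_potential_def)
    have "C1_on \<Omega> (\<lambda>x. v x $ k)" for k
      using v C1_on_vec_iff by blast
    then have c: "continuous_on \<Omega> (\<lambda>x. v x $ k / f x)" for k
      by (intro C1_on_continuous C1_on_divide f)
    show "continuous_on \<Omega> (partial k \<phi>)" for k
      by (rule continuous_on_eq[OF c[of k]]) (simp add: p\<phi>)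
  qed
  have C1S: "C1_on \<Omega> (\<lambda>y. (f y * \<phi> y) / 2)"
    by (rule C1_on_bounded_linear[OF bl C1_on_mult[OF f(1) C1\<phi>]])
  have C1U: "C1_on \<Omega> (\<lambda>y. (N i y / f y) / 2)" for i
    by (rule C1_on_bounded_linear[OF bl C1_on_divide[OF N f]])
  have C1vW: "C1_on \<Omega> (\<lambda>y. vect (W y))"
    by (subst C1_on_vec_iff) (simp only: vW C1U simp_thms)
  have "qC1_on \<Omega> W"
    unfolding qC1_on_def by (rule conjI) (simp_all only: sW C1S C1vW)
  moreover have "Dl W x - Dlog f x * qconj (W x) = 0 \<and> of_vec (v x) = Dr W x - qconj (W x) * Dlog f x"
    if x: "x \<in> \<Omega>" for x
  proof -
    have nz: "f x \<noteq> 0"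
      using f x by simp
    note df = C1_on_differentiable[OF f(1) x] and d\<phi> = C1_on_differentiable[OF C1\<phi> x] and dN = C1_on_differentiable[OF N x]
    have pS: "partial j (\<lambda>y. scal (W y)) x = (partial j f x * \<phi> x + v x $ j) / 2" for j
      unfolding sW using nz
      by (simp add: partial_bounded_linear[OF bl differentiable_mult[OF df d\<phi>]] partial_mult[OF df d\<phi>] p\<phi>[OF x])
    have pU: "partial j (\<lambda>y. vect (W y) $ i) x
        = ((partial j (N i) x * f x - N i x * partial j f x) / (f x)\<^sup>2) / 2" for i j
      unfolding vW
      by (simp only: partial_bounded_linear[OF bl differentiable_divide[OF dN df nz]] partial_divide[OF dN df nz])
    have pN: "partial j (N i) x = partial j (partial i h) x - partial j (\<lambda>y. C y $ i) x" for i j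
      unfolding N_def[abs_def] by (rule partial_diff[OF C1_on_differentiable[OF h1(2) x] C1_on_differentiable[OF C1C x]])
    \<comment> \<open>\<open>trace\<close> and \<open>curl\<close> are solved for four different
      partial derivatives of \<open>N\<close>, so that they can act as rewrite rules in the final
      computation.\<close>
    have trace: "partial 1 (N 1) x = - (partial 2 (N 2) x + partial 3 (N 3) x)"
    proof -
      have "(\<Sum>k\<in>UNIV. partial k (partial k h) x) = 0" "(\<Sum>k\<in>UNIV. partial k (\<lambda>y. C y $ k) x) = 0"
        using h C x by (simp_all add: harmonic_on_def solenoidal_inverse_curl_def)
      then show ?thesis
        unfolding pN sum_3 by algebra
    qed
    have rC: "rot C x = f x *s v x"
      using C x by (simp add: solenoidal_inverse_curl_def)
    note sh = partial_commute[OF \<Omega> h1(1) h1(2) x, of 2 1] partial_commute[OF \<Omega> h1(1) h1(2) x, of 3 1]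
      partial_commute[OF \<Omega> h1(1) h1(2) x, of 3 2]
    have curl: "partial 2 (N 3) x = partial 3 (N 2) x - f x * v x $ 1"
      "partial 3 (N 1) x = partial 1 (N 3) x - f x * v x $ 2"
      "partial 1 (N 2) x = partial 2 (N 1) x - f x * v x $ 3"
      using arg_cong[OF rC, of "\<lambda>u. u $ 1"] arg_cong[OF rC, of "\<lambda>u. u $ 2"] arg_cong[OF rC, of "\<lambda>u. u $ 3"]
      unfolding pN sh by (simp_all add: rot_def algebra_simps)
    note dvW = C1_on_differentiable[OF C1vW x]
    show ?thesis
      unfolding Dl_eq[OF dvW] Dr_eq[OF dvW] Dlog_eq qconj_def of_vec_def grad_def rot_def sum_3 pS pU
      unfolding sW
      using nz
      by (simp add: times_cquat_def minus_cquat_def zero_cquat_def cdot_def ccross_def sum_3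
          vec_eq_iff forall_3 vW trace curl divide_simps power2_eq_square)
        (simp add: algebra_simps)
  qed
  ultimately show ?thesis
    by blast
qed

theorem theorem10:
  fixes \<Omega> :: "(real^3) set"
    and f :: "real^3 \<Rightarrow> complex"
    and w :: "real^3 \<Rightarrow> cquat"
  assumes "open \<Omega>" and "connected \<Omega>" and "\<Omega> \<noteq> {}"
    and "C1_on \<Omega> f" and "\<forall>x\<in>\<Omega>. f x \<noteq> 0"
    and "qC1_on \<Omega> w" and "\<forall>x\<in>\<Omega>. scal (w x) = 0"
    and "\<forall>x\<in>\<Omega>. Dl w x + w x * Dlog f x = 0"
    and "Bop_defined \<Omega> (\<lambda>x. f x *s vect (w x))"
    and "zero_normal_trace \<Omega> (\<lambda>x. f x *s vect (w x))"
  shows "(\<forall>x\<in>\<Omega>. rot (\<lambda>y. (1 / f y) *s vect (w y)) x = 0) \<and>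
    (\<forall>p c. path_admissible \<Omega> p \<longrightarrow>
      scalar_potential \<Omega> (\<lambda>x. (1 / f x) *s vect (w x))
        (path_potential p c (\<lambda>x. (1 / f x) *s vect (w x)))) \<and>
    (\<forall>x\<in>\<Omega>. Bop \<Omega> (\<lambda>y. f y *s vect (w y)) differentiable at x) \<and>
    (\<forall>\<phi> h W. scalar_potential \<Omega> (\<lambda>x. (1 / f x) *s vect (w x)) \<phi> \<and> harmonic_on \<Omega> h \<and>
      W = (\<lambda>x. of_scalar (1 / 2) *
            (of_scalar (f x * \<phi> x)
             - of_vec ((1 / f x) *s rot (Bop \<Omega> (\<lambda>y. f y *s vect (w y))) x)
             + of_vec ((1 / f x) *s grad h x))) \<longrightarrow>
      qC1_on \<Omega> W \<and>
      (\<forall>x\<in>\<Omega>. Dl W x - Dlog f x * qconj (W x) = 0) \<and>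
      (\<forall>x\<in>\<Omega>. w x = Dr W x - qconj (W x) * Dlog f x))"
proof -
  let ?E = "\<lambda>x. (1 / f x) *s vect (w x)" and ?Q = "\<lambda>x. f x *s vect (w x)"
  have v: "C1_on \<Omega> (\<lambda>y. vect (w y))"
    using assms(6) by (simp add: qC1_on_def)
  then have vi: "C1_on \<Omega> (\<lambda>y. vect (w y) $ i)" for i
    by (simp add: C1_on_vec_iff[of _ "\<lambda>y. vect (w y)"])
  have E: "C1_on \<Omega> ?E"
    by (subst C1_on_vec_iff) (simp add: C1_on_divide[OF vi assms(4,5)])
  have Q: "C1_on \<Omega> ?Q"
    by (subst C1_on_vec_iff) (simp add: C1_on_mult[OF assms(4) vi])
  have rotE: "rot ?E x = 0" if "x \<in> \<Omega>" for x
    using assms(8) that by (intro rot_eq_0_of_Vekua[OF assms(1,4,5,6,7)]) auto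
  \<comment> \<open>Since \<open>w\<close> is purely vectorial on \<Omega>, recovering its vector
    part recovers \<open>w\<close>.\<close>
  have of_vec_w: "of_vec (vect (w x)) = w x" if "x \<in> \<Omega>" for x
    using assms(7) that by (cases "w x") (auto simp: of_vec_def)
  note B = Bop_differentiable[OF assms(1,3) Q assms(9,10)] rot_Bop[OF assms(1,3) Q assms(9,10)]
  show ?thesis
  proof (intro conjI allI impI ballI)
    show "scalar_potential \<Omega> ?E (path_potential p c ?E)" if "path_admissible \<Omega> p" for p c
      by (rule scalar_potential_path_potential[OF assms(1) E rotE that])
  next
    fix \<phi> h W
    assume *: "scalar_potential \<Omega> ?E \<phi> \<and> harmonic_on \<Omega> h \<and>
      W = (\<lambda>x. of_scalar (1 / 2) * (of_scalar (f x * \<phi> x)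
             - of_vec ((1 / f x) *s rot (Bop \<Omega> ?Q) x) + of_vec ((1 / f x) *s grad h x)))"
    note main = solution_of_main_Vekua[OF assms(1,4,5) B(2) v]
    from * main[of \<phi> h W] have **: "qC1_on \<Omega> W \<and> (\<forall>x\<in>\<Omega>. Dl W x - Dlog f x * qconj (W x) = 0) \<and>
      (\<forall>x\<in>\<Omega>. of_vec (vect (w x)) = Dr W x - qconj (W x) * Dlog f x)"
      by blast
    then show "qC1_on \<Omega> W"
      by blast
    show "Dl W x - Dlog f x * qconj (W x) = 0" if "x \<in> \<Omega>" for x
      using ** that by blast
    show "w x = Dr W x - qconj (W x) * Dlog f x" if "x \<in> \<Omega>" for x
      using ** that of_vec_w[OF that] by simp
  qed (simp_all add: rotE B(1))
qed

end
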